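(* Let $n,k,m$ be integers with $n\neq0$ and $k\ne 0$. (i) For a diagram $D$ of an oriented virtual knot $K$, the polynomial $$\widetilde F_K^{n,k,m}(t,\ell,v)=\sum_{c\in C(D)}\operatorname{sgn}(c)\,t^{\operatorname{Ind}(c)}\ell^{\nabla J_n(D_c)}v^{\operatorname{fspan}_{k,m}(D^c)}-\sum_{c\in T(D)}\operatorname{sgn}(c)\,\ell^{\nabla J_n(D_c)}v^{\operatorname{fspan}_{k,m}(D^c)}-\sum_{c\in C(D)\setminus T(D)}\operatorname{sgn}(c)\,\ell^{\nabla J_n(D)}v^{\operatorname{fspan}_{k,m}(D^c)},$$ where $$T(D)=\{c\in C(D)\mid\nabla J_n(D_c)=\pm\nabla J_n(D)\ \text{and}\ \operatorname{fspan}_{k,m}(D^c)=0\},$$ is an oriented virtual knot invariant. (ii) The family of polynomial invariants $\widetilde F^{n,k,m}(t,\ell,v)$ is stronger than the family of $F$-polynomials $F^n(t,\ell)$: any two oriented virtual knots distinguished by $F^n$ for some $n$ are distinguished by $\widetilde F^{n,k,m}$ for some $n,k,m$, and there exist two oriented virtual knots that are not distinguished by $F^n$ for any $n$ but are distinguished by $\widetilde F^{n,k,m}$ for some $n,k,m$.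
   Context: Diagrams. A virtual link diagram is a 4-regular plane diagram of immersed oriented circles in which every vertex is marked as a classical crossing (with over/under information) or as a virtual crossing. Virtual links (knots, if one component) are diagrams modulo generalized Reidemeister moves: classical moves RI, RII, RIII, virtual moves VRI, VRII, VRIII, and the move SV, in which a strand having two virtual crossings with the two strands of a classical crossing is moved across that crossing. A 2-component link is ordered if its components are labelled $1,2$. $C(D)$ is the set of classical crossings of $D$. Sign and index. Draw a classical crossing $c$ with both strands directed upward. $\operatorname{sgn}(c)=+1$ if the overstrand runs from bottom left to top right, and $-1$ otherwise. For an oriented virtual knot diagram, label the arcs (edges of the 4-regular graph) by integers so that at each classical crossing, if the incoming bottom-left and bottom-right arcs are labelled $a$ and $b$, then the outgoing top-left and top-right arcs are labelled $b+1$ and $a-1$; labels do not change along a strand through a virtual crossing. Then $\operatorname{Ind}(c)=\operatorname{sgn}(c)(a-b-1)$. For $n\ne0$, $J_n(D)=\sum_{c:\operatorname{Ind}(c)=n}\operatorname{sgn}(c)$ and $\nabla J_n(D)=J_n(D)-J_{-n}(D)$. Smoothings. A classical crossing $c$ of a knot diagram $D$ cuts the knot into two arcs: one leaving $c$ along the overstrand and returning along the understrand, and one leaving along the understrand and returning along the overstrand. Type-1: $D_c$ is the oriented knot diagram obtained by removing $c$, joining the two incoming ends to each other and the two outgoing ends to each other, and reversing the orientation of one of the two arcs. Type-2: $D^c$ is the ordered oriented 2-component diagram obtained by removing $c$ and closing up each arc separately (joining incoming to outgoing ends as orientation prescribes); one of the two components keeps its orientation and is labelled $1$, the other gets the reversed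 orientation and is labelled $2$. Type-3: for a crossing $c$ between the two components of a 2-component diagram $E$, ${}^cE$ is the oriented knot diagram obtained by removing $c$, joining the two incoming ends to each other and the two outgoing ends to each other, and reversing the orientation of one of the two components. In each type, which arc (component) keeps its orientation depends only on over/under information (always the one leaving $c$ along the overstrand, or always the one leaving along the understrand), a convention fixed once for all crossings. Flat span. For an ordered oriented 2-component diagram $E=K_1\cup K_2$ let $O(E)$ (respectively $U(E)$) be the set of classical crossings at which $K_1$ passes over (respectively under) $K_2$, and let $I_{k,m}$ be the set of crossings $c$ between $K_1$ and $K_2$ with $\nabla J_k({}^cE)=m$. Put $\operatorname{span}_{k,m}(E)=\sum_{c\in O(E)\cap I_{k,m}}\operatorname{sgn}(c)-\sum_{c\in U(E)\cap I_{k,m}}\operatorname{sgn}(c)$ and $\operatorname{fspan}_{k,m}(E)=\operatorname{span}_{k,m}(E)+\operatorname{span}_{k,-m}(E)$. $F$-polynomials: with $T_n(D)=\{c\in C(D)\mid\nabla J_n(D_c)=\pm\nabla J_n(D)\}$, $$F^n_K(t,\ell)=\sum_{c\in C(D)}\operatorname{sgn}(c)t^{\operatorname{Ind}(c)}\ell^{\nabla J_n(D_c)}-\sum_{c\in T_n(D)}\operatorname{sgn}(c)\ell^{\nabla J_n(D_c)}-\sum_{c\notin T_n(D)}\operatorname{sgn}(c)\ell^{\nabla J_n(D)}.$$ *)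

theory Defs
  imports "HOL-Library.Poly_Mapping" "HOL-Library.Product_Plus" "HOL-Combinatorics.Orbits"
begin

section \<open>Virtual knot diagrams\<close>

text \<open>
  A plane diagram is encoded by its rotation system.  Draw a vertex with both strands directed
  upward.  The strand entering at the bottom left leaves at the top right (side \<open>Lft\<close>), the strand
  entering at the bottom right leaves at the top left (side \<open>Rgt\<close>).  A passage is one traversal of a
  vertex along one of its two strands: the name of the vertex, the side at which the strand enters,
  and whether the strand is the overstrand or the understrand of a classical crossing or belongs to
  a virtual crossing.  An immersed oriented circle is the cyclic word of the passages met along
  it; the empty word is a circle without vertices.
\<close>

datatype side = Lft | Rgt

datatype level = Over | Under | Virt

datatype passage = Pass (vert: nat) (side: side) (level: level)

type_synonym circ = "passage list"

primrec opp_side :: "side \<Rightarrow> side" where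
  "opp_side Lft = Rgt"
| "opp_side Rgt = Lft"

primrec opp_level :: "level \<Rightarrow> level" where
  "opp_level Over = Under"
| "opp_level Under = Over"
| "opp_level Virt = Virt"

text \<open>The passage of the other strand through the same vertex.\<close>

definition mate :: "passage \<Rightarrow> passage" where
  "mate p = Pass (vert p) (opp_side (side p)) (opp_level (level p))"

definition vertices :: "circ \<Rightarrow> nat set" where
  "vertices w = vert ` set w"

definition four_regular :: "circ \<Rightarrow> bool" where
  "four_regular w \<longleftrightarrow>
     distinct w \<and> (\<forall>p\<in>set w. {q \<in> set w. vert q = vert p} = {p, mate p})"

text \<open>Cyclic successor and predecessor of a passage.\<close>

definition nxt :: "circ \<Rightarrow> passage \<Rightarrow> passage" where
  "nxt w p = the (map_of (zip w (rotate1 w)) p)"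

definition prv :: "circ \<Rightarrow> passage \<Rightarrow> passage" where
  "prv w p = the (map_of (zip (rotate1 w) w) p)"

text \<open>
  A dart is a directed edge, named by the place where it arrives: \<open>(p, True)\<close> is the edge
  preceding the passage \<open>p\<close>, traversed along the orientation of the circle; \<open>(p, False)\<close> is the edge
  following \<open>p\<close>, traversed backwards.  The map \<open>face_next\<close> turns left at the vertex reached, so that
  its orbits are the boundaries of the faces, each face lying to the left of its darts.  For
  example, coming in at the bottom left, one leaves along the edge going out at the top left.
\<close>

type_synonym dart = "passage \<times> bool"

definition face_next :: "circ \<Rightarrow> dart \<Rightarrow> dart" where
  "face_next w = (\<lambda>(p, fwd).
     if (side p = Lft) = fwd then (nxt w (mate p), True) else (prv w (mate p), False))"

definition faces :: "circ \<Rightarrow> dart set set" where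
  "faces w = orbit (face_next w) ` (set w \<times> UNIV)"

text \<open>
  The underlying graph of a knot diagram is connected, and a nonempty one with \<open>V\<close> vertices has
  \<open>2 V\<close> edges, so by Euler's formula it is embedded in the sphere iff it has \<open>V + 2\<close> faces.  The face
  at infinity is not recorded: moving an edge across the point at infinity is a composition of
  generalized Reidemeister moves in the plane, and every planar move is one of the moves below.
\<close>

definition planar :: "circ \<Rightarrow> bool" where
  "planar w \<longleftrightarrow> w = [] \<or> card (faces w) = card (vertices w) + 2"

definition knot_diagram :: "circ \<Rightarrow> bool" where
  "knot_diagram w \<longleftrightarrow> four_regular w \<and> planar w"


section \<open>Generalized Reidemeister moves\<close>

definition rename :: "(nat \<Rightarrow> nat) \<Rightarrow> passage \<Rightarrow> passage" where
  "rename f p = Pass (f (vert p)) (side p) (level p)"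

text \<open>The two darts of the edge that joins two consecutive passages \<open>x\<close>, \<open>y\<close>.\<close>

definition edge_darts :: "passage \<Rightarrow> passage \<Rightarrow> dart set" where
  "edge_darts x y = {(y, True), (x, False)}"

definition bigon :: "circ \<Rightarrow> passage \<times> passage \<Rightarrow> passage \<times> passage \<Rightarrow> bool" where
  "bigon w = (\<lambda>(a1, a2) (b1, b2).
     \<exists>d\<in>edge_darts a1 a2. \<exists>e\<in>edge_darts b1 b2. {d, e} \<in> faces w)"

definition triangle ::
  "circ \<Rightarrow> passage \<times> passage \<Rightarrow> passage \<times> passage \<Rightarrow> passage \<times> passage \<Rightarrow> bool" where
  "triangle w = (\<lambda>(a1, a2) (b1, b2) (c1, c2).
     \<exists>d\<in>edge_darts a1 a2. \<exists>e\<in>edge_darts b1 b2. \<exists>f\<in>edge_darts c1 c2. {d, e, f} \<in> faces w)"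

text \<open>
  \<open>Rotate\<close> and \<open>Rename\<close> identify different encodings of the same diagram; \<open>Rotate\<close> also allows the
  other moves to take place anywhere on the circle.  A kink \<open>[p, mate p]\<close> always bounds a monogon.
  In the triangle moves each of the three strands meets the two others in the opposite order
  afterwards; all three crossings keep their sides and levels.  The levels of the two passages of
  each strand tell the moves apart: a strand over both others and one under both others for
  \<open>RIII\<close>, three virtual crossings for \<open>VRIII\<close>, and a strand with two virtual crossings meeting the
  two strands of a classical one for \<open>SV\<close>.
\<close>

inductive move :: "circ \<Rightarrow> circ \<Rightarrow> bool" where
  Rotate: "move w (rotate j w)"
| Rename: "inj_on f (vertices w) \<Longrightarrow> move w (map (rename f) w)"
| RI: "level p \<noteq> Virt \<Longrightarrow> move w (w @ [p, mate p])"
| VRI: "level p = Virt \<Longrightarrow> move w (w @ [p, mate p])"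
| RII: "\<lbrakk>w' = u @ [a1, a2] @ v @ [b1, b2]; bigon w' (a1, a2) (b1, b2);
         level a1 \<noteq> Virt; level a2 = level a1\<rbrakk> \<Longrightarrow> move (u @ v) w'"
| VRII: "\<lbrakk>w' = u @ [a1, a2] @ v @ [b1, b2]; bigon w' (a1, a2) (b1, b2);
          level a1 = Virt; level a2 = Virt\<rbrakk> \<Longrightarrow> move (u @ v) w'"
| RIII: "\<lbrakk>w = u @ [a1, a2] @ v @ [b1, b2] @ x @ [c1, c2];
          triangle w (a1, a2) (b1, b2) (c1, c2);
          {(Over, Over), (Under, Under)} \<subseteq>
            {(level a1, level a2), (level b1, level b2), (level c1, level c2)}\<rbrakk>
         \<Longrightarrow> move w (u @ [a2, a1] @ v @ [b2, b1] @ x @ [c2, c1])"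
| VRIII: "\<lbrakk>w = u @ [a1, a2] @ v @ [b1, b2] @ x @ [c1, c2];
           triangle w (a1, a2) (b1, b2) (c1, c2);
           level ` {a1, a2, b1, b2, c1, c2} = {Virt}\<rbrakk>
          \<Longrightarrow> move w (u @ [a2, a1] @ v @ [b2, b1] @ x @ [c2, c1])"
| SV: "\<lbrakk>w = u @ [a1, a2] @ v @ [b1, b2] @ x @ [c1, c2];
        triangle w (a1, a2) (b1, b2) (c1, c2);
        (Virt, Virt) \<in> {(level a1, level a2), (level b1, level b2), (level c1, level c2)};
        level ` {a1, a2, b1, b2, c1, c2} \<noteq> {Virt}\<rbrakk>
       \<Longrightarrow> move w (u @ [a2, a1] @ v @ [b2, b1] @ x @ [c2, c1])"

definition equivalent :: "circ \<Rightarrow> circ \<Rightarrow> bool" where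
  "equivalent = equivclp (\<lambda>w w'. knot_diagram w \<and> knot_diagram w' \<and> move w w')"

text \<open>An oriented virtual knot is the set of all its diagrams.\<close>

definition virtual_knots :: "circ set set" where
  "virtual_knots =
     {w. knot_diagram w} // {(w, w'). knot_diagram w \<and> knot_diagram w' \<and> equivalent w w'}"

definition knot_invariant :: "(circ \<Rightarrow> 'a) \<Rightarrow> bool" where
  "knot_invariant f \<longleftrightarrow> (\<forall>K\<in>virtual_knots. \<forall>D\<in>K. \<forall>D'\<in>K. f D = f D')"

text \<open>For a knot invariant \<open>f\<close>: the value of \<open>f\<close> on \<open>K\<close> differs from its value on \<open>K'\<close>.\<close>

definition distinguishes :: "(circ \<Rightarrow> 'a) \<Rightarrow> circ set \<Rightarrow> circ set \<Rightarrow> bool" where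
  "distinguishes f K K' \<longleftrightarrow> (\<forall>D\<in>K. \<forall>D'\<in>K'. f D \<noteq> f D')"


section \<open>Sign and index\<close>

definition crossings :: "circ \<Rightarrow> nat set" where
  "crossings w = vert ` {p \<in> set w. level p \<noteq> Virt}"

definition passage_on :: "circ \<Rightarrow> nat \<Rightarrow> level \<Rightarrow> passage" where
  "passage_on w c l = (THE p. p \<in> set w \<and> vert p = c \<and> level p = l)"

definition passage_from :: "circ \<Rightarrow> nat \<Rightarrow> side \<Rightarrow> passage" where
  "passage_from w c s = (THE p. p \<in> set w \<and> vert p = c \<and> side p = s)"

definition crossing_sgn :: "circ \<Rightarrow> nat \<Rightarrow> int" where
  "crossing_sgn w c = (if side (passage_on w c Over) = Lft then 1 else -1)"

text \<open>
  \<open>lab p\<close> is the label of the edge preceding the passage \<open>p\<close>; the edge following \<open>p\<close> therefore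
  carries the label \<open>lab (nxt w p)\<close>.
\<close>

definition labelling :: "circ \<Rightarrow> (passage \<Rightarrow> int) \<Rightarrow> bool" where
  "labelling w lab \<longleftrightarrow> (\<forall>p\<in>set w. lab (nxt w p) =
     (if level p = Virt then lab p else if side p = Lft then lab p - 1 else lab p + 1))"

text \<open>A labelling of a knot diagram exists and is unique up to an additive constant.\<close>

definition Ind :: "circ \<Rightarrow> nat \<Rightarrow> int" where
  "Ind w c = (THE i. \<exists>lab. labelling w lab \<and>
     i = crossing_sgn w c * (lab (passage_from w c Lft) - lab (passage_from w c Rgt) - 1))"

definition J :: "int \<Rightarrow> circ \<Rightarrow> int" where
  "J n w = (\<Sum>c\<in>{c \<in> crossings w. Ind w c = n}. crossing_sgn w c)"

definition nabla_J :: "int \<Rightarrow> circ \<Rightarrow> int" where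
  "nabla_J n w = J n w - J (- n) w"


section \<open>Smoothings\<close>

text \<open>
  Which of the two arcs (components) keeps its orientation: the one that leaves the crossing along
  the overstrand or the one that leaves it along the understrand.
\<close>

datatype convention = Keep_Over | Keep_Under

primrec kept_level :: "convention \<Rightarrow> level" where
  "kept_level Keep_Over = Over"
| "kept_level Keep_Under = Under"

text \<open>The passages met after leaving \<open>p\<close>, before the circle comes back to \<open>p\<close>.\<close>

definition after :: "circ \<Rightarrow> passage \<Rightarrow> passage list" where
  "after w p = tl (dropWhile (\<lambda>q. q \<noteq> p) w) @ takeWhile (\<lambda>q. q \<noteq> p) w"

definition arc :: "circ \<Rightarrow> passage \<Rightarrow> passage list" where
  "arc w p = takeWhile (\<lambda>q. q \<noteq> mate p) (after w p)"

text \<open>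
  If exactly one of the two strands at a vertex is reversed, the strand that entered at the bottom
  left enters at the bottom right once both strands are directed upward again, and conversely; if
  both strands are reversed, the picture is turned by a half-turn and the sides stay the same.
  Over and under do not change.
\<close>

definition reorient :: "passage set \<Rightarrow> passage \<Rightarrow> passage" where
  "reorient R p =
     (if (p \<in> R) \<noteq> (mate p \<in> R) then Pass (vert p) (opp_side (side p)) (level p) else p)"

text \<open>
  Keep \<open>X\<close> and reverse \<open>Y\<close>.  Both arcs start at an outgoing and finish at an incoming end of the
  removed crossing; joining incoming to incoming and outgoing to outgoing ends, one runs through \<open>X\<close>
  and then through \<open>Y\<close> backwards.
\<close>

definition reverse_join :: "passage list \<Rightarrow> passage list \<Rightarrow> circ" where
  "reverse_join X Y = map (reorient (set Y)) (X @ rev Y)"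

definition smooth1 :: "convention \<Rightarrow> circ \<Rightarrow> nat \<Rightarrow> circ" where
  "smooth1 \<kappa> w c = (let p = passage_on w c (kept_level \<kappa>) in
     reverse_join (arc w p) (arc w (mate p)))"

text \<open>Ordered oriented 2-component diagrams: the component labelled 1, the component labelled 2.\<close>

type_synonym link2 = "circ \<times> circ"

definition smooth2 :: "convention \<Rightarrow> circ \<Rightarrow> nat \<Rightarrow> link2" where
  "smooth2 \<kappa> w c = (let p = passage_on w c (kept_level \<kappa>); X = arc w p; Y = arc w (mate p) in
     (map (reorient (set Y)) X, map (reorient (set Y)) (rev Y)))"

definition smooth3 :: "convention \<Rightarrow> link2 \<Rightarrow> nat \<Rightarrow> circ" where
  "smooth3 \<kappa> E c = (let p = passage_on (fst E @ snd E) c (kept_level \<kappa>) in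
     if p \<in> set (fst E) then reverse_join (after (fst E) p) (after (snd E) (mate p))
     else reverse_join (after (snd E) p) (after (fst E) (mate p)))"


section \<open>Flat span\<close>

definition first_over :: "link2 \<Rightarrow> nat set" where
  "first_over E = vert ` {p \<in> set (fst E). level p = Over \<and> mate p \<in> set (snd E)}"

definition first_under :: "link2 \<Rightarrow> nat set" where
  "first_under E = vert ` {p \<in> set (fst E). level p = Under \<and> mate p \<in> set (snd E)}"

definition mixed_with :: "convention \<Rightarrow> int \<Rightarrow> int \<Rightarrow> link2 \<Rightarrow> nat set" where
  "mixed_with \<kappa> k m E = {c \<in> first_over E \<union> first_under E. nabla_J k (smooth3 \<kappa> E c) = m}"

definition link_span :: "convention \<Rightarrow> int \<Rightarrow> int \<Rightarrow> link2 \<Rightarrow> int" where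
  "link_span \<kappa> k m E =
     (\<Sum>c\<in>first_over E \<inter> mixed_with \<kappa> k m E. crossing_sgn (fst E @ snd E) c)
     - (\<Sum>c\<in>first_under E \<inter> mixed_with \<kappa> k m E. crossing_sgn (fst E @ snd E) c)"

definition fspan :: "convention \<Rightarrow> int \<Rightarrow> int \<Rightarrow> link2 \<Rightarrow> int" where
  "fspan \<kappa> k m E = link_span \<kappa> k m E + link_span \<kappa> k (- m) E"


section \<open>The polynomials\<close>

text \<open>
  Laurent polynomials with integer coefficients are finitely supported functions of the exponent
  vectors: \<open>single (i, j) s\<close> is the term with coefficient \<open>s\<close> and monomial \<open>t\<^sup>i \<ell>\<^sup>j\<close>, and
  \<open>single (i, j, k) s\<close> the one with monomial \<open>t\<^sup>i \<ell>\<^sup>j v\<^sup>k\<close>.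
\<close>

definition T_set :: "convention \<Rightarrow> int \<Rightarrow> circ \<Rightarrow> nat set" where
  "T_set \<kappa>\<^sub>1 n D =
     {c \<in> crossings D. nabla_J n (smooth1 \<kappa>\<^sub>1 D c) \<in> {nabla_J n D, - nabla_J n D}}"

definition F_poly :: "convention \<Rightarrow> int \<Rightarrow> circ \<Rightarrow> (int \<times> int) \<Rightarrow>\<^sub>0 int" where
  "F_poly \<kappa>\<^sub>1 n D =
     (\<Sum>c\<in>crossings D.
        Poly_Mapping.single (Ind D c, nabla_J n (smooth1 \<kappa>\<^sub>1 D c)) (crossing_sgn D c))
     - (\<Sum>c\<in>T_set \<kappa>\<^sub>1 n D.
        Poly_Mapping.single (0, nabla_J n (smooth1 \<kappa>\<^sub>1 D c)) (crossing_sgn D c))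
     - (\<Sum>c\<in>crossings D - T_set \<kappa>\<^sub>1 n D.
        Poly_Mapping.single (0, nabla_J n D) (crossing_sgn D c))"

definition T_tilde ::
  "convention \<Rightarrow> convention \<Rightarrow> convention \<Rightarrow> int \<Rightarrow> int \<Rightarrow> int \<Rightarrow> circ \<Rightarrow> nat set" where
  "T_tilde \<kappa>\<^sub>1 \<kappa>\<^sub>2 \<kappa>\<^sub>3 n k m D =
     {c \<in> crossings D. nabla_J n (smooth1 \<kappa>\<^sub>1 D c) \<in> {nabla_J n D, - nabla_J n D}
        \<and> fspan \<kappa>\<^sub>3 k m (smooth2 \<kappa>\<^sub>2 D c) = 0}"

definition F_tilde ::
  "convention \<Rightarrow> convention \<Rightarrow> convention \<Rightarrow> int \<Rightarrow> int \<Rightarrow> int \<Rightarrow> circ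
     \<Rightarrow> (int \<times> int \<times> int) \<Rightarrow>\<^sub>0 int" where
  "F_tilde \<kappa>\<^sub>1 \<kappa>\<^sub>2 \<kappa>\<^sub>3 n k m D =
     (\<Sum>c\<in>crossings D.
        Poly_Mapping.single
          (Ind D c, nabla_J n (smooth1 \<kappa>\<^sub>1 D c), fspan \<kappa>\<^sub>3 k m (smooth2 \<kappa>\<^sub>2 D c)) (crossing_sgn D c))
     - (\<Sum>c\<in>T_tilde \<kappa>\<^sub>1 \<kappa>\<^sub>2 \<kappa>\<^sub>3 n k m D.
        Poly_Mapping.single
          (0, nabla_J n (smooth1 \<kappa>\<^sub>1 D c), fspan \<kappa>\<^sub>3 k m (smooth2 \<kappa>\<^sub>2 D c)) (crossing_sgn D c))
     - (\<Sum>c\<in>crossings D - T_tilde \<kappa>\<^sub>1 \<kappa>\<^sub>2 \<kappa>\<^sub>3 n k m D.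
        Poly_Mapping.single
          (0, nabla_J n D, fspan \<kappa>\<^sub>3 k m (smooth2 \<kappa>\<^sub>2 D c)) (crossing_sgn D c))"

end

theory Submission
  imports Defs
begin

text \<open>
  Everything is flat.  Give a passage the weight \<open>+1\<close> on the left, \<open>-1\<close> on the right and \<open>0\<close> at a
  virtual crossing, and let \<open>S(p)\<close> be the total weight of the arc leaving \<open>p\<close>.  Then the index of a
  crossing is \<open>S\<close> of its over passage, and \<open>2 \<nabla>J\<^sub>n\<close> is the sum over all passages of the weight times
  the odd function \<open>[S = n] - [S = -n]\<close>.  If the crossings \<open>c\<close> and \<open>e\<close> interlace, smoothing first \<open>c\<close>
  and then \<open>e\<close> amounts, up to a global reversal, to smoothing both along the orientation, so
  \<open>fspan(D\<^sup>c)\<close> is a weighted count of the \<open>e\<close> for which this curve has \<open>\<nabla>J\<^sub>k = \<plusminus>m\<close>.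

  Invariance is then local.  The sums \<open>S\<close> are differences of an edge labelling, and the labelling
  of a smoothed curve lives on the edges of the original one, with modified rules at the smoothed
  crossings.  A Reidemeister move changes such a labelling only at the passages taking part, even
  when some of their crossings are smoothed, so every case is a computation with finitely many labels.
  A kink contributes zero, the crossings of a bigon cancel, and those of a triangle keep their terms.

  For \<open>k\<close> larger than the number of passages and \<open>m = 1\<close> all flat spans vanish and the polynomial
  becomes \<open>F\<^sup>n\<close>.  A diagram with five classical crossings has the same \<open>F\<^sup>n\<close> as the unknot for every
  \<open>n\<close> but nonzero flat spans for \<open>k = 2\<close>, \<open>m = 1\<close>.
\<close>

section \<open>Passages and arcs\<close>

text \<open>A smoothing reverses and reconnects long pieces of the word, so a move that is local in
  \<open>w\<close> is not visibly local in the word of the smoothed curve. Potentials remove this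
  obstacle thanks to two facts about signs. The index is used in the doubled form
  \<open>f p + g p - f (mate p) - g (mate p)\<close>, which is symmetric in the labels before and
  after a passage and hence blind to the direction in which an arc is traversed. And in the rule
  \<open>g p = f p - wt p * \<chi> (mate p)\<close> the sign of the arc of \<open>p\<close> itself
  has cancelled: it occurs once in the weight of a reoriented passage and once in the direction of
  travel. From the face of a bigon or triangle the calculations take two things: which passages are
  mates of each other, and a relation between weights. Replacing a passage by its mate negates its
  index sum, the value of \<nabla>J after the first smoothing and the flat span, so a comparison at
  one passage of a crossing settles either choice of the kept arc. The third convention disappears
  because it can only reverse a whole curve, and \<open>hit\<close> is even.\<close>

definition wt :: "passage \<Rightarrow> int" where
  "wt p = (if level p = Virt then 0 else if side p = Lft then 1 else -1)"

lemma opp_side_opp_side [simp]: "opp_side (opp_side s) = s"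
  by (cases s) auto

lemma opp_side_neq [simp]: "opp_side s \<noteq> s" "s \<noteq> opp_side s"
  by (cases s; simp)+

lemma opp_level_opp_level [simp]: "opp_level (opp_level l) = l"
  by (cases l) auto

lemma opp_level_eq_Virt [simp]: "opp_level l = Virt \<longleftrightarrow> l = Virt"
  by (cases l) auto

lemma mate_simps [simp]:
  "vert (mate p) = vert p" "side (mate p) = opp_side (side p)"
  "level (mate p) = opp_level (level p)" "mate (mate p) = p"
  by (simp_all add: mate_def)

lemma mate_neq [simp]: "mate p \<noteq> p" "p \<noteq> mate p"
  by (metis mate_simps(2) opp_side_neq(1))+

lemma mate_eq_iff [simp]: "mate p = mate q \<longleftrightarrow> p = q"
  by (metis mate_simps(4))

lemma eq_mate_iff: "p = mate q \<longleftrightarrow> q = mate p"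
  by auto

lemma wt_mate [simp]: "wt (mate p) = - wt p"
  by (cases "side p") (auto simp: wt_def)

text \<open>Keeps from \<open>four_regular\<close> the part about \<open>mate\<close>: this is what
  cutting the circle at \<open>p\<close> and \<open>mate p\<close> requires, and it is easy to check
  for the words of smoothed curves.\<close>

definition paired :: "circ \<Rightarrow> bool" where
  "paired w \<longleftrightarrow> distinct w \<and> (\<forall>p\<in>set w. mate p \<in> set w)"

lemma paired_distinct: "paired w \<Longrightarrow> distinct w"
  by (simp add: paired_def)

lemma paired_mate_iff: "paired w \<Longrightarrow> mate p \<in> set w \<longleftrightarrow> p \<in> set w"
  by (metis mate_simps(4) paired_def)

lemma four_regular_paired: "four_regular w \<Longrightarrow> paired w"
  unfolding four_regular_def paired_def by blast

lemma paired_rotated: "paired (u @ v) \<longleftrightarrow> paired (v @ u)"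
  by (auto simp: paired_def)

lemma takeWhile_neq_split: "p \<notin> set xs \<Longrightarrow> takeWhile (\<lambda>q. q \<noteq> p) (xs @ p # ys) = xs"
  by (induction xs) auto

lemma dropWhile_neq_split: "p \<notin> set xs \<Longrightarrow> dropWhile (\<lambda>q. q \<noteq> p) (xs @ p # ys) = p # ys"
  by (induction xs) auto

lemma after_split: "p \<notin> set xs \<Longrightarrow> after (xs @ p # ys) p = ys @ xs"
  by (simp add: after_def takeWhile_neq_split dropWhile_neq_split)

lemma after_rotated:
  assumes "distinct (u @ v)" "p \<in> set (u @ v)"
  shows "after (v @ u) p = after (u @ v) p"
proof (cases "p \<in> set u")
  case True
  then obtain u1 u2 where u: "u = u1 @ p # u2" by (meson split_list)
  show ?thesis
    using assms(1) after_split[of p "v @ u1" u2] after_split[of p u1 "u2 @ v"] by (simp add: u)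
next
  case False
  then obtain v1 v2 where v: "v = v1 @ p # v2"
    using assms(2) by (metis Un_iff set_append split_list)
  show ?thesis
    using assms(1) after_split[of p v1 "v2 @ u"] after_split[of p "u @ v1" v2] by (simp add: v)
qed

lemma arc_rotated:
  "distinct (u @ v) \<Longrightarrow> p \<in> set (u @ v) \<Longrightarrow> arc (v @ u) p = arc (u @ v) p"
  by (simp only: arc_def after_rotated)

lemma arc_Cons:
  "mate p \<notin> set xs \<Longrightarrow> p \<notin> set xs \<Longrightarrow> arc (p # xs @ mate p # ys) p = xs"
  by (simp add: arc_def after_def takeWhile_neq_split)

lemma arc_Cons_mate:
  assumes "distinct (p # xs @ mate p # ys)"
  shows "arc (p # xs @ mate p # ys) (mate p) = ys"
proof -
  have "arc (p # xs @ mate p # ys) (mate p) = arc (mate p # ys @ p # xs) (mate p)"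
    using arc_rotated[of "p # xs" "mate p # ys" "mate p"] assms by simp
  also have "\<dots> = ys"
    using arc_Cons[of "mate p" ys xs] assms by auto
  finally show ?thesis .
qed

text \<open>Read from \<open>p\<close> on, the circle has the normal form: \<open>p\<close>, an arc,
  \<open>mate p\<close>, the other arc. The words \<open>u\<close> and \<open>v\<close> record where
  the list happens to be cut, so anything invariant under rotation can be computed on the normal
  form.\<close>

lemma paired_split:
  assumes "paired w" "p \<in> set w"
  obtains u v where "w = u @ v" "v @ u = p # arc w p @ mate p # arc w (mate p)"
proof -
  obtain u v where w: "w = u @ p # v" using assms(2) by (meson split_list)
  have "mate p \<in> set (v @ u)"
    using assms paired_mate_iff[OF assms(1), of p] by (auto simp: w)
  then obtain xs ys where xy: "v @ u = xs @ mate p # ys" by (meson split_list)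
  have d: "distinct (p # xs @ mate p # ys)"
    using paired_distinct[OF assms(1)] unfolding w xy[symmetric] by auto
  have r: "(p # v) @ u = p # xs @ mate p # ys" using xy by simp
  have "arc w q = arc (p # xs @ mate p # ys) q" if "q \<in> set w" for q
    using arc_rotated[of u "p # v" q] that paired_distinct[OF assms(1)] unfolding r w by simp
  then have "arc w p = xs" "arc w (mate p) = ys"
    using assms paired_mate_iff[OF assms(1), of p] arc_Cons[of p xs ys] arc_Cons_mate[OF d] d by auto
  then show ?thesis using that[of u "p # v"] xy w by simp
qed

lemma paired_split_facts:
  assumes "paired w" "p \<in> set w"
  shows "set w = {p, mate p} \<union> set (arc w p) \<union> set (arc w (mate p))"
    and "distinct (p # arc w p @ mate p # arc w (mate p))"
proof -
  obtain u v where w: "w = u @ v" and vu: "v @ u = p # arc w p @ mate p # arc w (mate p)"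
    using paired_split[OF assms] .
  have "set w = set (v @ u)" by (auto simp: w)
  then show "set w = {p, mate p} \<union> set (arc w p) \<union> set (arc w (mate p))" unfolding vu by auto
  have "distinct (v @ u)" using paired_distinct[OF assms(1)] by (auto simp: w)
  then show "distinct (p # arc w p @ mate p # arc w (mate p))" unfolding vu .
qed

section \<open>Arcs under deletion, relabelling and reversal\<close>

lemma after_filter:
  assumes "distinct w" "p \<in> set w" "P p"
  shows "after (filter P w) p = filter P (after w p)"
proof -
  obtain xs ys where w: "w = xs @ p # ys" using assms(2) by (meson split_list)
  show ?thesis
    using assms after_split[of p xs ys] after_split[of p "filter P xs" "filter P ys"] by (simp add: w)
qed

lemma after_map:
  assumes "distinct w" "p \<in> set w" "inj_on h (set w)"
  shows "after (map h w) (h p) = map h (after w p)"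
proof -
  obtain xs ys where w: "w = xs @ p # ys" using assms(2) by (meson split_list)
  have "h p \<notin> set (map h xs)" using assms unfolding w by (auto simp: inj_on_def)
  then show ?thesis
    using assms after_split[of p xs ys] after_split[of "h p" "map h xs" "map h ys"] by (simp add: w)
qed

lemma after_rev:
  assumes "distinct w" "p \<in> set w"
  shows "after (rev w) p = rev (after w p)"
proof -
  obtain xs ys where w: "w = xs @ p # ys" using assms(2) by (meson split_list)
  show ?thesis
    using assms after_split[of p xs ys] after_split[of p "rev ys" "rev xs"] by (simp add: w)
qed

lemma takeWhile_filter_neq:
  "P y \<Longrightarrow> takeWhile (\<lambda>q. q \<noteq> y) (filter P xs) = filter P (takeWhile (\<lambda>q. q \<noteq> y) xs)"
  by (induction xs) auto

lemma arc_filter: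
  assumes "distinct w" "p \<in> set w" "P p" "P (mate p)"
  shows "arc (filter P w) p = filter P (arc w p)"
  using assms by (simp add: arc_def after_filter takeWhile_filter_neq)

lemma set_after: "distinct w \<Longrightarrow> p \<in> set w \<Longrightarrow> set (after w p) = set w - {p}"
proof -
  assume "distinct w" "p \<in> set w"
  then obtain xs ys where w: "w = xs @ p # ys" by (meson split_list)
  show ?thesis using \<open>distinct w\<close> after_split[of p xs ys] by (auto simp: w)
qed

lemma takeWhile_map_neq:
  assumes "inj_on h (insert y (set xs))"
  shows "takeWhile (\<lambda>q. q \<noteq> h y) (map h xs) = map h (takeWhile (\<lambda>q. q \<noteq> y) xs)"
  using assms
proof (induction xs)
  case (Cons a xs)
  have "h a = h y \<longleftrightarrow> a = y" using Cons.prems by (auto simp: inj_on_def)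
  moreover have "inj_on h (insert y (set xs))" by (rule inj_on_subset[OF Cons.prems]) auto
  ultimately show ?case using Cons.IH by auto
qed simp

lemma arc_map:
  assumes "paired w" "p \<in> set w" "inj_on h (set w)" "mate (h p) = h (mate p)"
  shows "arc (map h w) (h p) = map h (arc w p)"
proof -
  have d: "distinct w" using paired_distinct[OF assms(1)] .
  have "inj_on h (insert (mate p) (set (after w p)))"
    by (rule inj_on_subset[OF assms(3)])
       (use set_after[OF d assms(2)] paired_mate_iff[OF assms(1)] assms(2) in auto)
  then show ?thesis
    using after_map[OF d assms(2,3)] assms(4) by (simp add: arc_def takeWhile_map_neq)
qed

text \<open>Walking backwards from \<open>p\<close> one meets the piece that led from
  \<open>mate p\<close> to \<open>p\<close>.\<close>

lemma arc_rev:
  assumes "paired w" "p \<in> set w"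
  shows "arc (rev w) p = rev (arc w (mate p))"
proof -
  obtain u v where w: "w = u @ v" and vu: "v @ u = p # arc w p @ mate p # arc w (mate p)"
    using paired_split[OF assms] .
  have d: "distinct (p # arc w p @ mate p # arc w (mate p))"
    using paired_split_facts(2)[OF assms] .
  have "rev (v @ u) = rev (arc w (mate p)) @ mate p # rev (arc w p) @ [p]"
    unfolding vu by simp
  then have r: "rev u @ rev v = rev (arc w (mate p)) @ mate p # rev (arc w p) @ [p]"
    by (simp only: rev_append)
  have "arc (rev w) p = arc (rev u @ rev v) p"
    using arc_rotated[of "rev u" "rev v" p] paired_distinct[OF assms(1)] assms(2) by (auto simp: w)
  also have "\<dots> = arc ([p] @ (rev (arc w (mate p)) @ mate p # rev (arc w p))) p"
    unfolding r
    using arc_rotated[of "[p]" "rev (arc w (mate p)) @ mate p # rev (arc w p)" p] d by auto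
  also have "\<dots> = rev (arc w (mate p))"
    using arc_Cons[of p "rev (arc w (mate p))" "rev (arc w p)"] d by auto
  finally show ?thesis .
qed

section \<open>The index sums\<close>

text \<open>An odd function of the index. The two passages of a crossing have opposite weights and
  opposite arc sums, so they contribute equally; this is the origin of the factor 2 in
  \<open>NN\<close>.\<close>

definition delta :: "int \<Rightarrow> int \<Rightarrow> int" where
  "delta n x = of_bool (x = n) - of_bool (x = - n)"

lemma delta_0 [simp]: "delta n 0 = 0"
  by (auto simp: delta_def)

lemma delta_minus [simp]: "delta n (- x) = - delta n x"
  by (auto simp: delta_def)

lemma delta_double [simp]: "delta (2 * n) (2 * x) = delta n x"
  by (auto simp: delta_def)

text \<open>With the weights \<open>s = wt\<close> this is \<open>2 \<nabla>J\<^sub>n\<close>.\<close>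

definition NN :: "int \<Rightarrow> (passage \<Rightarrow> int) \<Rightarrow> circ \<Rightarrow> int" where
  "NN n s w = (\<Sum>p\<in>set w. s p * delta n (sum_list (map s (arc w p))))"

lemma NN_map:
  assumes "paired w" "inj_on h (set w)" "\<And>p. p \<in> set w \<Longrightarrow> mate (h p) = h (mate p)"
  shows "NN n s (map h w) = NN n (s \<circ> h) w"
  unfolding NN_def set_map using assms
  by (subst sum.reindex) (auto simp: arc_map intro!: sum.cong)

lemma NN_cong:
  assumes "paired w" "\<And>p. p \<in> set w \<Longrightarrow> s p = t p"
  shows "NN n s w = NN n t w"
proof -
  have "sum_list (map s (arc w p)) = sum_list (map t (arc w p))" if "p \<in> set w" for p
    using paired_split_facts(1)[OF assms(1) that] assms(2)
    by (intro arg_cong[of _ _ sum_list] map_cong) auto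
  then show ?thesis unfolding NN_def using assms(2) by (intro sum.cong) auto
qed

lemma sum_antisym:
  fixes s :: "passage \<Rightarrow> int"
  assumes "\<And>p. p \<in> A \<Longrightarrow> mate p \<in> A" "\<And>p. p \<in> A \<Longrightarrow> s (mate p) = - s p"
  shows "sum s A = 0"
proof -
  have "sum s A = (\<Sum>p\<in>A. s (mate p))"
    by (rule sum.reindex_bij_witness[of _ mate mate]) (use assms in auto)
  also have "\<dots> = - sum s A" using assms(2) by (simp add: sum_negf)
  finally show ?thesis by simp
qed

lemma sum_list_antisym:
  assumes "paired w" "\<And>p. p \<in> set w \<Longrightarrow> s (mate p) = - (s p :: int)"
  shows "sum_list (map s w) = 0"
  using assms sum_antisym[of "set w" s] by (simp add: paired_def sum_list_distinct_conv_sum_set)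

text \<open>The two arcs and the two passages of a crossing exhaust the circle, whose total weight
  is zero.\<close>

lemma arc_sum_mate:
  assumes "paired w" "\<And>p. p \<in> set w \<Longrightarrow> s (mate p) = - (s p :: int)" "p \<in> set w"
  shows "sum_list (map s (arc w (mate p))) = - sum_list (map s (arc w p))"
proof -
  obtain u v where w: "w = u @ v" and vu: "v @ u = p # arc w p @ mate p # arc w (mate p)"
    using paired_split[OF assms(1,3)] .
  have "sum_list (map s (v @ u)) = 0"
    using sum_list_antisym[of w s] assms(1,2) by (simp add: w)
  then show ?thesis unfolding vu using assms(2)[OF assms(3)] by simp
qed

text \<open>Reversal exchanges the arcs of \<open>p\<close> and \<open>mate p\<close> and so negates
  every arc sum. The weights stay: with both strands reversed a vertex is turned by a half-turn,
  which preserves sides.\<close>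

lemma NN_rev:
  assumes "paired w" "\<And>p. p \<in> set w \<Longrightarrow> s (mate p) = - s p"
  shows "NN n s (rev w) = - NN n s w"
  unfolding NN_def using assms
  by (auto simp: arc_rev arc_sum_mate rev_map[symmetric] sum_list_rev simp flip: sum_negf intro!: sum.cong)

lemma NN_rotated:
  "distinct (u @ v) \<Longrightarrow> NN n s (v @ u) = NN n s (u @ v)"
  unfolding NN_def by (auto simp: arc_rotated Un_commute intro!: sum.cong)

section \<open>Potentials\<close>

text \<open>
  A potential assigns to every passage the labels of the edges arriving at and leaving it.
  Separating the two labels makes a potential a local object: a move changes it only at the
  passages that take part in the move.
\<close>

primrec chain ::
  "(passage \<Rightarrow> int) \<Rightarrow> (passage \<Rightarrow> int) \<Rightarrow> int \<Rightarrow> passage list \<Rightarrow> int \<Rightarrow> bool" where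
  "chain f g a [] b \<longleftrightarrow> a = b"
| "chain f g a (p # ps) b \<longleftrightarrow> f p = a \<and> chain f g (g p) ps b"

lemma chain_append [simp]:
  "chain f g a (xs @ ys) b \<longleftrightarrow> (\<exists>c. chain f g a xs c \<and> chain f g c ys b)"
  by (induction xs arbitrary: a) auto

lemma chain_rev: "chain f g a (rev xs) b \<longleftrightarrow> chain g f b xs a"
  by (induction xs arbitrary: b) auto

lemma chain_cong:
  "(\<And>p. p \<in> set xs \<Longrightarrow> f p = f' p) \<Longrightarrow> (\<And>p. p \<in> set xs \<Longrightarrow> g p = g' p) \<Longrightarrow>
    chain f g a xs b \<longleftrightarrow> chain f' g' a xs b"
  by (induction xs arbitrary: a) auto

lemma chain_sum:
  "chain f g a xs b \<Longrightarrow> (\<And>p. p \<in> set xs \<Longrightarrow> g p = f p - s p) \<Longrightarrow>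
    b = a - sum_list (map s xs)"
  by (induction xs arbitrary: a) fastforce+

text \<open>Labels are assigned letter by letter; distinctness prevents a later letter from
  overwriting an earlier one.\<close>

lemma chain_exists:
  "distinct xs \<Longrightarrow>
    \<exists>f g. chain f g a xs (a - sum_list (map s xs)) \<and> (\<forall>p. g p = f p - s p)"
proof (induction xs arbitrary: a)
  case Nil
  show ?case by (rule exI[of _ s], rule exI[of _ "\<lambda>p. 0"]) simp
next
  case (Cons p xs)
  then obtain f g where fg: "chain f g (a - s p) xs (a - s p - sum_list (map s xs))"
    "\<forall>p. g p = f p - s p" by (metis distinct.simps(2))
  let ?f = "f(p := a)" let ?g = "g(p := a - s p)"
  have "chain ?f ?g (a - s p) xs (a - s p - sum_list (map s xs))"
    using fg(1) Cons.prems by (subst chain_cong[of xs _ f _ g]) auto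
  then have "chain ?f ?g a (p # xs) (a - sum_list (map s (p # xs))) \<and> (\<forall>q. ?g q = ?f q - s q)"
    using fg(2) by (simp add: algebra_simps)
  then show ?case by blast
qed

definition closed_chain :: "(passage \<Rightarrow> int) \<Rightarrow> (passage \<Rightarrow> int) \<Rightarrow> circ \<Rightarrow> bool" where
  "closed_chain f g w \<longleftrightarrow> (\<exists>a. chain f g a w a)"

lemma closed_chain_rotated: "closed_chain f g (u @ v) \<longleftrightarrow> closed_chain f g (v @ u)"
  by (auto simp: closed_chain_def)

text \<open>The labels close up around the circle because the total weight vanishes.\<close>

lemma closed_chain_exists:
  assumes "paired w" "\<And>p. p \<in> set w \<Longrightarrow> s (mate p) = - s p"
  obtains f g where "closed_chain f g w" "\<And>p. g p = f p - s p"
proof -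
  have "sum_list (map s w) = 0" using assms by (rule sum_list_antisym)
  then show ?thesis
    using chain_exists[of w 0 s] paired_distinct[OF assms(1)] that
    unfolding closed_chain_def by auto
qed

lemma closed_chain_arc:
  assumes "paired w" "closed_chain f g w" "\<And>p. p \<in> set w \<Longrightarrow> g p = f p - s p" "p \<in> set w"
  shows "sum_list (map s (arc w p)) = g p - f (mate p)"
proof -
  obtain u v where w: "w = u @ v" and vu: "v @ u = p # arc w p @ mate p # arc w (mate p)"
    using paired_split[OF assms(1,4)] .
  have "closed_chain f g (v @ u)" using assms(2) closed_chain_rotated w by simp
  then have "chain f g (g p) (arc w p) (f (mate p))" unfolding vu by (auto simp: closed_chain_def)
  from chain_sum[OF this, of s] show ?thesis
    using paired_split_facts(1)[OF assms(1,4)] assms(3) by auto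
qed

text \<open>An arc sum is the difference \<open>g p - f (mate p)\<close> of two edge labels.
  Doubling it and using the rule at both passages gives an expression symmetric in \<open>f\<close>
  and \<open>g\<close>, which survives their exchange along a reversed arc.\<close>

lemma NN_closed_chain:
  assumes "paired w" "\<And>p. p \<in> set w \<Longrightarrow> s (mate p) = - s p"
    "closed_chain f g w" "\<And>p. p \<in> set w \<Longrightarrow> g p = f p - s p"
  shows "NN n s w = (\<Sum>p\<in>set w. s p * delta (2 * n) (f p + g p - f (mate p) - g (mate p)))"
  unfolding NN_def
proof (intro sum.cong refl)
  fix p assume p: "p \<in> set w"
  have m: "mate p \<in> set w" using p paired_mate_iff[OF assms(1)] by simp
  have "f p + g p - f (mate p) - g (mate p) = 2 * sum_list (map s (arc w p))"
    using closed_chain_arc[OF assms(1,3,4) p] assms(2)[OF p] assms(4)[OF p] assms(4)[OF m] by simp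
  then show "s p * delta n (sum_list (map s (arc w p)))
      = s p * delta (2 * n) (f p + g p - f (mate p) - g (mate p))"
    by simp
qed

text \<open>The rule of the smoothed curve, read in the direction of \<open>w\<close>. In that curve
  a passage weighs \<open>wt p * \<chi> p * \<chi> (mate p)\<close>, and on a reversed arc the
  arriving and leaving labels change places; the two factors \<open>\<chi> p\<close> cancel.\<close>

definition conf ::
  "(passage \<Rightarrow> int) \<Rightarrow> passage set \<Rightarrow> (passage \<Rightarrow> int) \<Rightarrow> (passage \<Rightarrow> int) \<Rightarrow> circ \<Rightarrow> bool" where
  "conf \<chi> Z f g w \<longleftrightarrow>
     closed_chain f g w \<and> (\<forall>p\<in>set w - Z. g p = f p - wt p * \<chi> (mate p))"

definition val ::
  "int \<Rightarrow> (passage \<Rightarrow> int) \<Rightarrow> (passage \<Rightarrow> int) \<Rightarrow> (passage \<Rightarrow> int) \<Rightarrow> passage set \<Rightarrow> int" where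
  "val n \<chi> f g A =
     (\<Sum>p\<in>A. wt p * \<chi> p * \<chi> (mate p) * delta (2 * n) (f p + g p - f (mate p) - g (mate p)))"

text \<open>
  The smoothings below are words on the passages of \<open>w\<close> outside a set \<open>Z\<close> of removed ones; \<open>\<chi>\<close> is
  \<open>-1\<close> on the reversed passages.  Their potentials can be written in terms of \<open>w\<close> itself, with
  a condition \<open>\<gamma>\<close> that describes how the ends at \<open>Z\<close> are joined.
\<close>

definition state ::
  "circ \<Rightarrow> (passage \<Rightarrow> int) \<Rightarrow> passage set
    \<Rightarrow> ((passage \<Rightarrow> int) \<Rightarrow> (passage \<Rightarrow> int) \<Rightarrow> bool) \<Rightarrow> (int \<Rightarrow> int) \<Rightarrow> bool" where
  "state w \<chi> Z \<gamma> N \<longleftrightarrow>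
     (\<forall>f g. conf \<chi> Z f g w \<and> \<gamma> f g \<longrightarrow> (\<forall>n. N n = val n \<chi> f g (set w - Z)))
     \<and> (\<exists>f g. conf \<chi> Z f g w \<and> \<gamma> f g)"

text \<open>A \<open>state\<close> says that every admissible potential has the value
  \<open>N\<close> and that there is one. Transport in one direction therefore suffices: a potential
  is taken from the first state and its transported image determines the second value.\<close>

lemma state_eqI:
  assumes "state w \<chi> Z \<gamma> N" "state w' \<chi>' Z' \<gamma>' N'"
    and "\<And>f g. conf \<chi> Z f g w \<Longrightarrow> \<gamma> f g \<Longrightarrow> \<exists>f' g'. conf \<chi>' Z' f' g' w' \<and> \<gamma>' f' g'
           \<and> (\<forall>n. val n \<chi> f g (set w - Z) = val n \<chi>' f' g' (set w' - Z'))"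
  shows "N = N'"
  using assms unfolding state_def fun_eq_iff by metis

lemma conf_rotated: "conf \<chi> Z f g (u @ v) \<longleftrightarrow> conf \<chi> Z f g (v @ u)"
  by (auto simp: conf_def closed_chain_rotated[of f g u v])

lemma state_rotated: "state (u @ v) \<chi> Z \<gamma> N \<longleftrightarrow> state (v @ u) \<chi> Z \<gamma> N"
  by (simp add: state_def conf_rotated[of \<chi> Z _ _ u v] Un_commute)

definition trivial_glue :: "(passage \<Rightarrow> int) \<Rightarrow> (passage \<Rightarrow> int) \<Rightarrow> bool" where
  "trivial_glue f g \<longleftrightarrow> True"

text \<open>\<open>f\<close> labels arriving and \<open>g\<close> leaving edges. Against the
  orientation the two arriving ends become one edge and so do the two leaving ends; along it, in
  \<open>along_glue\<close>, each arriving end continues on the leaving end of the other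
  strand.\<close>

definition against_glue :: "passage \<Rightarrow> (passage \<Rightarrow> int) \<Rightarrow> (passage \<Rightarrow> int) \<Rightarrow> bool" where
  "against_glue p f g \<longleftrightarrow> f p = f (mate p) \<and> g p = g (mate p)"

definition along_glue :: "passage \<Rightarrow> (passage \<Rightarrow> int) \<Rightarrow> (passage \<Rightarrow> int) \<Rightarrow> bool" where
  "along_glue p f g \<longleftrightarrow> g p = f (mate p) \<and> g (mate p) = f p"

lemma along_glue_mate [simp]: "along_glue (mate p) = along_glue p"
  by (auto simp: along_glue_def fun_eq_iff)

lemma state_plain:
  assumes "paired w"
  shows "state w (\<lambda>_. 1) {} trivial_glue (\<lambda>n. NN n wt w)"
  unfolding state_def
proof (intro conjI allI impI)
  fix f g n assume "conf (\<lambda>_. 1) {} f g w \<and> trivial_glue f g"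
  then show "NN n wt w = val n (\<lambda>_. 1) f g (set w - {})"
    using NN_closed_chain[of w wt f g n] assms by (simp add: conf_def val_def)
next
  obtain f g where "closed_chain f g w" "\<And>p. g p = f p - wt p"
    using closed_chain_exists[of w wt] assms by auto
  then show "\<exists>f g. conf (\<lambda>_. 1) {} f g w \<and> trivial_glue f g"
    by (auto simp: conf_def trivial_glue_def)
qed

text \<open>
  Joining the two halves of \<open>w\<close> at \<open>p\<close> against the orientation, and smoothing the two interlaced
  crossings of \<open>p\<close> and \<open>q\<close> along it.
\<close>

definition sm :: "circ \<Rightarrow> passage \<Rightarrow> circ" where
  "sm w p = reverse_join (arc w p) (arc w (mate p))"

definition dbl :: "circ \<Rightarrow> passage \<Rightarrow> passage \<Rightarrow> circ" where
  "dbl w p q = after (arc w p) q @ after (arc w (mate p)) (mate q)"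

text \<open>In the Gauss diagram these are the chords that cross the chord of \<open>p\<close>, each
  named by its end on the arc of \<open>p\<close>. After the type-2 smoothing at \<open>p\<close>
  they are the crossings between the two components.\<close>

definition chords :: "circ \<Rightarrow> passage \<Rightarrow> passage set" where
  "chords w p = {q \<in> set (arc w p). mate q \<in> set (arc w (mate p))}"

lemma reorient_simps [simp]:
  "vert (reorient R p) = vert p" "level (reorient R p) = level p"
  by (simp_all add: reorient_def)

lemma mate_reorient: "mate (reorient R p) = reorient R (mate p)"
  by (auto simp: reorient_def mate_def)

lemma four_regular_vert:
  "four_regular w \<Longrightarrow> p \<in> set w \<Longrightarrow> q \<in> set w \<Longrightarrow> vert q = vert p \<Longrightarrow> q = p \<or> q = mate p"
  unfolding four_regular_def by blast

lemma four_regular_iff: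
  "four_regular w \<longleftrightarrow>
     paired w \<and> (\<forall>p\<in>set w. \<forall>q\<in>set w. vert q = vert p \<longrightarrow> q = p \<or> q = mate p)"
proof
  assume "four_regular w"
  then show "paired w \<and> (\<forall>p\<in>set w. \<forall>q\<in>set w. vert q = vert p \<longrightarrow> q = p \<or> q = mate p)"
    using four_regular_paired four_regular_vert by blast
next
  assume *: "paired w \<and> (\<forall>p\<in>set w. \<forall>q\<in>set w. vert q = vert p \<longrightarrow> q = p \<or> q = mate p)"
  have "{q \<in> set w. vert q = vert p} = {p, mate p}" if "p \<in> set w" for p
    using * that paired_mate_iff[of w p] by auto
  then show "four_regular w" using * by (simp add: four_regular_def paired_def)
qed

text \<open>A reoriented passage stays at its vertex, and \<open>reorient\<close> commutes with
  \<open>mate\<close>, so the two passages of a vertex remain distinct.\<close>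

lemma reorient_inj_on:
  assumes "four_regular w"
  shows "inj_on (reorient R) (set w)"
proof (rule inj_onI)
  fix p q assume pq: "p \<in> set w" "q \<in> set w" "reorient R p = reorient R q"
  then have "vert q = vert p" by (metis reorient_simps(1))
  then consider "q = p" | "q = mate p" using four_regular_vert[OF assms pq(1,2)] by blast
  then show "p = q"
  proof cases
    case 2
    then have "reorient R p = mate (reorient R p)" using pq(3) by (simp add: mate_reorient)
    then show ?thesis by simp
  qed simp
qed

lemma wt_reorient:
  "wt (reorient R p) = (if (p \<in> R) \<noteq> (mate p \<in> R) then - wt p else wt p)"
  by (cases "side p") (auto simp: reorient_def wt_def)

lemma paired_sm_word:
  assumes "paired w" "p \<in> set w"
  shows "paired (arc w p @ rev (arc w (mate p)))"
    "set (arc w p @ rev (arc w (mate p))) = set w - {p, mate p}"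
proof -
  note facts = paired_split_facts[OF assms]
  show s: "set (arc w p @ rev (arc w (mate p))) = set w - {p, mate p}"
    using facts by auto
  show "paired (arc w p @ rev (arc w (mate p)))"
    unfolding paired_def s using facts(2) paired_mate_iff[OF assms(1)] by (auto simp: eq_mate_iff)
qed

lemma conf_sm_chains:
  assumes "paired w" "p \<in> set w"
  shows "closed_chain f g w \<longleftrightarrow>
     chain f g (g p) (arc w p) (f (mate p)) \<and> chain f g (g (mate p)) (arc w (mate p)) (f p)"
proof -
  obtain u v where w: "w = u @ v" and vu: "v @ u = p # arc w p @ mate p # arc w (mate p)"
    using paired_split[OF assms] .
  have "closed_chain f g w \<longleftrightarrow> closed_chain f g (v @ u)" using closed_chain_rotated w by simp
  then show ?thesis unfolding vu by (auto simp: closed_chain_def)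
qed

text \<open>A potential of \<open>w\<close> glued at \<open>p\<close> becomes a potential of the
  smoothed word by exchanging \<open>f\<close> and \<open>g\<close> along the reversed arc, and
  every potential of the smoothed word arises in this way.\<close>

lemma state_sm:
  assumes "four_regular w" "p \<in> set w"
    and "\<And>r. r \<in> set (arc w p) \<Longrightarrow> \<chi> r = 1" "\<And>r. r \<in> set (arc w (mate p)) \<Longrightarrow> \<chi> r = -1"
  shows "state w \<chi> {p, mate p} (against_glue p) (\<lambda>n. NN n wt (sm w p))"
proof -
  have pw: "paired w" using four_regular_paired assms(1) .
  define X where "X = arc w p"
  define Y where "Y = arc w (mate p)"
  define L where "L = X @ rev Y"
  define s where "s = (\<lambda>r. wt r * \<chi> r * \<chi> (mate r))"
  have L: "paired L" "set L = set w - {p, mate p}"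
    using paired_sm_word[OF pw assms(2)] by (simp_all add: L_def X_def Y_def)
  have disj: "set X \<inter> set Y = {}" "p \<notin> set X" "p \<notin> set Y" "mate p \<notin> set X" "mate p \<notin> set Y"
    using paired_split_facts(2)[OF pw assms(2)] by (auto simp: X_def Y_def)
  have \<chi>: "\<chi> r = (if r \<in> set Y then -1 else 1)" if "r \<in> set L" for r
    using that assms(3,4) disj by (auto simp: L_def X_def Y_def)
  have sL: "s (mate r) = - s r" for r by (simp add: s_def)
  have "NN n wt (sm w p) = NN n (wt \<circ> reorient (set Y)) L" for n
    unfolding sm_def reverse_join_def X_def[symmetric] Y_def[symmetric] L_def[symmetric]
    using NN_map[OF L(1), of "reorient (set Y)" n wt] inj_on_subset[OF reorient_inj_on[OF assms(1)]] L(2)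
    by (simp add: mate_reorient)
  moreover have "NN n (wt \<circ> reorient (set Y)) L = NN n s L" for n
    using paired_mate_iff[OF L(1)]
    by (intro NN_cong L) (auto simp: wt_reorient s_def \<chi>)
  ultimately have NN: "NN n wt (sm w p) = NN n s L" for n by simp
  show ?thesis unfolding state_def
  proof (intro conjI allI impI)
    fix f g n assume "conf \<chi> {p, mate p} f g w \<and> against_glue p f g"
    then have c: "chain f g (g p) X (f (mate p))" "chain f g (g (mate p)) Y (f p)"
      "f (mate p) = f p" "g (mate p) = g p"
      and r: "\<And>r. r \<in> set L \<Longrightarrow> g r = f r - wt r * \<chi> (mate r)"
      using conf_sm_chains[OF pw assms(2), of f g]
      by (auto simp: conf_def against_glue_def X_def Y_def L(2))
    define f' where "f' = (\<lambda>r. if r \<in> set Y then g r else f r)"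
    define g' where "g' = (\<lambda>r. if r \<in> set Y then f r else g r)"
    have "chain f' g' (g p) X (f p)"
      using c(1,3) disj(1) by (subst chain_cong[of X _ f _ g]) (auto simp: f'_def g'_def)
    moreover have "chain g' f' (g p) Y (f p)"
      using c(2,4) by (subst chain_cong[of Y _ f _ g]) (auto simp: f'_def g'_def)
    ultimately have cl: "closed_chain f' g' L"
      unfolding closed_chain_def L_def by (auto simp: chain_rev)
    have rule: "g' q = f' q - s q" if "q \<in> set L" for q
      using r[OF that] \<chi>[OF that] by (auto simp: f'_def g'_def s_def)
    show "NN n wt (sm w p) = val n \<chi> f g (set w - {p, mate p})"
      unfolding NN NN_closed_chain[OF L(1), of s f' g' n, OF sL cl rule, simplified] val_def L(2)
      by (intro sum.cong refl) (auto simp: f'_def g'_def s_def algebra_simps)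
  next
    obtain f0 g0 where fg: "closed_chain f0 g0 L" "\<And>p. g0 p = f0 p - s p"
      using closed_chain_exists[of L s, OF L(1) sL] by auto
    then obtain a c where ac: "chain f0 g0 a X c" "chain g0 f0 a Y c"
      by (auto simp: closed_chain_def L_def chain_rev)
    \<comment> \<open>\<open>c\<close> is the label of the edge formed by the two arriving ends at
      the removed crossing, \<open>a\<close> that of the edge formed by the two leaving
      ends.\<close>
    define f where "f = (\<lambda>r. if r \<in> {p, mate p} then c else if r \<in> set Y then g0 r else f0 r)"
    define g where "g = (\<lambda>r. if r \<in> {p, mate p} then a else if r \<in> set Y then f0 r else g0 r)"
    have "chain f g a X c"
      using ac(1) disj by (subst chain_cong[of X _ f0 _ g0]) (auto simp: f_def g_def)
    moreover have "chain f g a Y c"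
      using ac(2) disj by (subst chain_cong[of Y _ g0 _ f0]) (auto simp: f_def g_def)
    ultimately have "closed_chain f g w"
      unfolding conf_sm_chains[OF pw assms(2)] X_def[symmetric] Y_def[symmetric]
      by (auto simp: f_def g_def)
    moreover have "g r = f r - wt r * \<chi> (mate r)" if "r \<in> set w - {p, mate p}" for r
      using that fg(2)[of r] \<chi>[of r] L(2) by (auto simp: f_def g_def s_def)
    moreover have "against_glue p f g" by (simp add: against_glue_def f_def g_def)
    ultimately have "conf \<chi> {p, mate p} f g w \<and> against_glue p f g" by (simp add: conf_def)
    then show "\<exists>f g. conf \<chi> {p, mate p} f g w \<and> against_glue p f g" by blast
  qed
qed

text \<open>If the circle reads \<open>p\<close>, \<open>P1\<close>, \<open>q\<close>,
  \<open>P2\<close>, \<open>mate p\<close>, \<open>P3\<close>, \<open>mate q\<close>,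
  \<open>P4\<close>, then smoothing both crossings along the orientation visits \<open>P2\<close>,
  \<open>P1\<close>, \<open>P4\<close>, \<open>P3\<close> in this order. Interlacing is what makes
  the result a single circle.\<close>

lemma dbl_split:
  assumes "paired w" "p \<in> set w" "q \<in> chords w p"
  obtains P1 P2 P3 P4 where "arc w p = P1 @ q # P2" "arc w (mate p) = P3 @ mate q # P4"
    "dbl w p q = P2 @ P1 @ P4 @ P3"
proof -
  obtain P1 P2 where a: "arc w p = P1 @ q # P2"
    using assms(3) by (auto simp: chords_def dest: split_list)
  obtain P3 P4 where b: "arc w (mate p) = P3 @ mate q # P4"
    using assms(3) by (auto simp: chords_def dest: split_list)
  have "q \<notin> set P1" "mate q \<notin> set P3"
    using paired_split_facts(2)[OF assms(1,2)] by (auto simp: a b)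
  then have "dbl w p q = P2 @ P1 @ P4 @ P3" by (simp add: dbl_def a b after_split)
  then show ?thesis using that a b by blast
qed

lemma paired_dbl:
  assumes "paired w" "p \<in> set w" "q \<in> chords w p"
  shows "paired (dbl w p q)" "set (dbl w p q) = set w - {p, mate p, q, mate q}"
proof -
  obtain P1 P2 P3 P4 where P: "arc w p = P1 @ q # P2" "arc w (mate p) = P3 @ mate q # P4"
    "dbl w p q = P2 @ P1 @ P4 @ P3" using dbl_split[OF assms] .
  note facts = paired_split_facts[OF assms(1,2), unfolded P]
  show s: "set (dbl w p q) = set w - {p, mate p, q, mate q}"
    unfolding P facts(1) using facts(2) by auto
  show "paired (dbl w p q)"
    unfolding paired_def s unfolding P using facts(2) paired_mate_iff[OF assms(1)]
    by (auto simp: eq_mate_iff)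
qed

lemma state_dbl:
  assumes "paired w" "p \<in> set w" "q \<in> chords w p"
  shows "state w (\<lambda>_. 1) {p, mate p, q, mate q} (\<lambda>f g. along_glue p f g \<and> along_glue q f g)
    (\<lambda>n. NN n wt (dbl w p q))"
proof -
  obtain P1 P2 P3 P4 where P: "arc w p = P1 @ q # P2" "arc w (mate p) = P3 @ mate q # P4"
    "dbl w p q = P2 @ P1 @ P4 @ P3" using dbl_split[OF assms] .
  note L = paired_dbl[OF assms]
  note d = paired_split_facts(2)[OF assms(1,2), unfolded P]
  have cl: "closed_chain f g w \<longleftrightarrow> chain f g (g p) P1 (f q) \<and> chain f g (g q) P2 (f (mate p)) \<and>
      chain f g (g (mate p)) P3 (f (mate q)) \<and> chain f g (g (mate q)) P4 (f p)" for f g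
    unfolding conf_sm_chains[OF assms(1,2)] P by auto
  show ?thesis unfolding state_def
  proof (intro conjI allI impI)
    fix f g n
    assume "conf (\<lambda>_. 1) {p, mate p, q, mate q} f g w \<and> along_glue p f g \<and> along_glue q f g"
    then have "chain f g (f (mate p)) P1 (f q)" "chain f g (f (mate q)) P2 (f (mate p))"
        "chain f g (f p) P3 (f (mate q))" "chain f g (f q) P4 (f p)"
      and r: "\<And>r. r \<in> set (dbl w p q) \<Longrightarrow> g r = f r - wt r"
      unfolding conf_def L(2) cl by (auto simp: along_glue_def)
    then have c: "closed_chain f g (dbl w p q)"
      unfolding closed_chain_def P(3) chain_append by blast
    show "NN n wt (dbl w p q) = val n (\<lambda>_. 1) f g (set w - {p, mate p, q, mate q})"
      using NN_closed_chain[OF L(1) _ c r] by (simp add: val_def L(2))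
  next
    obtain f0 g0 where fg: "closed_chain f0 g0 (dbl w p q)" "\<And>p. g0 p = f0 p - wt p"
      using closed_chain_exists[of "dbl w p q" wt, OF L(1)] by auto
    then obtain a b c e where ac: "chain f0 g0 a P2 b" "chain f0 g0 b P1 c" "chain f0 g0 c P4 e"
      "chain f0 g0 e P3 a"
      by (auto simp: closed_chain_def P(3))
    \<comment> \<open>The four removed passages receive the labels found at the junctions of
      \<open>P2\<close>, \<open>P1\<close>, \<open>P4\<close>, \<open>P3\<close>: \<open>b\<close>
      after \<open>P2\<close>, \<open>c\<close> after \<open>P1\<close>, \<open>e\<close> after
      \<open>P4\<close>, and \<open>a\<close> where the circle closes.\<close>
    define f where "f = f0(p := e, mate p := b, q := c, mate q := a)"
    define g where "g = g0(p := b, mate p := e, q := a, mate q := c)"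
    have pq: "q \<noteq> p" "q \<noteq> mate p" "p \<noteq> mate q" using d by auto
    have "chain f g x P y \<longleftrightarrow> chain f0 g0 x P y" if "set P \<inter> {p, mate p, q, mate q} = {}" for P x y
      using that by (intro chain_cong) (auto simp: f_def g_def)
    then have "chain f g a P2 b \<and> chain f g b P1 c \<and> chain f g c P4 e \<and> chain f g e P3 a"
      using ac d by simp
    then have "closed_chain f g w" unfolding cl using pq by (simp add: f_def g_def)
    moreover have "along_glue p f g \<and> along_glue q f g"
      using pq by (simp add: along_glue_def f_def g_def)
    moreover have "g r = f r - wt r" if "r \<in> set w - {p, mate p, q, mate q}" for r
      using that fg(2)[of r] by (simp add: f_def g_def)
    ultimately have "conf (\<lambda>_. 1) {p, mate p, q, mate q} f g w \<and> along_glue p f g \<and> along_glue q f g"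
      by (simp add: conf_def)
    then show "\<exists>f g. conf (\<lambda>_. 1) {p, mate p, q, mate q} f g w
        \<and> along_glue p f g \<and> along_glue q f g" by blast
  qed
qed

section \<open>Local changes of a word\<close>

lemma val_cong:
  assumes "\<And>r. r \<in> A \<Longrightarrow> f r = f' r \<and> g r = g' r \<and> f (mate r) = f' (mate r) \<and> g (mate r) = g' (mate r)
      \<and> \<chi> r = \<chi>' r \<and> \<chi> (mate r) = \<chi>' (mate r)"
  shows "val n \<chi> f g A = val n \<chi>' f' g' A"
  unfolding val_def using assms by (intro sum.cong) auto

lemma val_empty [simp]: "val n \<chi> f g {} = 0"
  by (simp add: val_def)

lemma val_pair:
  assumes "finite A" "p \<notin> A" "mate p \<notin> A"
  shows "val n \<chi> f g (insert p (insert (mate p) A)) =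
    2 * (wt p * \<chi> p * \<chi> (mate p) * delta (2 * n) (f p + g p - f (mate p) - g (mate p)))
      + val n \<chi> f g A"
proof -
  have "delta (2 * n) (f (mate p) + g (mate p) - f p - g p)
      = - delta (2 * n) (f p + g p - f (mate p) - g (mate p))"
    by (metis delta_minus diff_diff_eq minus_diff_eq)
  then show ?thesis using assms by (simp add: val_def)
qed

text \<open>The rest of the circle sees the three segments only through the labels at their six
  ends, so a new potential has to be found on \<open>E\<close> alone. \<open>Z\<close> and
  \<open>Z'\<close> may differ inside \<open>E\<close>, which also allows the comparison of
  smoothings at two different crossings of the same bigon or triangle.\<close>

lemma local_change:
  assumes st: "state (S1 @ u @ S2 @ v @ S3 @ x) \<chi> Z \<gamma> N"
    "state (S1' @ u @ S2' @ v @ S3' @ x) \<chi>' Z' \<gamma>' N'"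
    and E: "set (S1 @ S2 @ S3) \<subseteq> E" "set (S1' @ S2' @ S3') \<subseteq> E" "E \<inter> set (u @ v @ x) = {}"
    and rest: "\<And>r. r \<in> set (u @ v @ x) \<Longrightarrow> mate r \<in> set (u @ v @ x) \<and> \<chi> r = \<chi>' r"
    and Z: "Z - E = Z' - E"
    and step: "\<And>f g i1 e1 i2 e2 i3 e3. chain f g i1 S1 e1 \<Longrightarrow> chain f g i2 S2 e2 \<Longrightarrow> chain f g i3 S3 e3 \<Longrightarrow>
       (\<And>r. r \<in> set (S1 @ S2 @ S3) - Z \<Longrightarrow> g r = f r - wt r * \<chi> (mate r)) \<Longrightarrow> \<gamma> f g \<Longrightarrow>
       \<exists>f' g'. (\<forall>r. r \<notin> E \<longrightarrow> f' r = f r \<and> g' r = g r)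
         \<and> chain f' g' i1 S1' e1 \<and> chain f' g' i2 S2' e2 \<and> chain f' g' i3 S3' e3
         \<and> (\<forall>r\<in>set (S1' @ S2' @ S3') - Z'. g' r = f' r - wt r * \<chi>' (mate r)) \<and> \<gamma>' f' g'
         \<and> (\<forall>n. val n \<chi> f g (set (S1 @ S2 @ S3) - Z) = val n \<chi>' f' g' (set (S1' @ S2' @ S3') - Z'))"
  shows "N = N'"
proof (rule state_eqI[OF st])
  fix f g
  let ?U = "set (u @ v @ x)"
  assume c: "conf \<chi> Z f g (S1 @ u @ S2 @ v @ S3 @ x)" and \<gamma>: "\<gamma> f g"
  then obtain i1 e1 i2 e2 i3 e3 where ch: "chain f g i1 S1 e1" "chain f g i2 S2 e2" "chain f g i3 S3 e3"
    and cu: "chain f g e1 u i2" "chain f g e2 v i3" "chain f g e3 x i1"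
    by (auto simp: conf_def closed_chain_def)
  have "g r = f r - wt r * \<chi> (mate r)" if "r \<in> set (S1 @ S2 @ S3) - Z" for r
    using c that by (auto simp: conf_def)
  from step[OF ch this \<gamma>] obtain f' g' where
    fg: "\<And>r. r \<notin> E \<Longrightarrow> f' r = f r \<and> g' r = g r"
    and ch': "chain f' g' i1 S1' e1" "chain f' g' i2 S2' e2" "chain f' g' i3 S3' e3"
    and r': "\<forall>r\<in>set (S1' @ S2' @ S3') - Z'. g' r = f' r - wt r * \<chi>' (mate r)"
    and \<gamma>': "\<gamma>' f' g'"
    and vl: "\<forall>n. val n \<chi> f g (set (S1 @ S2 @ S3) - Z) = val n \<chi>' f' g' (set (S1' @ S2' @ S3') - Z')"
    by metis
  have out: "f' r = f r" "g' r = g r" if "r \<in> ?U" for r using fg[of r] E(3) that by auto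
  have "chain f' g' e1 u i2" "chain f' g' e2 v i3" "chain f' g' e3 x i1"
    using cu out chain_cong[of u f' f g' g] chain_cong[of v f' f g' g] chain_cong[of x f' f g' g]
    by auto
  then have "closed_chain f' g' (S1' @ u @ S2' @ v @ S3' @ x)"
    using ch' unfolding closed_chain_def chain_append by blast
  moreover have "g' r = f' r - wt r * \<chi>' (mate r)" if r: "r \<in> set (S1' @ u @ S2' @ v @ S3' @ x) - Z'" for r
  proof (cases "r \<in> ?U")
    case True
    then have "r \<notin> Z" using Z E(3) r by auto
    then have "g r = f r - wt r * \<chi> (mate r)" using c True by (auto simp: conf_def)
    then show ?thesis using out[OF True] rest[OF True] rest[of "mate r"] by simp
  next
    case False
    then show ?thesis using r' r by auto
  qed
  ultimately have conf: "conf \<chi>' Z' f' g' (S1' @ u @ S2' @ v @ S3' @ x)" by (simp add: conf_def)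
  have split: "val n \<chi> f g (set (S1 @ u @ S2 @ v @ S3 @ x) - Z)
      = val n \<chi> f g (set (S1 @ S2 @ S3) - Z) + val n \<chi> f g (?U - Z)"
    if "set (S1 @ S2 @ S3) \<inter> ?U = {}" for n \<chi> f g S1 S2 S3 Z
  proof -
    have "set (S1 @ u @ S2 @ v @ S3 @ x) - Z = (set (S1 @ S2 @ S3) - Z) \<union> (?U - Z)" by auto
    moreover have "(set (S1 @ S2 @ S3) - Z) \<inter> (?U - Z) = {}" using that by auto
    ultimately show ?thesis unfolding val_def by (simp only: sum.union_disjoint finite_set finite_Diff)
  qed
  have "val n \<chi> f g (?U - Z) = val n \<chi>' f' g' (?U - Z')" for n
  proof -
    have "?U - Z = ?U - Z'" using Z E(3) by auto
    moreover have "val n \<chi> f g (?U - Z) = val n \<chi>' f' g' (?U - Z)"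
      using out rest by (intro val_cong) auto
    ultimately show ?thesis by simp
  qed
  moreover have "set (S1 @ S2 @ S3) \<inter> ?U = {}" "set (S1' @ S2' @ S3') \<inter> ?U = {}" using E by auto
  ultimately have "\<forall>n. val n \<chi> f g (set (S1 @ u @ S2 @ v @ S3 @ x) - Z)
      = val n \<chi>' f' g' (set (S1' @ u @ S2' @ v @ S3' @ x) - Z')"
    using vl by (simp only: split simp_thms)
  then show "\<exists>f' g'. conf \<chi>' Z' f' g' (S1' @ u @ S2' @ v @ S3' @ x) \<and> \<gamma>' f' g' \<and>
      (\<forall>n. val n \<chi> f g (set (S1 @ u @ S2 @ v @ S3 @ x) - Z)
        = val n \<chi>' f' g' (set (S1' @ u @ S2' @ v @ S3' @ x) - Z'))"
    using conf \<gamma>' by blast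
qed

definition local_glue ::
  "passage set \<Rightarrow> ((passage \<Rightarrow> int) \<Rightarrow> (passage \<Rightarrow> int) \<Rightarrow> bool) \<Rightarrow> bool" where
  "local_glue Z \<gamma> \<longleftrightarrow>
     (\<forall>f g f' g'. (\<forall>r\<in>Z. f r = f' r \<and> g r = g' r) \<longrightarrow> \<gamma> f g \<longrightarrow> \<gamma> f' g')"

lemma local_glueD:
  "local_glue Z \<gamma> \<Longrightarrow> \<gamma> f g \<Longrightarrow> (\<And>r. r \<in> Z \<Longrightarrow> f' r = f r \<and> g' r = g r) \<Longrightarrow> \<gamma> f' g'"
  unfolding local_glue_def by metis

lemma local_glue_simps [simp]:
  "local_glue Z trivial_glue"
  "local_glue {p, mate p} (against_glue p)"
  "local_glue {p, mate p} (along_glue p)"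
  "local_glue {p, mate p, q, mate q} (\<lambda>f g. along_glue p f g \<and> along_glue q f g)"
  by (auto simp: local_glue_def trivial_glue_def against_glue_def along_glue_def)

text \<open>Both passages of the kink carry the same sign \<open>\<chi>\<close>, so their label
  changes cancel and the doubled difference at the kink is zero; the old potential serves
  unchanged.\<close>

lemma RI_state:
  assumes "paired (u @ [z, mate z])" "state (u @ [z, mate z]) \<chi> Z \<gamma> N" "state u \<chi> Z \<gamma> N'"
    "z \<notin> Z" "mate z \<notin> Z" "\<chi> z = \<chi> (mate z)"
  shows "N = N'"
proof (rule local_change[where ?S1.0 = "[]" and ?S2.0 = "[]" and ?S3.0 = "[z, mate z]" and u = u
      and v = "[]" and x = "[]" and ?S1'.0 = "[]" and ?S2'.0 = "[]" and ?S3'.0 = "[]"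
      and \<chi> = \<chi> and \<chi>' = \<chi> and Z = Z and Z' = Z and \<gamma> = \<gamma> and \<gamma>' = \<gamma> and E = "{z, mate z}"])
  fix f g i1 e1 i2 e2 i3 e3
  assume "chain f g i1 [] e1" "chain f g i2 [] e2" and ch: "chain f g i3 [z, mate z] e3"
    and r: "\<And>r. r \<in> set ([] @ [] @ [z, mate z]) - Z \<Longrightarrow> g r = f r - wt r * \<chi> (mate r)" and "\<gamma> f g"
  have "g z = f z - wt z * \<chi> (mate z)" "g (mate z) = f (mate z) + wt z * \<chi> z"
    using r[of z] r[of "mate z"] assms(4,5) by auto
  then have e: "e3 = i3" "f z + g z - f (mate z) - g (mate z) = 0" using ch assms(6) by auto
  have "{z, mate z} - Z = {z, mate z}" using assms(4,5) by auto
  then have "val n \<chi> f g (set ([] @ [] @ [z, mate z]) - Z) = 0" for n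
    using val_pair[of "{}" z n \<chi> f g] e(2) by simp
  then show "\<exists>f' g'. (\<forall>r. r \<notin> {z, mate z} \<longrightarrow> f' r = f r \<and> g' r = g r)
     \<and> chain f' g' i1 [] e1 \<and> chain f' g' i2 [] e2 \<and> chain f' g' i3 [] e3
     \<and> (\<forall>r\<in>set ([] @ [] @ []) - Z. g' r = f' r - wt r * \<chi> (mate r)) \<and> \<gamma> f' g'
     \<and> (\<forall>n. val n \<chi> f g (set ([] @ [] @ [z, mate z]) - Z) = val n \<chi> f' g' (set ([] @ [] @ []) - Z))"
    using e(1) \<open>chain f g i1 [] e1\<close> \<open>chain f g i2 [] e2\<close> \<open>\<gamma> f g\<close> by auto
qed (use assms in \<open>auto simp: paired_def eq_mate_iff\<close>)

subsection \<open>Bigons\<close>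

definition strand :: "bool \<Rightarrow> passage \<Rightarrow> passage \<Rightarrow> passage list" where
  "strand s p q = (if s then [p, q] else [q, p])"

lemma set_strand [simp]: "set (strand s p q) = {p, q}"
  by (auto simp: strand_def)

text \<open>The flag tells whether the second strand runs parallel to the first one
  (\<open>s\<close>) or antiparallel to it.\<close>

definition bigon_word :: "bool \<Rightarrow> passage \<Rightarrow> passage \<Rightarrow> passage list \<Rightarrow> passage list \<Rightarrow> circ" where
  "bigon_word s a b u v = [a, b] @ u @ strand s (mate a) (mate b) @ v"

lemma bigon_word_distinct:
  assumes "paired (bigon_word s a b u v)"
  shows "a \<noteq> b" "b \<noteq> a" "a \<noteq> mate b" "b \<noteq> mate a" "mate a \<noteq> b" "mate b \<noteq> a"
    "{a, b, mate a, mate b} \<inter> set (u @ v) = {}"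
    "distinct (u @ v)" "set u \<inter> set v = {}"
    "\<And>r. r \<in> set (u @ v) \<Longrightarrow> mate r \<in> set (u @ v)"
proof -
  have d: "distinct (bigon_word s a b u v)" and
    m: "\<And>r. r \<in> set (bigon_word s a b u v) \<Longrightarrow> mate r \<in> set (bigon_word s a b u v)"
    using assms by (auto simp: paired_def)
  then show ab: "a \<noteq> b" "b \<noteq> a" "a \<noteq> mate b" "b \<noteq> mate a" "mate a \<noteq> b" "mate b \<noteq> a"
    and disj: "{a, b, mate a, mate b} \<inter> set (u @ v) = {}"
    and "distinct (u @ v)" "set u \<inter> set v = {}"
    by (auto simp: bigon_word_def strand_def split: if_splits)
  fix r assume "r \<in> set (u @ v)"
  then show "mate r \<in> set (u @ v)"
    using m[of r] disj by (auto simp: bigon_word_def eq_mate_iff)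
qed

text \<open>Along each strand the two label changes cancel. Hence the two crossings have the same
  doubled difference, and their opposite weights make the terms cancel.\<close>

lemma RII_state:
  assumes p: "paired (bigon_word s a b u v)"
    and "state (bigon_word s a b u v) \<chi> Z \<gamma> N" "state (u @ v) \<chi> Z \<gamma> N'"
    and Z: "Z \<inter> {a, b, mate a, mate b} = {}"
    and \<chi>: "\<chi> a = \<chi> b" "\<chi> (mate a) = \<chi> (mate b)" and wt: "wt b = - wt a"
  shows "N = N'"
proof (rule local_change[where ?S1.0 = "[a, b]" and ?S2.0 = "strand s (mate a) (mate b)" and ?S3.0 = "[]"
      and u = u and v = v and x = "[]" and ?S1'.0 = "[]" and ?S2'.0 = "[]" and ?S3'.0 = "[]"
      and \<chi> = \<chi> and \<chi>' = \<chi> and Z = Z and Z' = Z and \<gamma> = \<gamma> and \<gamma>' = \<gamma> and E = "{a, b, mate a, mate b}"])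
  note d = bigon_word_distinct[OF p]
  fix f g i1 e1 i2 e2 i3 e3
  assume ch: "chain f g i1 [a, b] e1" "chain f g i2 (strand s (mate a) (mate b)) e2" "chain f g i3 [] e3"
    and r: "\<And>r. r \<in> set ([a, b] @ strand s (mate a) (mate b) @ []) - Z \<Longrightarrow>
        g r = f r - wt r * \<chi> (mate r)" and "\<gamma> f g"
  have rr: "g a = f a - wt a * \<chi> (mate a)" "g b = f b + wt a * \<chi> (mate a)"
    "g (mate a) = f (mate a) + wt a * \<chi> a" "g (mate b) = f (mate b) - wt a * \<chi> a"
    using r[of a] r[of b] r[of "mate a"] r[of "mate b"] Z \<chi> wt by auto
  have e: "e1 = i1" "e2 = i2" "f b + g b - f (mate b) - g (mate b) = f a + g a - f (mate a) - g (mate a)"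
    using ch rr by (auto simp: strand_def split: if_splits)
  have "set ([a, b] @ strand s (mate a) (mate b) @ []) - Z = {a, mate a, b, mate b}" using Z by auto
  then have "val n \<chi> f g (set ([a, b] @ strand s (mate a) (mate b) @ []) - Z) = 0" for n
    using val_pair[of "{b, mate b}" a n \<chi> f g] val_pair[of "{}" b n \<chi> f g] d e(3) \<chi> wt by simp
  then show "\<exists>f' g'. (\<forall>r. r \<notin> {a, b, mate a, mate b} \<longrightarrow> f' r = f r \<and> g' r = g r)
     \<and> chain f' g' i1 [] e1 \<and> chain f' g' i2 [] e2 \<and> chain f' g' i3 [] e3
     \<and> (\<forall>r\<in>set ([] @ [] @ []) - Z. g' r = f' r - wt r * \<chi> (mate r)) \<and> \<gamma> f' g'
     \<and> (\<forall>n. val n \<chi> f g (set ([a, b] @ strand s (mate a) (mate b) @ []) - Z)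
          = val n \<chi> f' g' (set ([] @ [] @ []) - Z))"
    using e(1,2) ch(3) \<open>\<gamma> f g\<close> by auto
qed (use assms bigon_word_distinct[OF p] in \<open>auto simp: bigon_word_def\<close>)

definition dstate :: "circ \<Rightarrow> passage \<Rightarrow> passage \<Rightarrow> (int \<Rightarrow> int) \<Rightarrow> bool" where
  "dstate w p q N \<longleftrightarrow> state w (\<lambda>_. 1) {p, mate p, q, mate q}
     (\<lambda>f g. along_glue p f g \<and> along_glue q f g) N"

lemma dstate_commute: "dstate w p q N \<longleftrightarrow> dstate w q p N"
proof -
  have "{p, mate p, q, mate q} = {q, mate q, p, mate p}" by auto
  then show ?thesis unfolding dstate_def by (simp only: conj_commute)
qed

lemma dstate_mate: "dstate w p (mate q) N \<longleftrightarrow> dstate w p q N"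
proof -
  have "{p, mate p, mate q, mate (mate q)} = {p, mate p, q, mate q}" by auto
  then show ?thesis unfolding dstate_def by (simp only: along_glue_mate)
qed

text \<open>Smoothing either crossing of the bigon along the orientation leaves the same curve:
  \<open>mate b\<close> in one plays the part of \<open>a\<close> in the other. This accounts for
  the two minus signs, in the weight and in the label difference.\<close>

lemma RII_dbl:
  assumes p: "paired (bigon_word s a b u v)"
    and "dstate (bigon_word s a b u v) p a N" "dstate (bigon_word s a b u v) p b N'"
    and Z: "p \<notin> {a, b, mate a, mate b}" and wt: "wt b = - wt a"
  shows "N = N'"
proof (rule local_change[where ?S1.0 = "[a, b]" and ?S2.0 = "strand s (mate a) (mate b)" and ?S3.0 = "[]"
      and u = u and v = v and x = "[]" and ?S1'.0 = "[a, b]" and ?S2'.0 = "strand s (mate a) (mate b)"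
      and ?S3'.0 = "[]" and \<chi> = "\<lambda>_. 1" and \<chi>' = "\<lambda>_. 1" and Z = "{p, mate p, a, mate a}"
      and Z' = "{p, mate p, b, mate b}" and \<gamma> = "\<lambda>f g. along_glue p f g \<and> along_glue a f g"
      and \<gamma>' = "\<lambda>f g. along_glue p f g \<and> along_glue b f g" and E = "{a, b, mate a, mate b}"])
  note d = bigon_word_distinct[OF p]
  have pn: "p \<noteq> a" "p \<noteq> b" "p \<noteq> mate a" "p \<noteq> mate b" "mate p \<noteq> a" "mate p \<noteq> b"
    using Z by auto
  let ?T = "set ([a, b] @ strand s (mate a) (mate b) @ [])"
  fix f g i1 e1 i2 e2 i3 e3
  assume ch: "chain f g i1 [a, b] e1" "chain f g i2 (strand s (mate a) (mate b)) e2" "chain f g i3 [] e3"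
    and r: "\<And>r. r \<in> ?T - {p, mate p, a, mate a} \<Longrightarrow> g r = f r - wt r * 1"
    and \<gamma>: "along_glue p f g \<and> along_glue a f g"
  have rr: "g b = f b + wt a" "g (mate b) = f (mate b) - wt a"
    using r[of b] r[of "mate b"] pn d wt by auto
  have T: "?T - {p, mate p, a, mate a} = {b, mate b}" "?T - {p, mate p, b, mate b} = {a, mate a}"
    using pn d by auto
  \<comment> \<open>All new labels are forced by the labels at the ends of the strands and by the
    rule at the crossing of \<open>a\<close>, which is no longer smoothed. What remains to be
    verified is the gluing at \<open>b\<close>.\<close>
  define f' where "f' = f(a := i1, b := i1 - wt a, mate a := if s then i2 else e2 - wt a,
     mate b := if s then i2 + wt a else i2)"
  define g' where "g' = g(a := i1 - wt a, b := e1, mate a := if s then i2 + wt a else e2,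
     mate b := if s then e2 else e2 - wt a)"
  have "chain f' g' i1 [a, b] e1" "chain f' g' i2 (strand s (mate a) (mate b)) e2"
    using d by (auto simp: strand_def f'_def g'_def)
  moreover have "\<forall>r\<in>?T - {p, mate p, b, mate b}. g' r = f' r - wt r * 1"
    unfolding T using d by (simp add: f'_def g'_def)
  moreover have "along_glue p f' g' \<and> along_glue b f' g'"
    using \<gamma> rr ch d pn by (cases s) (auto simp: along_glue_def f'_def g'_def strand_def)
  moreover have "val n (\<lambda>_. 1) f g {b, mate b} = val n (\<lambda>_. 1) f' g' {a, mate a}" for n
  proof -
    have "f b + g b - f (mate b) - g (mate b) = - (f' a + g' a - f' (mate a) - g' (mate a))"
      using \<gamma> rr ch d pn by (cases s) (auto simp: along_glue_def f'_def g'_def strand_def)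
    then show ?thesis
      using val_pair[of "{}" b n "\<lambda>_. 1" f g] val_pair[of "{}" a n "\<lambda>_. 1" f' g'] wt
      by (simp only: delta_minus finite.emptyI empty_iff not_False_eq_True val_empty)
  qed
  ultimately show "\<exists>f' g'. (\<forall>r. r \<notin> {a, b, mate a, mate b} \<longrightarrow> f' r = f r \<and> g' r = g r)
     \<and> chain f' g' i1 [a, b] e1 \<and> chain f' g' i2 (strand s (mate a) (mate b)) e2 \<and> chain f' g' i3 [] e3
     \<and> (\<forall>r\<in>?T - {p, mate p, b, mate b}. g' r = f' r - wt r * 1)
     \<and> (along_glue p f' g' \<and> along_glue b f' g')
     \<and> (\<forall>n. val n (\<lambda>_. 1) f g (?T - {p, mate p, a, mate a})
          = val n (\<lambda>_. 1) f' g' (?T - {p, mate p, b, mate b}))"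
    unfolding T using ch(3) by (intro exI[of _ f'] exI[of _ g']) (auto simp: f'_def g'_def)
qed (use assms bigon_word_distinct[OF p] in \<open>auto simp: bigon_word_def dstate_def\<close>)

text \<open>For parallel strands the crossing left over is a kink after either smoothing, with label
  difference zero. For antiparallel strands \<open>mate b\<close> in one curve plays the part of
  \<open>a\<close> in the other. The prescribed values of \<open>\<chi>\<close> and
  \<open>\<chi>'\<close> say on which arc of the smoothed crossing each passage lies.\<close>

lemma RII_sm:
  assumes p: "paired (bigon_word s a b u v)"
    and "state (bigon_word s a b u v) \<chi> {a, mate a} (against_glue a) N"
    and "state (bigon_word s a b u v) \<chi>' {b, mate b} (against_glue b) N'"
    and \<chi>: "\<chi> b = 1" "\<chi> (mate b) = (if s then -1 else 1)" "\<And>r. r \<in> set (u @ v) \<Longrightarrow> \<chi> r = \<chi>' r"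
      "\<chi>' a = -1" "\<chi>' (mate a) = (if s then 1 else -1)"
    and wt: "wt b = - wt a"
  shows "N = N'"
proof (rule local_change[where ?S1.0 = "[a, b]" and ?S2.0 = "strand s (mate a) (mate b)" and ?S3.0 = "[]"
      and u = u and v = v and x = "[]" and ?S1'.0 = "[a, b]" and ?S2'.0 = "strand s (mate a) (mate b)"
      and ?S3'.0 = "[]" and \<chi> = \<chi> and \<chi>' = \<chi>' and Z = "{a, mate a}"
      and Z' = "{b, mate b}" and \<gamma> = "against_glue a"
      and \<gamma>' = "against_glue b" and E = "{a, b, mate a, mate b}"])
  note d = bigon_word_distinct[OF p]
  let ?T = "set ([a, b] @ strand s (mate a) (mate b) @ [])"
  fix f g i1 e1 i2 e2 i3 e3
  assume ch: "chain f g i1 [a, b] e1" "chain f g i2 (strand s (mate a) (mate b)) e2" "chain f g i3 [] e3"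
    and r: "\<And>r. r \<in> ?T - {a, mate a} \<Longrightarrow> g r = f r - wt r * \<chi> (mate r)"
    and \<gamma>: "against_glue a f g"
  have rr: "g b = f b + wt a * \<chi> (mate b)" "g (mate b) = f (mate b) - wt a"
    using r[of b] r[of "mate b"] d wt \<chi> by auto
  have T: "?T - {a, mate a} = {b, mate b}" "?T - {b, mate b} = {a, mate a}"
    using d by auto
  define f' where "f' = f(a := i1, b := i1 - wt a * \<chi>' (mate a), mate a := if s then i2 else e2 + wt a,
     mate b := if s then i2 - wt a else i2)"
  define g' where "g' = g(a := i1 - wt a * \<chi>' (mate a), b := e1, mate a := if s then i2 - wt a else e2,
     mate b := if s then e2 else e2 + wt a)"
  have "chain f' g' i1 [a, b] e1" "chain f' g' i2 (strand s (mate a) (mate b)) e2"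
    using d by (auto simp: strand_def f'_def g'_def)
  moreover have "\<forall>r\<in>?T - {b, mate b}. g' r = f' r - wt r * \<chi>' (mate r)"
    unfolding T using d \<chi> by (simp add: f'_def g'_def)
  moreover have "against_glue b f' g'"
    using \<gamma> rr ch d \<chi> by (cases s) (auto simp: against_glue_def f'_def g'_def strand_def)
  moreover have "val n \<chi> f g {b, mate b} = val n \<chi>' f' g' {a, mate a}" for n
  proof -
    have "f b + g b - f (mate b) - g (mate b) =
        (if s then 1 else -1) * (f' a + g' a - f' (mate a) - g' (mate a))"
      "s \<Longrightarrow> f b + g b - f (mate b) - g (mate b) = 0"
      using \<gamma> rr ch d \<chi> by (cases s; auto simp: against_glue_def f'_def g'_def strand_def)+
    then show ?thesis
      using val_pair[of "{}" b n \<chi> f g] val_pair[of "{}" a n \<chi>' f' g'] wt \<chi>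
        delta_minus[of "2 * n" "f' a + g' a - f' (mate a) - g' (mate a)"]
      by (cases s) simp_all
  qed
  ultimately show "\<exists>f' g'. (\<forall>r. r \<notin> {a, b, mate a, mate b} \<longrightarrow> f' r = f r \<and> g' r = g r)
     \<and> chain f' g' i1 [a, b] e1 \<and> chain f' g' i2 (strand s (mate a) (mate b)) e2 \<and> chain f' g' i3 [] e3
     \<and> (\<forall>r\<in>?T - {b, mate b}. g' r = f' r - wt r * \<chi>' (mate r))
     \<and> against_glue b f' g'
     \<and> (\<forall>n. val n \<chi> f g (?T - {a, mate a}) = val n \<chi>' f' g' (?T - {b, mate b}))"
    unfolding T using ch(3) by (intro exI[of _ f'] exI[of _ g']) (auto simp: f'_def g'_def)
qed (use assms bigon_word_distinct[OF p] in \<open>auto simp: bigon_word_def\<close>)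

subsection \<open>Triangles\<close>

text \<open>
  The crossings of the three strands are those of the passages \<open>a\<close> on the first, \<open>b\<close> on the second
  and \<open>c\<close> on the third strand; each strand ends at its crossing with the next one iff its flag
  is false.
\<close>

definition tri_word ::
  "bool \<Rightarrow> bool \<Rightarrow> bool \<Rightarrow> passage \<Rightarrow> passage \<Rightarrow> passage
    \<Rightarrow> passage list \<Rightarrow> passage list \<Rightarrow> passage list \<Rightarrow> circ" where
  "tri_word s1 s2 s3 a b c u v x =
     strand s1 a (mate c) @ u @ strand s2 b (mate a) @ v @ strand s3 c (mate b) @ x"

definition sg :: "bool \<Rightarrow> int" where
  "sg s = (if s then 1 else -1)"

lemma sg_simps [simp]: "sg True = 1" "sg False = -1"
  by (simp_all add: sg_def)

text \<open>What the triangular face says about three classical crossings, see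
  \<open>triangle_normal\<close>. It makes the two passages of each crossing undergo the same label
  shift in the move.\<close>

definition tri_wts :: "bool \<Rightarrow> bool \<Rightarrow> bool \<Rightarrow> passage \<Rightarrow> passage \<Rightarrow> passage \<Rightarrow> bool" where
  "tri_wts s1 s2 s3 a b c \<longleftrightarrow>
     sg s1 * wt c = sg s2 * wt b \<and> sg s2 * wt a = sg s3 * wt c \<and> sg s3 * wt b = sg s1 * wt a"

lemma tri_word_distinct:
  assumes "paired (tri_word s1 s2 s3 a b c u v x)"
  shows "a \<noteq> b" "b \<noteq> a" "a \<noteq> c" "c \<noteq> a" "b \<noteq> c" "c \<noteq> b"
    "a \<noteq> mate b" "b \<noteq> mate a" "a \<noteq> mate c" "c \<noteq> mate a" "b \<noteq> mate c" "c \<noteq> mate b"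
    "mate a \<noteq> b" "mate b \<noteq> a" "mate a \<noteq> c" "mate c \<noteq> a" "mate b \<noteq> c" "mate c \<noteq> b"
    "{a, b, c, mate a, mate b, mate c} \<inter> set (u @ v @ x) = {}"
    "distinct (u @ v @ x)"
    "\<And>r. r \<in> set (u @ v @ x) \<Longrightarrow> mate r \<in> set (u @ v @ x)"
proof -
  have d: "distinct (tri_word s1 s2 s3 a b c u v x)" and
    m: "\<And>r. r \<in> set (tri_word s1 s2 s3 a b c u v x) \<Longrightarrow> mate r \<in> set (tri_word s1 s2 s3 a b c u v x)"
    using assms by (auto simp: paired_def)
  have d': "distinct [a, b, c, mate a, mate b, mate c]"
    using d unfolding tri_word_def strand_def by (cases s1; cases s2; cases s3) auto
  then show "a \<noteq> b" "b \<noteq> a" "a \<noteq> c" "c \<noteq> a" "b \<noteq> c" "c \<noteq> b"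
    "a \<noteq> mate b" "b \<noteq> mate a" "a \<noteq> mate c" "c \<noteq> mate a" "b \<noteq> mate c" "c \<noteq> mate b"
    "mate a \<noteq> b" "mate b \<noteq> a" "mate a \<noteq> c" "mate c \<noteq> a" "mate b \<noteq> c" "mate c \<noteq> b"
    by auto
  show disj: "{a, b, c, mate a, mate b, mate c} \<inter> set (u @ v @ x) = {}"
    and "distinct (u @ v @ x)"
    using d unfolding tri_word_def strand_def by (cases s1; cases s2; cases s3; auto)+
  fix r assume "r \<in> set (u @ v @ x)"
  then show "mate r \<in> set (u @ v @ x)"
    using m[of r] disj by (auto simp: tri_word_def eq_mate_iff)
qed

lemma val_triple:
  assumes "distinct [a, b, c, mate a, mate b, mate c]"
    and "f a + g a - f (mate a) - g (mate a) = f' a + g' a - f' (mate a) - g' (mate a)"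
    and "f b + g b - f (mate b) - g (mate b) = f' b + g' b - f' (mate b) - g' (mate b)"
    and "f c + g c - f (mate c) - g (mate c) = f' c + g' c - f' (mate c) - g' (mate c)"
  shows "val n \<chi> f g {a, mate a, b, mate b, c, mate c} = val n \<chi> f' g' {a, mate a, b, mate b, c, mate c}"
proof -
  have neq: "a \<notin> {b, mate b, c, mate c}" "mate a \<notin> {b, mate b, c, mate c}"
    "b \<notin> {c, mate c}" "mate b \<notin> {c, mate c}"
    using assms(1) by auto
  have "val n \<chi> h k {a, mate a, b, mate b, c, mate c} =
      2 * (wt a * \<chi> a * \<chi> (mate a) * delta (2 * n) (h a + k a - h (mate a) - k (mate a)))
    + (2 * (wt b * \<chi> b * \<chi> (mate b) * delta (2 * n) (h b + k b - h (mate b) - k (mate b)))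
    + (2 * (wt c * \<chi> c * \<chi> (mate c) * delta (2 * n) (h c + k c - h (mate c) - k (mate c)))))"
    for h k
    using neq val_pair[of "{b, mate b, c, mate c}" a n \<chi> h k] val_pair[of "{c, mate c}" b n \<chi> h k]
      val_pair[of "{}" c n \<chi> h k] by simp
  then show ?thesis by (simp only: assms(2-))
qed

text \<open>Only the sum of the two contributions is compared, so that two crossings may cancel each
  other or exchange their terms.\<close>

lemma val_double:
  assumes "distinct [b, c, mate b, mate c]"
    and "wt b * \<chi> b * \<chi> (mate b) * delta (2 * n) (f b + g b - f (mate b) - g (mate b))
       + wt c * \<chi> c * \<chi> (mate c) * delta (2 * n) (f c + g c - f (mate c) - g (mate c))
     = wt b * \<chi>' b * \<chi>' (mate b) * delta (2 * n) (f' b + g' b - f' (mate b) - g' (mate b))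
       + wt c * \<chi>' c * \<chi>' (mate c) * delta (2 * n) (f' c + g' c - f' (mate c) - g' (mate c))"
  shows "val n \<chi> f g {b, mate b, c, mate c} = val n \<chi>' f' g' {b, mate b, c, mate c}"
proof -
  have neq: "b \<notin> {c, mate c}" "mate b \<notin> {c, mate c}" using assms(1) by auto
  have "val n \<chi> h k {b, mate b, c, mate c} =
      2 * (wt b * \<chi> b * \<chi> (mate b) * delta (2 * n) (h b + k b - h (mate b) - k (mate b))
         + wt c * \<chi> c * \<chi> (mate c) * delta (2 * n) (h c + k c - h (mate c) - k (mate c)))" for \<chi> h k
    using neq val_pair[of "{c, mate c}" b n \<chi> h k] val_pair[of "{}" c n \<chi> h k]
    by (simp add: algebra_simps)
  then show ?thesis by (simp only: assms(2))
qed

text \<open>Every passage of the triangle is shifted by the label change at the other crossing of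
  its strand. By \<open>tri_wts\<close> both passages of a crossing are shifted equally, so the
  label difference at the crossing is kept.\<close>

lemma RIII_state:
  assumes p: "paired (tri_word s1 s2 s3 a b c u v x)"
    and "state (tri_word s1 s2 s3 a b c u v x) \<chi> Z \<gamma> N"
    and "state (tri_word (\<not> s1) (\<not> s2) (\<not> s3) a b c u v x) \<chi> Z \<gamma> N'"
    and Z: "Z \<inter> {a, b, c, mate a, mate b, mate c} = {}" and \<gamma>: "local_glue Z \<gamma>"
    and \<chi>: "\<chi> a = \<chi> (mate c)" "\<chi> b = \<chi> (mate a)" "\<chi> c = \<chi> (mate b)"
    and wts: "tri_wts s1 s2 s3 a b c"
  shows "N = N'"
proof (rule local_change[where ?S1.0 = "strand s1 a (mate c)" and ?S2.0 = "strand s2 b (mate a)"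
      and ?S3.0 = "strand s3 c (mate b)"
      and ?S1'.0 = "strand (\<not> s1) a (mate c)" and ?S2'.0 = "strand (\<not> s2) b (mate a)"
      and ?S3'.0 = "strand (\<not> s3) c (mate b)"
      and u = u and v = v and x = x and \<chi> = \<chi> and \<chi>' = \<chi> and Z = Z and Z' = Z and \<gamma> = \<gamma> and \<gamma>' = \<gamma>
      and E = "{a, b, c, mate a, mate b, mate c}"])
  note d = tri_word_distinct[OF p]
  let ?T = "set (strand s1 a (mate c) @ strand s2 b (mate a) @ strand s3 c (mate b))"
  let ?T' = "set (strand (\<not> s1) a (mate c) @ strand (\<not> s2) b (mate a) @ strand (\<not> s3) c (mate b))"
  fix f g i1 e1 i2 e2 i3 e3
  assume ch: "chain f g i1 (strand s1 a (mate c)) e1" "chain f g i2 (strand s2 b (mate a)) e2"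
      "chain f g i3 (strand s3 c (mate b)) e3"
    and r: "\<And>r. r \<in> ?T - Z \<Longrightarrow> g r = f r - wt r * \<chi> (mate r)" and "\<gamma> f g"
  have T: "?T - Z = {a, mate a, b, mate b, c, mate c}" "?T' - Z = {a, mate a, b, mate b, c, mate c}"
    using Z by auto
  have rr: "g a = f a - wt a * \<chi> b" "g b = f b - wt b * \<chi> c" "g c = f c - wt c * \<chi> a"
    "g (mate a) = f (mate a) + wt a * \<chi> a" "g (mate b) = f (mate b) + wt b * \<chi> b"
    "g (mate c) = f (mate c) + wt c * \<chi> c"
    using r[of a] r[of b] r[of c] r[of "mate a"] r[of "mate b"] r[of "mate c"] \<chi> unfolding T by auto
  \<comment> \<open>If \<open>a\<close> came first on its strand (\<open>s1\<close>), it is now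
    preceded by \<open>mate c\<close>, whose rule adds \<open>wt c * \<chi> c\<close>; otherwise
    this amount is lost. The other five entries arise in the same way.\<close>
  define t where "t = (\<lambda>_. 0)(a := sg s1 * wt c * \<chi> c, mate c := sg s1 * wt a * \<chi> b,
    b := sg s2 * wt a * \<chi> a, mate a := sg s2 * wt b * \<chi> c,
    c := sg s3 * wt b * \<chi> b, mate b := sg s3 * wt c * \<chi> a)"
  define f' where "f' = (\<lambda>r. f r + t r)"
  define g' where "g' = (\<lambda>r. g r + t r)"
  have t: "t a = sg s1 * wt c * \<chi> c" "t (mate c) = sg s1 * wt a * \<chi> b"
    "t b = sg s2 * wt a * \<chi> a" "t (mate a) = sg s2 * wt b * \<chi> c"
    "t c = sg s3 * wt b * \<chi> b" "t (mate b) = sg s3 * wt c * \<chi> a"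
    "\<And>r. r \<notin> {a, b, c, mate a, mate b, mate c} \<Longrightarrow> t r = 0"
    unfolding t_def using d by simp_all
  have c1: "chain f' g' i1 (strand (\<not> s1) a (mate c)) e1"
    using ch(1) rr t by (cases s1) (auto simp: strand_def f'_def g'_def)
  have c2: "chain f' g' i2 (strand (\<not> s2) b (mate a)) e2"
    using ch(2) rr t by (cases s2) (auto simp: strand_def f'_def g'_def)
  have c3: "chain f' g' i3 (strand (\<not> s3) c (mate b)) e3"
    using ch(3) rr t by (cases s3) (auto simp: strand_def f'_def g'_def)
  have rule: "\<forall>r\<in>?T' - Z. g' r = f' r - wt r * \<chi> (mate r)"
    unfolding T using rr \<chi> by (auto simp: f'_def g'_def)
  have "t r = 0" if "r \<in> Z" for r using t(7)[of r] Z that by auto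
  then have \<gamma>': "\<gamma> f' g'"
    by (intro local_glueD[OF \<gamma> \<open>\<gamma> f g\<close>]) (simp_all add: f'_def g'_def)
  have tt: "t a = t (mate a)" "t b = t (mate b)" "t c = t (mate c)"
    using wts unfolding t tri_wts_def by (simp_all)
  have "val n \<chi> f g (?T - Z) = val n \<chi> f' g' (?T' - Z)" for n
    unfolding T by (rule val_triple) (use d tt in \<open>auto simp: f'_def g'_def\<close>)
  then show "\<exists>f' g'. (\<forall>r. r \<notin> {a, b, c, mate a, mate b, mate c} \<longrightarrow> f' r = f r \<and> g' r = g r)
     \<and> chain f' g' i1 (strand (\<not> s1) a (mate c)) e1 \<and> chain f' g' i2 (strand (\<not> s2) b (mate a)) e2
     \<and> chain f' g' i3 (strand (\<not> s3) c (mate b)) e3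
     \<and> (\<forall>r\<in>?T' - Z. g' r = f' r - wt r * \<chi> (mate r)) \<and> \<gamma> f' g'
     \<and> (\<forall>n. val n \<chi> f g (?T - Z) = val n \<chi> f' g' (?T' - Z))"
    using c1 c2 c3 rule \<gamma>' t(7) by (intro exI[of _ f'] exI[of _ g']) (auto simp: f'_def g'_def)
qed (use assms tri_word_distinct[OF p] in \<open>auto simp: tri_word_def\<close>)

lemma chain_strandD:
  assumes "chain f g i (strand s p q) e"
  shows "i = (if s then f p else f q)" "e = (if s then g q else g p)"
    "(if s then g p else g q) = (if s then f q else f p)"
  using assms by (auto simp: strand_def split: if_splits)

text \<open>Smoothing \<open>a\<close> along the orientation reconnects the first two strands. If
  \<open>s1 = s2\<close>, the other two crossings lie on one of the new strands, form a bigon with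
  the third strand and cancel, before and after the move. Otherwise each new strand carries one of
  them, and the crossings of \<open>b\<close> and \<open>c\<close> trade places.\<close>

lemma RIII_dbl:
  assumes p: "paired (tri_word s1 s2 s3 a b c u v x)"
    and "dstate (tri_word s1 s2 s3 a b c u v x) p a N"
    and "dstate (tri_word (\<not> s1) (\<not> s2) (\<not> s3) a b c u v x) p a N'"
    and Z: "p \<notin> {a, b, c, mate a, mate b, mate c}"
    and wts: "tri_wts s1 s2 s3 a b c"
  shows "N = N'"
proof (rule local_change[where ?S1.0 = "strand s1 a (mate c)" and ?S2.0 = "strand s2 b (mate a)"
      and ?S3.0 = "strand s3 c (mate b)"
      and ?S1'.0 = "strand (\<not> s1) a (mate c)" and ?S2'.0 = "strand (\<not> s2) b (mate a)"
      and ?S3'.0 = "strand (\<not> s3) c (mate b)"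
      and u = u and v = v and x = x and \<chi> = "\<lambda>_. 1" and \<chi>' = "\<lambda>_. 1"
      and Z = "{p, mate p, a, mate a}" and Z' = "{p, mate p, a, mate a}"
      and \<gamma> = "\<lambda>f g. along_glue p f g \<and> along_glue a f g"
      and \<gamma>' = "\<lambda>f g. along_glue p f g \<and> along_glue a f g"
      and E = "{a, b, c, mate a, mate b, mate c}"])
  note d = tri_word_distinct[OF p]
  let ?Z = "{p, mate p, a, mate a}"
  let ?T = "set (strand s1 a (mate c) @ strand s2 b (mate a) @ strand s3 c (mate b))"
  let ?T' = "set (strand (\<not> s1) a (mate c) @ strand (\<not> s2) b (mate a) @ strand (\<not> s3) c (mate b))"
  have pn: "p \<noteq> a" "p \<noteq> b" "p \<noteq> c" "p \<noteq> mate a" "p \<noteq> mate b" "p \<noteq> mate c"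
    "mate p \<noteq> a" "mate p \<noteq> b" "mate p \<noteq> c"
    using Z by auto
  fix f g i1 e1 i2 e2 i3 e3
  assume ch: "chain f g i1 (strand s1 a (mate c)) e1" "chain f g i2 (strand s2 b (mate a)) e2"
      "chain f g i3 (strand s3 c (mate b)) e3"
    and r: "\<And>r. r \<in> ?T - ?Z \<Longrightarrow> g r = f r - wt r * 1" and \<gamma>: "along_glue p f g \<and> along_glue a f g"
  have T: "?T - ?Z = {b, mate b, c, mate c}" "?T' - ?Z = {b, mate b, c, mate c}"
    using d pn by auto
  have rr: "g b = f b - wt b" "g c = f c - wt c" "g (mate b) = f (mate b) + wt b"
    "g (mate c) = f (mate c) + wt c"
    using r[of b] r[of c] r[of "mate b"] r[of "mate c"] unfolding T by auto
  \<comment> \<open>Again the end labels and the rules at the crossings of \<open>b\<close> and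
    \<open>c\<close> leave no choice.\<close>
  define f' where "f' = f(
    a := (if s1 then i1 + wt c else i1), mate c := (if s1 then i1 else e1 - wt c),
    b := (if s2 then e2 + wt b else i2), mate a := (if s2 then i2 else i2 - wt b),
    c := (if s3 then e3 + wt c else i3), mate b := (if s3 then i3 else i3 - wt c))"
  define g' where "g' = g(
    a := (if s1 then e1 else e1 - wt c), mate c := (if s1 then i1 + wt c else e1),
    b := (if s2 then e2 else i2 - wt b), mate a := (if s2 then e2 + wt b else e2),
    c := (if s3 then e3 else i3 - wt c), mate b := (if s3 then i3 + wt b else e3))"
  have v: "f' a = (if s1 then i1 + wt c else i1)" "f' (mate c) = (if s1 then i1 else e1 - wt c)"
    "f' b = (if s2 then e2 + wt b else i2)" "f' (mate a) = (if s2 then i2 else i2 - wt b)"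
    "f' c = (if s3 then e3 + wt c else i3)" "f' (mate b) = (if s3 then i3 else i3 - wt c)"
    "g' a = (if s1 then e1 else e1 - wt c)" "g' (mate c) = (if s1 then i1 + wt c else e1)"
    "g' b = (if s2 then e2 else i2 - wt b)" "g' (mate a) = (if s2 then e2 + wt b else e2)"
    "g' c = (if s3 then e3 else i3 - wt c)" "g' (mate b) = (if s3 then i3 + wt b else e3)"
    "\<And>r. r \<notin> {a, b, c, mate a, mate b, mate c} \<Longrightarrow> f' r = f r \<and> g' r = g r"
    unfolding f'_def g'_def using d by simp_all
  have c12: "chain f' g' i1 (strand (\<not> s1) a (mate c)) e1" "chain f' g' i2 (strand (\<not> s2) b (mate a)) e2"
    by (auto simp: strand_def v)
  note eqs = chain_strandD[OF ch(1)] chain_strandD[OF ch(2)] chain_strandD[OF ch(3)]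
  note nfs = if_True if_False sg_simps mult_1 mult_minus_left
  \<comment> \<open>Both crossings of the third strand stay unsmoothed, so its total label change
    \<open>wt b - wt c\<close> is the same in either order.\<close>
  have m3: "i3 + wt b = e3 + wt c" using eqs(7-9) rr by (cases s3; simp only: nfs; linarith)
  have c3: "chain f' g' i3 (strand (\<not> s3) c (mate b)) e3"
    using m3 by (auto simp: strand_def v)
  have rule: "\<forall>r\<in>?T' - ?Z. g' r = f' r - wt r * 1"
    unfolding T using m3 by (simp add: v)
  have \<gamma>': "along_glue p f' g'"
    using \<gamma> v(13)[of p] v(13)[of "mate p"] pn by (auto simp: along_glue_def)
  have \<gamma>a: "g a = f (mate a)" "g (mate a) = f a" using \<gamma> by (auto simp: along_glue_def)
  have wts': "sg s1 * wt c = sg s2 * wt b" "sg s2 * wt a = sg s3 * wt c" "sg s3 * wt b = sg s1 * wt a"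
    using wts by (simp_all add: tri_wts_def)
  have fs: "f (mate c) = (if s1 then f (mate a) else f a - wt c)"
    "f b = (if s2 then f (mate a) + wt b else f a)"
    "f c = f (mate b) + (if s3 then wt c else wt b)"
    using eqs(3) rr(4) \<gamma>a(1) apply (cases s1; simp only: nfs; linarith)
    using eqs(6) rr(1) \<gamma>a(2) apply (cases s2; simp only: nfs; linarith)
    using eqs(9) rr(2,3) by (cases s3; simp only: nfs; linarith)
  have wt12: "wt c = sg s1 * sg s2 * wt b" using wts'(1) by (cases s1; cases s2) auto
  have \<gamma>'': "along_glue a f' g'"
    unfolding along_glue_def v eqs(1,2,4,5,7,8) \<gamma>a rr fs using wt12
    by (cases s1; cases s2; simp)
  let ?b = "f b + g b - f (mate b) - g (mate b)" and ?c = "f c + g c - f (mate c) - g (mate c)"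
  let ?b' = "f' b + g' b - f' (mate b) - g' (mate b)" and ?c' = "f' c + g' c - f' (mate c) - g' (mate c)"
  have M: "if s1 = s2 then ?b = - ?c \<and> ?b' = - ?c' else ?b = - ?c' \<and> ?c = - ?b'"
    unfolding v eqs(1,2,4,5,7,8) \<gamma>a rr fs using wt12
    by (cases s1; cases s2; cases s3; simp)
  have "wt b * delta (2 * n) ?b + wt c * delta (2 * n) ?c
      = wt b * delta (2 * n) ?b' + wt c * delta (2 * n) ?c'" for n
  proof (cases "s1 = s2")
    case True
    then have "?b = - ?c" "?b' = - ?c'" "wt c = wt b" using M wt12 by (auto simp: sg_def)
    then show ?thesis by (simp only: delta_minus)
  next
    case False
    then have "?b = - ?c'" "?c = - ?b'" "wt c = - wt b" using M wt12 by (auto simp: sg_def)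
    then show ?thesis by (simp only: delta_minus)
  qed
  then have "val n (\<lambda>_. 1) f g {b, mate b, c, mate c} = val n (\<lambda>_. 1) f' g' {b, mate b, c, mate c}" for n
    by (intro val_double) (use d in simp_all)
  then have vl: "\<forall>n. val n (\<lambda>_. 1) f g (?T - ?Z) = val n (\<lambda>_. 1) f' g' (?T' - ?Z)"
    unfolding T by blast
  have "\<forall>r. r \<notin> {a, b, c, mate a, mate b, mate c} \<longrightarrow> f' r = f r \<and> g' r = g r"
    using v(13) by blast
  then show "\<exists>f' g'. (\<forall>r. r \<notin> {a, b, c, mate a, mate b, mate c} \<longrightarrow> f' r = f r \<and> g' r = g r)
     \<and> chain f' g' i1 (strand (\<not> s1) a (mate c)) e1 \<and> chain f' g' i2 (strand (\<not> s2) b (mate a)) e2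
     \<and> chain f' g' i3 (strand (\<not> s3) c (mate b)) e3
     \<and> (\<forall>r\<in>?T' - ?Z. g' r = f' r - wt r * 1) \<and> (along_glue p f' g' \<and> along_glue a f' g')
     \<and> (\<forall>n. val n (\<lambda>_. 1) f g (?T - ?Z) = val n (\<lambda>_. 1) f' g' (?T' - ?Z))"
    using c12 c3 rule \<gamma>' \<gamma>'' vl by blast
qed (use assms tri_word_distinct[OF p] in \<open>auto simp: tri_word_def dstate_def\<close>)

text \<open>Smoothing \<open>a\<close> against the orientation interchanges the two cases of
  \<open>RIII_dbl\<close>: for \<open>s1 = s2\<close> the crossings of \<open>b\<close> and
  \<open>c\<close> trade places, for \<open>s1 \<noteq> s2\<close> they form a bigon and cancel on
  each side.\<close>

lemma RIII_sm:
  assumes p: "paired (tri_word s1 s2 s3 a b c u v x)"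
    and "state (tri_word s1 s2 s3 a b c u v x) \<chi> {a, mate a} (against_glue a) N"
    and "state (tri_word (\<not> s1) (\<not> s2) (\<not> s3) a b c u v x) \<chi>' {a, mate a} (against_glue a) N'"
    and \<chi>: "\<chi> (mate c) = sg s1" "\<chi> b = sg s2" "\<chi> c = -1" "\<chi> (mate b) = -1"
      "\<chi>' (mate c) = - sg s1" "\<chi>' b = - sg s2" "\<chi>' c = -1" "\<chi>' (mate b) = -1"
      "\<And>r. r \<in> set (u @ v @ x) \<Longrightarrow> \<chi> r = \<chi>' r"
    and wts: "tri_wts s1 s2 s3 a b c"
  shows "N = N'"
proof (rule local_change[where ?S1.0 = "strand s1 a (mate c)" and ?S2.0 = "strand s2 b (mate a)"
      and ?S3.0 = "strand s3 c (mate b)"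
      and ?S1'.0 = "strand (\<not> s1) a (mate c)" and ?S2'.0 = "strand (\<not> s2) b (mate a)"
      and ?S3'.0 = "strand (\<not> s3) c (mate b)"
      and u = u and v = v and x = x and \<chi> = \<chi> and \<chi>' = \<chi>'
      and Z = "{a, mate a}" and Z' = "{a, mate a}"
      and \<gamma> = "against_glue a" and \<gamma>' = "against_glue a"
      and E = "{a, b, c, mate a, mate b, mate c}"])
  note d = tri_word_distinct[OF p]
  let ?Z = "{a, mate a}"
  let ?T = "set (strand s1 a (mate c) @ strand s2 b (mate a) @ strand s3 c (mate b))"
  let ?T' = "set (strand (\<not> s1) a (mate c) @ strand (\<not> s2) b (mate a) @ strand (\<not> s3) c (mate b))"
  fix f g i1 e1 i2 e2 i3 e3
  assume ch: "chain f g i1 (strand s1 a (mate c)) e1" "chain f g i2 (strand s2 b (mate a)) e2"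
      "chain f g i3 (strand s3 c (mate b)) e3"
    and r: "\<And>r. r \<in> ?T - ?Z \<Longrightarrow> g r = f r - wt r * \<chi> (mate r)" and \<gamma>: "against_glue a f g"
  have T: "?T - ?Z = {b, mate b, c, mate c}" "?T' - ?Z = {b, mate b, c, mate c}"
    using d by auto
  \<comment> \<open>The common value in the first equation of \<open>tri_wts\<close>. The third
    strand lies entirely on the reversed arc and its two passages change the label by
    \<open>k\<close> and \<open>- k\<close>, so it returns to its initial label.\<close>
  define k where "k = sg s1 * wt c"
  have k: "k = sg s2 * wt b" "sg s1 * k = wt c" "sg s2 * k = wt b"
  proof -
    show "k = sg s2 * wt b" using wts unfolding k_def tri_wts_def by blast
    then show "sg s2 * k = wt b" by (cases s2) simp_all
    show "sg s1 * k = wt c" by (cases s1) (simp_all add: k_def)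
  qed
  have kk: "wt c * sg s1 = k" "wt b * sg s2 = k"
    by (simp only: k_def mult.commute, simp only: k(1) mult.commute)
  have rr: "g b = f b + wt b" "g c = f c - k" "g (mate b) = f (mate b) + k"
    "g (mate c) = f (mate c) - wt c"
  proof -
    show "g b = f b + wt b" "g c = f c - k" "g (mate b) = f (mate b) + k"
      "g (mate c) = f (mate c) - wt c"
      using r[of b] r[of c] r[of "mate b"] r[of "mate c"] unfolding T by (simp_all add: \<chi> kk)
  qed
  define f' where "f' = f(
    a := (if s1 then i1 - wt c else i1),
    mate c := (if s1 then i1 else e1 + wt c),
    b := (if s2 then e2 - wt b else i2),
    mate a := (if s2 then i2 else i2 + wt b),
    c := (if s3 then i3 - k else i3),
    mate b := (if s3 then i3 else i3 + k))"
  define g' where "g' = g(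
    a := (if s1 then e1 else e1 + wt c),
    mate c := (if s1 then i1 - wt c else e1),
    b := (if s2 then e2 else i2 + wt b),
    mate a := (if s2 then e2 - wt b else e2),
    c := (if s3 then e3 else i3 + k),
    mate b := (if s3 then i3 - k else e3))"
  have v: "f' (a) = (if s1 then i1 - wt c else i1)" "f' (mate c) = (if s1 then i1 else e1 + wt c)" "f' (b) = (if s2 then e2 - wt b else i2)" "f' (mate a) = (if s2 then i2 else i2 + wt b)" "f' (c) = (if s3 then i3 - k else i3)" "f' (mate b) = (if s3 then i3 else i3 + k)"
    "g' (a) = (if s1 then e1 else e1 + wt c)" "g' (mate c) = (if s1 then i1 - wt c else e1)" "g' (b) = (if s2 then e2 else i2 + wt b)" "g' (mate a) = (if s2 then e2 - wt b else e2)" "g' (c) = (if s3 then e3 else i3 + k)" "g' (mate b) = (if s3 then i3 - k else e3)"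
    "\<And>r. r \<notin> {a, b, c, mate a, mate b, mate c} \<Longrightarrow> f' r = f r \<and> g' r = g r"
    unfolding f'_def g'_def using d by simp_all
  have c12: "chain f' g' i1 (strand (\<not> s1) a (mate c)) e1" "chain f' g' i2 (strand (\<not> s2) b (mate a)) e2"
    by (auto simp: strand_def v)
  note eqs = chain_strandD[OF ch(1)] chain_strandD[OF ch(2)] chain_strandD[OF ch(3)]
  note nfs = if_True if_False sg_simps mult_1 mult_minus_left
  have m3: "e3 = i3" using eqs(7-9) rr by (cases s3; simp only: nfs; linarith)
  have c3: "chain f' g' i3 (strand (\<not> s3) c (mate b)) e3"
    using m3 by (auto simp: strand_def v)
  have rule: "\<forall>r\<in>?T' - ?Z. g' r = f' r - wt r * \<chi>' (mate r)"
    unfolding T using m3 by (simp add: v \<chi> kk)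
  have \<gamma>a: "f (mate a) = f a" "g (mate a) = g a" using \<gamma> by (auto simp: against_glue_def)
  have fs: "f (mate c) = (if s1 then g a else f a + wt c)" "f b = (if s2 then f a - wt b else g a)"
    "f c = f (mate b) + k"
    using eqs(3) rr(4) \<gamma>a apply (cases s1; simp only: nfs; linarith)
    using eqs(6) rr(1) \<gamma>a apply (cases s2; simp only: nfs; linarith)
    using eqs(9) rr(2,3) by (cases s3; simp only: nfs; linarith)
  have wtk: "wt c = sg s1 * k" "wt b = sg s2 * k" using k(2,3) by simp_all
  have \<gamma>': "against_glue a f' g'"
    unfolding against_glue_def v eqs(1,2,4,5,7,8) \<gamma>a rr fs wtk
    by (cases s1; cases s2; simp)
  let ?b = "f b + g b - f (mate b) - g (mate b)" and ?c = "f c + g c - f (mate c) - g (mate c)"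
  let ?b' = "f' b + g' b - f' (mate b) - g' (mate b)" and ?c' = "f' c + g' c - f' (mate c) - g' (mate c)"
  have M: "if s1 = s2 then ?b = - ?c' \<and> ?c = - ?b' else ?b = - ?c \<and> ?b' = - ?c'"
    unfolding v eqs(1,2,4,5,7,8) \<gamma>a rr fs wtk
    by (cases s1; cases s2; cases s3; simp)
  have "- k * delta (2 * n) ?b + - k * delta (2 * n) ?c
      = k * delta (2 * n) ?b' + k * delta (2 * n) ?c'" for n
  proof (cases "s1 = s2")
    case True
    then have "?b = - ?c'" "?c = - ?b'" using M by auto
    then show ?thesis by (simp only: delta_minus)
  next
    case False
    then have "?b = - ?c" "?b' = - ?c'" using M by auto
    then show ?thesis by (simp only: delta_minus)
  qed
  moreover have "wt b * \<chi> b * \<chi> (mate b) = - k" "wt c * \<chi> c * \<chi> (mate c) = - k"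
    "wt b * \<chi>' b * \<chi>' (mate b) = k" "wt c * \<chi>' c * \<chi>' (mate c) = k"
  proof -
    show "wt b * \<chi> b * \<chi> (mate b) = - k" "wt c * \<chi> c * \<chi> (mate c) = - k"
      "wt b * \<chi>' b * \<chi>' (mate b) = k" "wt c * \<chi>' c * \<chi>' (mate c) = k"
      by (simp_all add: \<chi> kk)
  qed
  ultimately have "val n \<chi> f g {b, mate b, c, mate c} = val n \<chi>' f' g' {b, mate b, c, mate c}" for n
    by (intro val_double) (use d in simp_all)
  then have vl: "\<forall>n. val n \<chi> f g (?T - ?Z) = val n \<chi>' f' g' (?T' - ?Z)"
    unfolding T by blast
  have "\<forall>r. r \<notin> {a, b, c, mate a, mate b, mate c} \<longrightarrow> f' r = f r \<and> g' r = g r"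
    using v(13) by blast
  then show "\<exists>f' g'. (\<forall>r. r \<notin> {a, b, c, mate a, mate b, mate c} \<longrightarrow> f' r = f r \<and> g' r = g r)
     \<and> chain f' g' i1 (strand (\<not> s1) a (mate c)) e1 \<and> chain f' g' i2 (strand (\<not> s2) b (mate a)) e2
     \<and> chain f' g' i3 (strand (\<not> s3) c (mate b)) e3
     \<and> (\<forall>r\<in>?T' - ?Z. g' r = f' r - wt r * \<chi>' (mate r)) \<and> against_glue a f' g'
     \<and> (\<forall>n. val n \<chi> f g (?T - ?Z) = val n \<chi>' f' g' (?T' - ?Z))"
    using c12 c3 rule \<gamma>' vl by blast
qed (use assms tri_word_distinct[OF p] in \<open>auto simp: tri_word_def\<close>)

text \<open>
  Smoothing two crossings of the triangle along the orientation gives the same curve, up to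
  the name of the third crossing, for every pair of linked crossings on either side of the move.
\<close>

lemma RIII_two_same:
  assumes p: "paired (tri_word s1 s2 s3 a b c u v x)"
    and "dstate (tri_word s1 s2 s3 a b c u v x) a c N"
    and "dstate (tri_word s1 s2 s3 a b c u v x) a b N'"
    and s: "s1" "s2" and wts: "tri_wts s1 s2 s3 a b c"
  shows "N = N'"
proof (rule local_change[where ?S1.0 = "strand s1 a (mate c)" and ?S2.0 = "strand s2 b (mate a)"
      and ?S3.0 = "strand s3 c (mate b)"
      and ?S1'.0 = "strand s1 a (mate c)" and ?S2'.0 = "strand s2 b (mate a)"
      and ?S3'.0 = "strand s3 c (mate b)"
      and u = u and v = v and x = x and \<chi> = "\<lambda>_. 1" and \<chi>' = "\<lambda>_. 1"
      and Z = "{a, mate a, c, mate c}" and Z' = "{a, mate a, b, mate b}"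
      and \<gamma> = "\<lambda>f g. along_glue a f g \<and> along_glue c f g"
      and \<gamma>' = "\<lambda>f g. along_glue a f g \<and> along_glue b f g"
      and E = "{a, b, c, mate a, mate b, mate c}"])
  note d = tri_word_distinct[OF p]
  let ?Z = "{a, mate a, c, mate c}" and ?Z' = "{a, mate a, b, mate b}"
  let ?T = "set (strand s1 a (mate c) @ strand s2 b (mate a) @ strand s3 c (mate b))"
  fix f g i1 e1 i2 e2 i3 e3
  assume ch: "chain f g i1 (strand s1 a (mate c)) e1" "chain f g i2 (strand s2 b (mate a)) e2"
      "chain f g i3 (strand s3 c (mate b)) e3"
    and r: "\<And>r. r \<in> ?T - ?Z \<Longrightarrow> g r = f r - wt r * 1" and \<gamma>: "along_glue a f g \<and> along_glue c f g"
  have T: "?T - ?Z = {b, mate b}" "?T - ?Z' = {c, mate c}"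
    using d by auto
  have wt: "wt c = wt b" using wts s by (simp add: tri_wts_def)
  have rr: "g b = f b - wt b" "g (mate b) = f (mate b) + wt b"
    using r[of b] r[of "mate b"] unfolding T by auto
  define f' where "f' = f(a := i1, mate c := e1 - wt c, b := i2, mate a := e1 - wt c,
    c := (if s3 then i3 else e3 + wt c), mate b := (if s3 then i3 - wt c else i3))"
  define g' where "g' = g(a := e1 - wt c, mate c := e1, b := e1 - wt c, mate a := e2,
    c := (if s3 then i3 - wt c else e3), mate b := (if s3 then e3 else e3 + wt c))"
  have v: "f' a = i1" "f' (mate c) = e1 - wt c" "f' b = i2" "f' (mate a) = e1 - wt c"
    "f' c = (if s3 then i3 else e3 + wt c)" "f' (mate b) = (if s3 then i3 - wt c else i3)"
    "g' a = e1 - wt c" "g' (mate c) = e1" "g' b = e1 - wt c" "g' (mate a) = e2"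
    "g' c = (if s3 then i3 - wt c else e3)" "g' (mate b) = (if s3 then e3 else e3 + wt c)"
    "\<And>r. r \<notin> {a, b, c, mate a, mate b, mate c} \<Longrightarrow> f' r = f r \<and> g' r = g r"
    unfolding f'_def g'_def using d by simp_all
  have c: "chain f' g' i1 (strand s1 a (mate c)) e1" "chain f' g' i2 (strand s2 b (mate a)) e2"
    "chain f' g' i3 (strand s3 c (mate b)) e3"
    using s by (auto simp: strand_def v)
  have rule: "\<forall>r\<in>?T - ?Z'. g' r = f' r - wt r * 1"
    unfolding T by (simp add: v)
  note eqs = chain_strandD[OF ch(1)] chain_strandD[OF ch(2)] chain_strandD[OF ch(3)]
  have \<gamma>a: "g a = f (mate a)" "g (mate a) = f a" "g c = f (mate c)" "g (mate c) = f c"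
    using \<gamma> by (auto simp: along_glue_def)
  have fs: "f (mate c) = f (mate a)" "f b = f (mate a) + wt b"
    "if s3 then f (mate b) = f (mate a) else f c = f (mate b) + wt b"
    using eqs(3,6,9) s rr unfolding \<gamma>a by (simp_all split: if_splits)
  have \<gamma>': "along_glue a f' g' \<and> along_glue b f' g'"
    unfolding along_glue_def v eqs(1,2,4,5,7,8) \<gamma>a rr wt using fs s
    by (cases s3) simp_all
  have M: "f b + g b - f (mate b) - g (mate b) = f' c + g' c - f' (mate c) - g' (mate c)"
    unfolding v eqs(1,2,4,5,7,8) \<gamma>a rr wt using fs s
    by (cases s3) simp_all
  have "val n (\<lambda>_. 1) f g {b, mate b} = val n (\<lambda>_. 1) f' g' {c, mate c}" for n
    using val_pair[of "{}" b n "\<lambda>_. 1" f g] val_pair[of "{}" c n "\<lambda>_. 1" f' g'] wt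
    unfolding M by simp
  then have vl: "\<forall>n. val n (\<lambda>_. 1) f g (?T - ?Z) = val n (\<lambda>_. 1) f' g' (?T - ?Z')"
    unfolding T by blast
  have "\<forall>r. r \<notin> {a, b, c, mate a, mate b, mate c} \<longrightarrow> f' r = f r \<and> g' r = g r"
    using v(13) by blast
  then show "\<exists>f' g'. (\<forall>r. r \<notin> {a, b, c, mate a, mate b, mate c} \<longrightarrow> f' r = f r \<and> g' r = g r)
     \<and> chain f' g' i1 (strand s1 a (mate c)) e1 \<and> chain f' g' i2 (strand s2 b (mate a)) e2
     \<and> chain f' g' i3 (strand s3 c (mate b)) e3
     \<and> (\<forall>r\<in>?T - ?Z'. g' r = f' r - wt r * 1) \<and> (along_glue a f' g' \<and> along_glue b f' g')
     \<and> (\<forall>n. val n (\<lambda>_. 1) f g (?T - ?Z) = val n (\<lambda>_. 1) f' g' (?T - ?Z'))"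
    using c rule \<gamma>' vl by blast
qed (use assms tri_word_distinct[OF p] in \<open>auto simp: tri_word_def dstate_def\<close>)

text \<open>For opposite flags \<open>a\<close> is linked with exactly one of the two crossings:
  with that of \<open>c\<close> before the move and with that of \<open>b\<close> after it. The
  third crossing of one picture corresponds to the reversed third crossing of the other.\<close>

lemma RIII_two_opposite:
  assumes p: "paired (tri_word s1 s2 s3 a b c u v x)"
    and "dstate (tri_word s1 s2 s3 a b c u v x) a c N"
    and "dstate (tri_word (\<not> s1) (\<not> s2) (\<not> s3) a b c u v x) a b N'"
    and s: "s1" "\<not> s2" and wts: "tri_wts s1 s2 s3 a b c"
  shows "N = N'"
proof (rule local_change[where ?S1.0 = "strand s1 a (mate c)" and ?S2.0 = "strand s2 b (mate a)"
      and ?S3.0 = "strand s3 c (mate b)"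
      and ?S1'.0 = "strand (\<not> s1) a (mate c)" and ?S2'.0 = "strand (\<not> s2) b (mate a)"
      and ?S3'.0 = "strand (\<not> s3) c (mate b)"
      and u = u and v = v and x = x and \<chi> = "\<lambda>_. 1" and \<chi>' = "\<lambda>_. 1"
      and Z = "{a, mate a, c, mate c}" and Z' = "{a, mate a, b, mate b}"
      and \<gamma> = "\<lambda>f g. along_glue a f g \<and> along_glue c f g"
      and \<gamma>' = "\<lambda>f g. along_glue a f g \<and> along_glue b f g"
      and E = "{a, b, c, mate a, mate b, mate c}"])
  note d = tri_word_distinct[OF p]
  let ?Z = "{a, mate a, c, mate c}" and ?Z' = "{a, mate a, b, mate b}"
  let ?T = "set (strand s1 a (mate c) @ strand s2 b (mate a) @ strand s3 c (mate b))"
  let ?T' = "set (strand (\<not> s1) a (mate c) @ strand (\<not> s2) b (mate a) @ strand (\<not> s3) c (mate b))"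
  fix f g i1 e1 i2 e2 i3 e3
  assume ch: "chain f g i1 (strand s1 a (mate c)) e1" "chain f g i2 (strand s2 b (mate a)) e2"
      "chain f g i3 (strand s3 c (mate b)) e3"
    and r: "\<And>r. r \<in> ?T - ?Z \<Longrightarrow> g r = f r - wt r * 1" and \<gamma>: "along_glue a f g \<and> along_glue c f g"
  have T: "?T - ?Z = {b, mate b}" "?T' - ?Z' = {c, mate c}"
    using d by auto
  have wt: "wt c = - wt b" using wts s by (simp add: tri_wts_def)
  have rr: "g b = f b - wt b" "g (mate b) = f (mate b) + wt b"
    using r[of b] r[of "mate b"] unfolding T by auto
  define f' where "f' = f(a := i1 + wt c, mate c := i1, b := i2, mate a := e1,
    c := (if s3 then e3 + wt c else i3), mate b := (if s3 then i3 else i3 - wt c))"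
  define g' where "g' = g(a := e1, mate c := i1 + wt c, b := e1, mate a := e2,
    c := (if s3 then e3 else i3 - wt c), mate b := (if s3 then e3 + wt c else e3))"
  have v: "f' a = i1 + wt c" "f' (mate c) = i1" "f' b = i2" "f' (mate a) = e1"
    "f' c = (if s3 then e3 + wt c else i3)" "f' (mate b) = (if s3 then i3 else i3 - wt c)"
    "g' a = e1" "g' (mate c) = i1 + wt c" "g' b = e1" "g' (mate a) = e2"
    "g' c = (if s3 then e3 else i3 - wt c)" "g' (mate b) = (if s3 then e3 + wt c else e3)"
    "\<And>r. r \<notin> {a, b, c, mate a, mate b, mate c} \<Longrightarrow> f' r = f r \<and> g' r = g r"
    unfolding f'_def g'_def using d by simp_all
  have c: "chain f' g' i1 (strand (\<not> s1) a (mate c)) e1" "chain f' g' i2 (strand (\<not> s2) b (mate a)) e2"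
    "chain f' g' i3 (strand (\<not> s3) c (mate b)) e3"
    using s by (auto simp: strand_def v)
  have rule: "\<forall>r\<in>?T' - ?Z'. g' r = f' r - wt r * 1"
    unfolding T by (simp add: v)
  note eqs = chain_strandD[OF ch(1)] chain_strandD[OF ch(2)] chain_strandD[OF ch(3)]
  have \<gamma>a: "g a = f (mate a)" "g (mate a) = f a" "g c = f (mate c)" "g (mate c) = f c"
    using \<gamma> by (auto simp: along_glue_def)
  have fs: "f (mate c) = f (mate a)" "f b = f a"
    "if s3 then f (mate b) = f (mate a) else f c = f (mate b) + wt b"
    using eqs(3,6,9) s rr unfolding \<gamma>a by (simp_all split: if_splits)
  have \<gamma>': "along_glue a f' g' \<and> along_glue b f' g'"
    unfolding along_glue_def v eqs(1,2,4,5,7,8) \<gamma>a rr wt using fs s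
    by (cases s3) simp_all
  have M: "f b + g b - f (mate b) - g (mate b) = - (f' c + g' c - f' (mate c) - g' (mate c))"
    unfolding v eqs(1,2,4,5,7,8) \<gamma>a rr wt using fs s
    by (cases s3) simp_all
  have "val n (\<lambda>_. 1) f g {b, mate b} = val n (\<lambda>_. 1) f' g' {c, mate c}" for n
    using val_pair[of "{}" b n "\<lambda>_. 1" f g] val_pair[of "{}" c n "\<lambda>_. 1" f' g'] wt
    unfolding M delta_minus by simp
  then have vl: "\<forall>n. val n (\<lambda>_. 1) f g (?T - ?Z) = val n (\<lambda>_. 1) f' g' (?T' - ?Z')"
    unfolding T by blast
  have "\<forall>r. r \<notin> {a, b, c, mate a, mate b, mate c} \<longrightarrow> f' r = f r \<and> g' r = g r"
    using v(13) by blast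
  then show "\<exists>f' g'. (\<forall>r. r \<notin> {a, b, c, mate a, mate b, mate c} \<longrightarrow> f' r = f r \<and> g' r = g r)
     \<and> chain f' g' i1 (strand (\<not> s1) a (mate c)) e1 \<and> chain f' g' i2 (strand (\<not> s2) b (mate a)) e2
     \<and> chain f' g' i3 (strand (\<not> s3) c (mate b)) e3
     \<and> (\<forall>r\<in>?T' - ?Z'. g' r = f' r - wt r * 1) \<and> (along_glue a f' g' \<and> along_glue b f' g')
     \<and> (\<forall>n. val n (\<lambda>_. 1) f g (?T - ?Z) = val n (\<lambda>_. 1) f' g' (?T' - ?Z'))"
    using c rule \<gamma>' vl by blast
qed (use assms tri_word_distinct[OF p] in \<open>auto simp: tri_word_def dstate_def\<close>)

lemma mate_swap: "mate p = q \<longleftrightarrow> p = mate q"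
  by auto

section \<open>The data of a passage\<close>

definition idx :: "circ \<Rightarrow> passage \<Rightarrow> int" where
  "idx w p = sum_list (map wt (arc w p))"

text \<open>Tests whether \<open>x = NN k wt w\<close> means \<nabla>J_k = \<plusminus>m. For
  \<open>m = 0\<close> both summands count, in agreement with \<open>fspan\<close>, which then adds
  the same span twice.\<close>

definition hit :: "int \<Rightarrow> int \<Rightarrow> int" where
  "hit m x = of_bool (x = 2 * m) + of_bool (x = - 2 * m)"

text \<open>Up to sign, the flat span of the type-2 smoothing at \<open>p\<close>.\<close>

definition BB :: "int \<Rightarrow> int \<Rightarrow> circ \<Rightarrow> passage \<Rightarrow> int" where
  "BB k m w p = (\<Sum>q\<in>chords w p. wt q * hit m (NN k wt (dbl w p q)))"

definition data_eq :: "circ \<Rightarrow> passage \<Rightarrow> circ \<Rightarrow> passage \<Rightarrow> bool" where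
  "data_eq w p w' p' \<longleftrightarrow> idx w p = idx w' p' \<and> (\<forall>n. NN n wt (sm w p) = NN n wt (sm w' p'))
     \<and> (\<forall>k m. BB k m w p = BB k m w' p')"

lemma hit_minus [simp]: "hit m (- x) = hit m x"
  by (auto simp: hit_def)

lemma data_eq_trans: "data_eq w p w' p' \<Longrightarrow> data_eq w' p' w'' p'' \<Longrightarrow> data_eq w p w'' p''"
  by (simp add: data_eq_def)

lemma data_eq_sym: "data_eq w p w' p' \<Longrightarrow> data_eq w' p' w p"
  by (simp add: data_eq_def)

lemma data_eq_arcs:
  assumes "arc w p = arc w' p" "arc w (mate p) = arc w' (mate p)"
  shows "data_eq w p w' p"
  using assms by (simp add: data_eq_def idx_def sm_def BB_def chords_def dbl_def)

lemma data_eq_rotated: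
  assumes "paired (u @ v)" "p \<in> set (u @ v)"
  shows "data_eq (v @ u) p (u @ v) p"
  using assms arc_rotated[of u v] paired_mate_iff[OF assms(1)] paired_distinct[OF assms(1)]
  by (intro data_eq_arcs) auto

lemma idx_set: "paired w \<Longrightarrow> p \<in> set w \<Longrightarrow> idx w p = (\<Sum>r\<in>set (arc w p). wt r)"
  using paired_split_facts(2)[of w p] by (simp add: idx_def sum_list_distinct_conv_sum_set)

lemma idx_mate: "paired w \<Longrightarrow> p \<in> set w \<Longrightarrow> idx w (mate p) = - idx w p"
  unfolding idx_def by (rule arc_sum_mate) auto

lemma paired_map_reorient:
  assumes "four_regular w" "paired L" "set L \<subseteq> set w"
  shows "paired (map (reorient R) L)"
  using assms(2) inj_on_subset[OF reorient_inj_on[OF assms(1), of R] assms(3)]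
  by (auto simp: paired_def distinct_map mate_reorient)

text \<open>A passage is reoriented iff its mate lies on the other arc, a condition symmetric in the
  two arcs. Keeping the other arc therefore yields the same word backwards.\<close>

lemma sm_mate:
  assumes "four_regular w" "p \<in> set w"
  shows "NN n wt (sm w (mate p)) = - NN n wt (sm w p)"
proof -
  let ?X = "arc w p" and ?Y = "arc w (mate p)"
  have pw: "paired w" using four_regular_paired assms(1) .
  note L = paired_sm_word[OF pw assms(2)]
  have "reorient (set ?X) r = reorient (set ?Y) r" if "r \<in> set (?X @ rev ?Y)" for r
  proof -
    have "mate r \<in> set (?X @ rev ?Y)" using L(1) that paired_mate_iff by blast
    moreover have "set ?X \<inter> set ?Y = {}" using paired_split_facts(2)[OF pw assms(2)] by auto
    ultimately have "(r \<in> set ?X) = (r \<notin> set ?Y)" "(mate r \<in> set ?X) = (mate r \<notin> set ?Y)"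
      using that by auto
    then show ?thesis unfolding reorient_def by simp
  qed
  then have "sm w (mate p) = rev (sm w p)"
    unfolding sm_def reverse_join_def by (simp add: rev_map)
  moreover have "paired (sm w p)"
    unfolding sm_def reverse_join_def
    by (rule paired_map_reorient[OF assms(1) L(1)]) (unfold L(2), blast)
  ultimately show ?thesis by (simp add: NN_rev)
qed

lemma chords_mate: "chords w (mate p) = mate ` chords w p"
  by (force simp: chords_def image_iff mate_swap)

lemma dbl_dstate:
  "paired w \<Longrightarrow> p \<in> set w \<Longrightarrow> q \<in> chords w p \<Longrightarrow> dstate w p q (\<lambda>n. NN n wt (dbl w p q))"
  unfolding dstate_def by (rule state_dbl)

lemma dbl_mate:
  assumes "paired w" "p \<in> set w" "q \<in> chords w p"
  shows "NN n wt (dbl w (mate p) (mate q)) = NN n wt (dbl w p q)"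
proof -
  have "distinct (dbl w p q)" using paired_dbl(1)[OF assms] paired_distinct by blast
  then show ?thesis
    using NN_rotated[of "after (arc w p) q" "after (arc w (mate p)) (mate q)"] by (simp add: dbl_def)
qed

text \<open>The chords are replaced by their mates: the weights change sign, while the doubly
  smoothed curves are only rotated.\<close>

lemma BB_mate: "paired w \<Longrightarrow> p \<in> set w \<Longrightarrow> BB k m w (mate p) = - BB k m w p"
  unfolding BB_def chords_mate
  by (subst sum.reindex) (auto simp: inj_on_def dbl_mate sum_negf)

text \<open>All three data merely change sign from a passage to its mate, so one passage of each
  crossing has to be compared.\<close>

lemma data_eq_mate:
  assumes "four_regular w" "four_regular w'" "p \<in> set w" "p' \<in> set w'" "data_eq w p w' p'"
  shows "data_eq w (mate p) w' (mate p')"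
  using assms four_regular_paired[of w] four_regular_paired[of w']
  by (simp add: data_eq_def idx_mate sm_mate BB_mate)

section \<open>Exchange of neighbouring passages\<close>

lemma takeWhile_adjacent:
  assumes "distinct (xs @ x # y # ys)" "P x" "P y"
  shows "x \<in> set (takeWhile P (xs @ x # y # ys)) \<longleftrightarrow> y \<in> set (takeWhile P (xs @ x # y # ys))"
    and "set (takeWhile P (xs @ y # x # ys)) = set (takeWhile P (xs @ x # y # ys))"
proof -
  show "x \<in> set (takeWhile P (xs @ x # y # ys)) \<longleftrightarrow> y \<in> set (takeWhile P (xs @ x # y # ys))"
    using assms
  proof (induction xs)
    case (Cons z xs)
    then show ?case by (cases "P z") (auto dest: set_takeWhileD)
  qed auto
  show "set (takeWhile P (xs @ y # x # ys)) = set (takeWhile P (xs @ x # y # ys))"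
    using assms
  proof (induction xs)
    case (Cons z xs)
    then have "set (takeWhile P (xs @ y # x # ys)) = set (takeWhile P (xs @ x # y # ys))" by simp
    then show ?case by (cases "P z") simp_all
  qed (simp add: insert_commute)
qed

lemma after_adjacent:
  assumes "distinct (xs @ x # y # ys)" "p \<in> set (xs @ x # y # ys)" "p \<noteq> x" "p \<noteq> y"
  obtains us vs where "after (xs @ x # y # ys) p = us @ x # y # vs"
    "after (xs @ y # x # ys) p = us @ y # x # vs"
proof -
  consider "p \<in> set xs" | "p \<in> set ys" using assms by auto
  then show ?thesis
  proof cases
    case 1
    then obtain x1 x2 where xs: "xs = x1 @ p # x2" by (meson split_list)
    then show ?thesis
      using assms that[of x2 "ys @ x1"] after_split[of p x1 "x2 @ x # y # ys"]
        after_split[of p x1 "x2 @ y # x # ys"] by simp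
  next
    case 2
    then obtain y1 y2 where ys: "ys = y1 @ p # y2" by (meson split_list)
    then show ?thesis
      using assms that[of "y2 @ xs" y1] after_split[of p "xs @ x # y # y1" y2]
        after_split[of p "xs @ y # x # y1" y2] by simp
  qed
qed

lemma distinct_after: "distinct w \<Longrightarrow> p \<in> set w \<Longrightarrow> distinct (after w p)"
proof -
  assume "distinct w" "p \<in> set w"
  then obtain xs ys where w: "w = xs @ p # ys" by (meson split_list)
  show ?thesis using \<open>distinct w\<close> after_split[of p xs ys] by (auto simp: w)
qed

text \<open>An arc can separate two neighbours only by beginning or ending at one of them. Hence the
  pairs that a kink or bigon inserts, and those that a triangle move exchanges, lie on one arc of
  any crossing outside the move.\<close>

lemma arc_adjacent:
  assumes "distinct (xs @ x # y # ys)" "p \<in> set (xs @ x # y # ys)" "p \<notin> {x, y, mate x, mate y}"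
  shows "x \<in> set (arc (xs @ x # y # ys) p) \<longleftrightarrow> y \<in> set (arc (xs @ x # y # ys) p)"
    and "set (arc (xs @ y # x # ys) p) = set (arc (xs @ x # y # ys) p)"
proof -
  obtain us vs where a: "after (xs @ x # y # ys) p = us @ x # y # vs"
    "after (xs @ y # x # ys) p = us @ y # x # vs"
    using after_adjacent[of xs x y ys p] assms by auto
  have d: "distinct (us @ x # y # vs)"
    unfolding a(1)[symmetric] by (rule distinct_after[OF assms(1,2)])
  have "x \<noteq> mate p" "y \<noteq> mate p" using assms(3) by (auto simp: mate_swap)
  then show "x \<in> set (arc (xs @ x # y # ys) p) \<longleftrightarrow> y \<in> set (arc (xs @ x # y # ys) p)"
    "set (arc (xs @ y # x # ys) p) = set (arc (xs @ x # y # ys) p)"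
    unfolding arc_def a using takeWhile_adjacent[OF d, of "\<lambda>q. q \<noteq> mate p"] by auto
qed

lemma arc_rotationI:
  assumes "distinct w" "w = us @ vs" "vs @ us = p # xs @ mate p # ys"
  shows "arc w p = xs" "arc w (mate p) = ys"
proof -
  have d: "distinct (p # xs @ mate p # ys)" using assms(1,2) by (auto simp: assms(3)[symmetric])
  have "p \<in> set w" "mate p \<in> set w"
    using assms(2) arg_cong[OF assms(3), of set] by auto
  then have "arc w p = arc (p # xs @ mate p # ys) p" "arc w (mate p) = arc (p # xs @ mate p # ys) (mate p)"
    using arc_rotated[of us vs] assms(1,2) unfolding assms(3)[symmetric] by auto
  then show "arc w p = xs" "arc w (mate p) = ys"
    using arc_Cons[of p xs ys] arc_Cons_mate[OF d] d by auto
qed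

lemma four_regular_filter:
  assumes "four_regular w" "\<And>p. p \<in> set w \<Longrightarrow> P p \<Longrightarrow> P (mate p)"
  shows "four_regular (filter P w)"
  using assms unfolding four_regular_iff by (auto simp: paired_def)

lemma four_regular_rotated: "four_regular (u @ v) \<Longrightarrow> four_regular (v @ u)"
  unfolding four_regular_iff using paired_rotated[of u v] by auto

subsection \<open>Kinks\<close>

lemma RI_four_regular:
  assumes "four_regular (u @ [z, mate z])"
  shows "four_regular u"
proof -
  have "filter (\<lambda>r. r \<notin> {z, mate z}) (u @ [z, mate z]) = u"
    using assms by (auto intro: filter_True simp: four_regular_def)
  moreover have "four_regular (filter (\<lambda>r. r \<notin> {z, mate z}) (u @ [z, mate z]))"
    by (rule four_regular_filter[OF assms]) (auto simp: mate_swap)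
  ultimately show ?thesis by simp
qed

lemma RI_facts:
  assumes "four_regular (u @ [z, mate z])" "p \<in> set u"
  shows "four_regular u" "p \<notin> {z, mate z}" "mate p \<in> set u"
    "set (arc u p) = set (arc (u @ [z, mate z]) p) - {z, mate z}"
    "z \<in> set (arc (u @ [z, mate z]) p) \<longleftrightarrow> mate z \<in> set (arc (u @ [z, mate z]) p)"
proof -
  let ?w = "u @ [z, mate z]"
  have pw: "paired ?w" using four_regular_paired[OF assms(1)] .
  have d: "distinct ?w" using paired_distinct[OF pw] .
  then show p: "p \<notin> {z, mate z}" using assms(2) by auto
  then show m: "mate p \<in> set u" using paired_mate_iff[OF pw, of p] assms(2) by (auto simp: mate_swap)
  have u: "filter (\<lambda>r. r \<notin> {z, mate z}) ?w = u" using d by (auto intro: filter_True)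
  show "four_regular u" using RI_four_regular[OF assms(1)] .
  have "arc u p = filter (\<lambda>r. r \<notin> {z, mate z}) (arc ?w p)"
    using arc_filter[OF d, of p "\<lambda>r. r \<notin> {z, mate z}"] p assms(2) unfolding u by (auto simp: mate_swap)
  then show "set (arc u p) = set (arc ?w p) - {z, mate z}" by auto
  show "z \<in> set (arc ?w p) \<longleftrightarrow> mate z \<in> set (arc ?w p)"
    using arc_adjacent(1)[of u z "mate z" "[]" p] d assms(2) p by auto
qed

lemma RI_NN:
  assumes "four_regular (u @ [z, mate z])" "four_regular u"
  shows "NN n wt (u @ [z, mate z]) = NN n wt u"
  using RI_state[OF four_regular_paired[OF assms(1)] state_plain state_plain]
    assms[THEN four_regular_paired] by (auto dest: fun_cong)

lemma RI_data:
  assumes "four_regular (u @ [z, mate z])" "p \<in> set u"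
  shows "data_eq (u @ [z, mate z]) p u p"
proof -
  let ?w = "u @ [z, mate z]"
  have pw: "paired ?w" using four_regular_paired[OF assms(1)] .
  note p = RI_facts[OF assms]
  note mp = RI_facts[OF assms(1) p(3)]
  have pu: "paired u" using four_regular_paired[OF p(1)] .
  have pin: "p \<in> set ?w" using assms(2) by simp
  note sp = paired_split_facts[OF pw pin]
  have disj: "set (arc ?w p) \<inter> set (arc ?w (mate p)) = {}" using sp(2) by simp
  have idx: "idx ?w p = idx u p"
  proof -
    have "(\<Sum>r\<in>set (arc ?w p). wt r)
        = (\<Sum>r\<in>set (arc u p). wt r) + (\<Sum>r\<in>set (arc ?w p) \<inter> {z, mate z}. wt r)"
      unfolding p(4) by (metis finite_set sum.Int_Diff add.commute)
    moreover have "set (arc ?w p) \<inter> {z, mate z} = {} \<or> set (arc ?w p) \<inter> {z, mate z} = {z, mate z}"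
      using p(5) by auto
    then have "(\<Sum>r\<in>set (arc ?w p) \<inter> {z, mate z}. wt r) = 0" by auto
    ultimately show ?thesis using idx_set[OF pw pin] idx_set[OF pu assms(2)] by simp
  qed
  define \<chi> where "\<chi> = (\<lambda>r. if r \<in> set (arc ?w (mate p)) then - 1 else 1 :: int)"
  have "state ?w \<chi> {p, mate p} (against_glue p) (\<lambda>n. NN n wt (sm ?w p))"
    by (rule state_sm[OF assms(1) pin]) (use disj in \<open>auto simp: \<chi>_def\<close>)
  moreover have "state u \<chi> {p, mate p} (against_glue p) (\<lambda>n. NN n wt (sm u p))"
    by (rule state_sm[OF p(1) assms(2)]) (use p(4) mp(4) disj in \<open>auto simp: \<chi>_def\<close>)
  moreover have zp: "z \<notin> {p, mate p}" "mate z \<notin> {p, mate p}" using p(2) by auto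
  moreover have "\<chi> z = \<chi> (mate z)" using mp(5) by (simp add: \<chi>_def)
  ultimately have sm: "(\<lambda>n. NN n wt (sm ?w p)) = (\<lambda>n. NN n wt (sm u p))"
    by (rule RI_state[OF pw])
  have zq: "mate q \<in> {z, mate z} \<longleftrightarrow> q \<in> {z, mate z}" for q by auto
  \<comment> \<open>The passages of the kink share an arc of \<open>p\<close>, so the kink is not
    interlaced with \<open>p\<close>.\<close>
  have zn: "q \<notin> {z, mate z}" if "q \<in> chords ?w p" for q
  proof
    assume q: "q \<in> {z, mate z}"
    then have "mate q \<in> set (arc ?w p)" using that p(5) by (auto simp: chords_def)
    then show False using that disj by (auto simp: chords_def)
  qed
  have ch: "chords ?w p = chords u p"
  proof (rule set_eqI)
    fix q show "q \<in> chords ?w p \<longleftrightarrow> q \<in> chords u p"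
    proof (cases "q \<in> {z, mate z}")
      case True
      then show ?thesis using zn p(4) by (auto simp: chords_def)
    next
      case False
      then have "mate q \<notin> {z, mate z}" using zq[of q] by blast
      then show ?thesis using False by (simp add: chords_def p(4) mp(4))
    qed
  qed
  have "NN n wt (dbl ?w p q) = NN n wt (dbl u p q)" if "q \<in> chords u p" for q n
  proof -
    have q: "q \<notin> {z, mate z}" using that p(4) by (auto simp: chords_def)
    have qw: "q \<in> chords ?w p" using that ch by simp
    have "z \<notin> {p, mate p, q, mate q}" "mate z \<notin> {p, mate p, q, mate q}" using zp q by auto
    then have "(\<lambda>n. NN n wt (dbl ?w p q)) = (\<lambda>n. NN n wt (dbl u p q))"
      by (rule RI_state[OF pw state_dbl[OF pw pin qw] state_dbl[OF pu assms(2) that]]) simp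
    then show ?thesis by (rule fun_cong)
  qed
  then have "BB k m ?w p = BB k m u p" for k m unfolding BB_def ch by simp
  then show ?thesis using idx sm by (simp add: data_eq_def fun_eq_iff)
qed

text \<open>One arc of the kink is empty and the other is \<open>u\<close>, so it has no chords, and
  its smoothing against the orientation is \<open>u\<close> run backwards.\<close>

lemma RI_kink:
  assumes "four_regular (u @ [z, mate z])"
  shows "idx (u @ [z, mate z]) z = 0" "BB k m (u @ [z, mate z]) z = 0"
    "NN n wt (sm (u @ [z, mate z]) z) = - NN n wt u"
proof -
  let ?w = "u @ [z, mate z]"
  have d: "distinct ?w" using four_regular_paired[OF assms] paired_distinct by blast
  have a: "arc ?w z = []" "arc ?w (mate z) = u"
    using arc_rotationI[OF d, of u "[z, mate z]" z "[]" u] by auto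
  then show "idx ?w z = 0" "BB k m ?w z = 0" by (auto simp: idx_def BB_def chords_def)
  have pu: "paired u"
    using four_regular_paired[OF RI_four_regular[OF assms]] .
  have "map (reorient (set u)) (rev u) = rev u"
    using pu by (intro map_idI) (auto simp: reorient_def paired_def)
  then have "sm ?w z = rev u" by (simp add: sm_def reverse_join_def a)
  then show "NN n wt (sm ?w z) = - NN n wt u" using NN_rev[OF pu, of wt] by simp
qed

subsection \<open>Bigons\<close>

lemma bigon_word_arcs:
  assumes "paired (bigon_word s a b u v)"
  shows "arc (bigon_word s a b u v) a = b # u @ (if s then [] else [mate b])"
    "arc (bigon_word s a b u v) (mate a) = (if s then [mate b] else []) @ v"
    "arc (bigon_word s a b u v) b = u @ (if s then [mate a] else [])"
    "arc (bigon_word s a b u v) (mate b) = (if s then [] else [mate a]) @ v @ [a]"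
proof -
  let ?w = "bigon_word s a b u v"
  note d = paired_distinct[OF assms]
  have "?w = [] @ ?w" "?w @ [] = a # (b # u @ (if s then [] else [mate b]))
      @ mate a # ((if s then [mate b] else []) @ v)"
    by (simp_all add: bigon_word_def strand_def)
  from arc_rotationI[OF d this]
  show "arc ?w a = b # u @ (if s then [] else [mate b])"
    "arc ?w (mate a) = (if s then [mate b] else []) @ v" by simp_all
  have "?w = [a] @ tl ?w" "tl ?w @ [a] = b # (u @ (if s then [mate a] else []))
      @ mate b # ((if s then [] else [mate a]) @ v @ [a])"
    by (simp_all add: bigon_word_def strand_def)
  from arc_rotationI[OF d this]
  show "arc ?w b = u @ (if s then [mate a] else [])"
    "arc ?w (mate b) = (if s then [] else [mate a]) @ v @ [a]" by simp_all
qed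

context
  fixes s a b u v w
  assumes fr: "four_regular w" and w: "w = bigon_word s a b u v" and wt: "wt b = - wt a"
begin

lemma RII_paired: "paired w"
  using fr four_regular_paired by blast

lemma RII_distinct:
  "a \<noteq> b" "b \<noteq> a" "a \<noteq> mate b" "b \<noteq> mate a" "mate a \<noteq> b" "mate b \<noteq> a"
  "{a, b, mate a, mate b} \<inter> set (u @ v) = {}" "distinct (u @ v)"
  "\<And>r. r \<in> set (u @ v) \<Longrightarrow> mate r \<in> set (u @ v)"
  "set w = {a, b, mate a, mate b} \<union> set (u @ v)"
  using bigon_word_distinct[of s a b u v] RII_paired unfolding w
  by (auto simp: bigon_word_def)

lemma RII_filter: "filter (\<lambda>r. r \<notin> {a, b, mate a, mate b}) w = u @ v"
proof -
  have "filter (\<lambda>r. r \<notin> {a, b, mate a, mate b}) u = u"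
    "filter (\<lambda>r. r \<notin> {a, b, mate a, mate b}) v = v"
    using RII_distinct(7) by (auto intro!: filter_True)
  then show ?thesis by (auto simp: w bigon_word_def strand_def)
qed

lemma mate_in_bigon: "mate q \<in> {a, b, mate a, mate b} \<longleftrightarrow> q \<in> {a, b, mate a, mate b}"
  by auto

lemma RII_four_regular: "four_regular (u @ v)"
  unfolding RII_filter[symmetric]
  by (rule four_regular_filter[OF fr]) (use mate_in_bigon in blast)

lemma RII_NN: "NN n wt w = NN n wt (u @ v)"
  using RII_state[of s a b u v "\<lambda>_. 1" "{}" trivial_glue]
    state_plain[OF RII_paired] state_plain[OF four_regular_paired[OF RII_four_regular]]
    RII_paired wt unfolding w by (auto dest: fun_cong)

lemma RII_arc:
  assumes "p \<in> set (u @ v)"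
  shows "set (arc (u @ v) p) = set (arc w p) - {a, b, mate a, mate b}"
    "a \<in> set (arc w p) \<longleftrightarrow> b \<in> set (arc w p)"
    "mate a \<in> set (arc w p) \<longleftrightarrow> mate b \<in> set (arc w p)"
proof -
  have d: "distinct w" using paired_distinct[OF RII_paired] .
  have p: "p \<notin> {a, b, mate a, mate b}" "p \<in> set w" "mate p \<notin> {a, b, mate a, mate b}"
    using RII_distinct(7,10) assms mate_in_bigon[of p] by blast+
  have "arc (u @ v) p = filter (\<lambda>r. r \<notin> {a, b, mate a, mate b}) (arc w p)"
    unfolding RII_filter[symmetric] by (rule arc_filter[OF d p(2,1,3)])
  then show "set (arc (u @ v) p) = set (arc w p) - {a, b, mate a, mate b}" by auto
  show "a \<in> set (arc w p) \<longleftrightarrow> b \<in> set (arc w p)"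
    using arc_adjacent(1)[of "[]" a b "u @ strand s (mate a) (mate b) @ v" p] d p
    by (simp add: w bigon_word_def)
  have "w = (a # b # u) @ (if s then mate a # mate b # v else mate b # mate a # v)"
    by (simp add: w bigon_word_def strand_def)
  then show "mate a \<in> set (arc w p) \<longleftrightarrow> mate b \<in> set (arc w p)"
    using arc_adjacent(1)[of "a # b # u" "mate a" "mate b" v p]
      arc_adjacent(1)[of "a # b # u" "mate b" "mate a" v p] d p
    by (cases s) simp_all
qed

lemma RII_chords:
  assumes "p \<in> set (u @ v)"
  shows "chords (u @ v) p = chords w p - {a, b, mate a, mate b}"
    "a \<in> chords w p \<longleftrightarrow> b \<in> chords w p" "mate a \<in> chords w p \<longleftrightarrow> mate b \<in> chords w p"
  using RII_arc[OF assms] RII_arc[OF RII_distinct(9)[OF assms]] mate_in_bigon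
  unfolding chords_def by (simp_all add: set_eq_iff) blast

lemma RII_data:
  assumes p: "p \<in> set (u @ v)"
  shows "data_eq w p (u @ v) p"
proof -
  note pw = RII_paired and puv = four_regular_paired[OF RII_four_regular]
  have mp: "mate p \<in> set (u @ v)" using RII_distinct(9)[OF p] .
  have pin: "p \<in> set w" using p RII_distinct(10) by blast
  have pE: "p \<notin> {a, b, mate a, mate b}" "mate p \<notin> {a, b, mate a, mate b}"
    using RII_distinct(7) p mp by blast+
  note arc = RII_arc[OF p] and arcm = RII_arc[OF mp]
  have disj: "set (arc w p) \<inter> set (arc w (mate p)) = {}"
    using paired_split_facts(2)[OF pw pin] by simp
  have idx: "idx w p = idx (u @ v) p"
  proof -
    have "(\<Sum>r\<in>set (arc w p). wt r)
        = (\<Sum>r\<in>set (arc (u @ v) p). wt r) + (\<Sum>r\<in>set (arc w p) \<inter> {a, b, mate a, mate b}. wt r)"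
      unfolding arc(1) by (metis finite_set sum.Int_Diff add.commute)
    moreover have "set (arc w p) \<inter> {a, b, mate a, mate b} =
        (if a \<in> set (arc w p) then {a, b} else {}) \<union> (if mate a \<in> set (arc w p) then {mate a, mate b} else {})"
      using arc(2,3) by auto
    then have "(\<Sum>r\<in>set (arc w p) \<inter> {a, b, mate a, mate b}. wt r) = 0"
      using RII_distinct(1-6) wt by (auto split: if_splits)
    ultimately show ?thesis using idx_set[OF pw pin] idx_set[OF puv p] by simp
  qed
  define \<chi> where "\<chi> = (\<lambda>r. if r \<in> set (arc w (mate p)) then - 1 else 1 :: int)"
  have "state w \<chi> {p, mate p} (against_glue p) (\<lambda>n. NN n wt (sm w p))"
    by (rule state_sm[OF fr pin]) (use disj in \<open>auto simp: \<chi>_def\<close>)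
  moreover have "state (u @ v) \<chi> {p, mate p} (against_glue p) (\<lambda>n. NN n wt (sm (u @ v) p))"
    by (rule state_sm[OF RII_four_regular p]) (use arc(1) arcm(1) disj in \<open>auto simp: \<chi>_def\<close>)
  moreover have "{p, mate p} \<inter> {a, b, mate a, mate b} = {}" using pE by blast
  moreover have "\<chi> a = \<chi> b" "\<chi> (mate a) = \<chi> (mate b)" using arcm(2,3) by (simp_all add: \<chi>_def)
  ultimately have sm: "(\<lambda>n. NN n wt (sm w p)) = (\<lambda>n. NN n wt (sm (u @ v) p))"
    using RII_state[OF pw[unfolded w], of \<chi> "{p, mate p}" "against_glue p"] wt unfolding w by blast
  note ch = RII_chords[OF p]
  have un: "NN n wt (dbl w p q) = NN n wt (dbl (u @ v) p q)" if q: "q \<in> chords (u @ v) p" for q n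
  proof -
    have qE: "q \<notin> {a, b, mate a, mate b}" "q \<in> chords w p" using q ch(1) by blast+
    have "{p, mate p, q, mate q} \<inter> {a, b, mate a, mate b} = {}"
      using pE qE mate_in_bigon[of q] by blast
    then have "(\<lambda>n. NN n wt (dbl w p q)) = (\<lambda>n. NN n wt (dbl (u @ v) p q))"
      using RII_state[OF pw[unfolded w] state_dbl[OF pw pin qE(2), unfolded w] state_dbl[OF puv p q]]
        wt unfolding w by blast
    then show ?thesis by (rule fun_cong)
  qed
  \<comment> \<open>The bigon may be interlaced with \<open>p\<close>. It then adds two chords with
    the same doubly smoothed curve and opposite weights, which cancel in \<open>BB\<close>.\<close>
  have ab: "NN n wt (dbl w p a) = NN n wt (dbl w p b)" if "a \<in> chords w p" for n
  proof -
    have "(\<lambda>n. NN n wt (dbl w p a)) = (\<lambda>n. NN n wt (dbl w p b))"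
      by (rule RII_dbl[OF pw[unfolded w], folded w, OF dbl_dstate[OF pw pin that]
            dbl_dstate[OF pw pin that[unfolded ch(2)]] pE(1) wt])
    then show ?thesis by (rule fun_cong)
  qed
  have abm: "NN n wt (dbl w p (mate a)) = NN n wt (dbl w p (mate b))" if "mate a \<in> chords w p" for n
  proof -
    have "dstate w p a (\<lambda>n. NN n wt (dbl w p (mate a)))" "dstate w p b (\<lambda>n. NN n wt (dbl w p (mate b)))"
      using dbl_dstate[OF pw pin, of "mate a"] dbl_dstate[OF pw pin, of "mate b"] that ch(3)
      by (simp_all add: dstate_mate)
    then have "(\<lambda>n. NN n wt (dbl w p (mate a))) = (\<lambda>n. NN n wt (dbl w p (mate b)))"
      by (rule RII_dbl[OF pw[unfolded w], folded w, OF _ _ pE(1) wt])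
    then show ?thesis by (rule fun_cong)
  qed
  have BB: "BB k m w p = BB k m (u @ v) p" for k m
  proof -
    let ?t = "\<lambda>q. wt q * hit m (NN k wt (dbl w p q))"
    have fin: "finite (chords w p)" by (simp add: chords_def)
    have "BB k m w p = sum ?t (chords w p - {a, b, mate a, mate b})
        + sum ?t (chords w p \<inter> {a, b, mate a, mate b})"
      unfolding BB_def using sum.Int_Diff[OF fin, of ?t "{a, b, mate a, mate b}"] by simp
    moreover have "sum ?t (chords w p - {a, b, mate a, mate b}) = BB k m (u @ v) p"
      unfolding BB_def ch(1)[symmetric] by (intro sum.cong refl) (simp add: un)
    moreover have "chords w p \<inter> {a, b, mate a, mate b} =
        (if a \<in> chords w p then {a, b} else {}) \<union> (if mate a \<in> chords w p then {mate a, mate b} else {})"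
      using ch(2,3) by auto
    then have "sum ?t (chords w p \<inter> {a, b, mate a, mate b}) = 0"
      using RII_distinct(1-6) wt ab[of k] abm[of k] by (auto split: if_splits)
    ultimately show ?thesis by simp
  qed
  show ?thesis using idx sm BB by (simp add: data_eq_def fun_eq_iff)
qed

text \<open>With equal data and opposite signs, the two crossings of the bigon cancel in the
  polynomial.\<close>

lemma RII_bigon: "data_eq w a w b"
proof -
  note pw = RII_paired and d = RII_distinct
  note arcs = bigon_word_arcs[OF pw[unfolded w], folded w]
  have ain: "a \<in> set w" "b \<in> set w" using d(10) by blast+
  have idx: "idx w a = idx w b" using wt by (simp add: idx_def arcs)
  define \<chi> where "\<chi> = (\<lambda>r. if r \<in> set (arc w (mate a)) then - 1 else 1 :: int)"
  define \<chi>' where "\<chi>' = (\<lambda>r. if r \<in> set (arc w (mate b)) then - 1 else 1 :: int)"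
  have "state w \<chi> {a, mate a} (against_glue a) (\<lambda>n. NN n wt (sm w a))"
    by (rule state_sm[OF fr ain(1)]) (use paired_split_facts(2)[OF pw ain(1)] in \<open>auto simp: \<chi>_def\<close>)
  moreover have "state w \<chi>' {b, mate b} (against_glue b) (\<lambda>n. NN n wt (sm w b))"
    by (rule state_sm[OF fr ain(2)]) (use paired_split_facts(2)[OF pw ain(2)] in \<open>auto simp: \<chi>'_def\<close>)
  moreover have "\<chi> b = 1" "\<chi> (mate b) = (if s then -1 else 1)" "\<chi>' a = -1" "\<chi>' (mate a) = (if s then 1 else -1)"
    using d(1-7) by (auto simp: \<chi>_def \<chi>'_def arcs)
  moreover have "\<chi> r = \<chi>' r" if "r \<in> set (u @ v)" for r
    using that d(7) by (auto simp: \<chi>_def \<chi>'_def arcs)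
  ultimately have sm: "(\<lambda>n. NN n wt (sm w a)) = (\<lambda>n. NN n wt (sm w b))"
    using RII_sm[OF pw[unfolded w], of \<chi> _ \<chi>'] wt unfolding w by blast
  have un: "NN n wt (dbl w a q) = NN n wt (dbl w b q)"
    if q: "q \<in> chords w a" "q \<in> chords w b" "q \<in> set (u @ v)" for q n
  proof -
    have "dstate w q a (\<lambda>n. NN n wt (dbl w a q))" "dstate w q b (\<lambda>n. NN n wt (dbl w b q))"
      using dbl_dstate[OF pw ain(1) q(1)] dbl_dstate[OF pw ain(2) q(2)] by (simp_all add: dstate_commute)
    moreover have "q \<notin> {a, b, mate a, mate b}" using q(3) d(7) by blast
    ultimately have "(\<lambda>n. NN n wt (dbl w a q)) = (\<lambda>n. NN n wt (dbl w b q))"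
      by (intro RII_dbl[OF pw[unfolded w], folded w, of q, OF _ _ _ wt])
    then show ?thesis by (rule fun_cong)
  qed
  define C where "C = {q \<in> set u. mate q \<in> set v}"
  have C: "C \<subseteq> set (u @ v)" "finite C" by (auto simp: C_def)
  \<comment> \<open>Apart from chords leading from \<open>u\<close> to \<open>v\<close>, which
    \<open>a\<close> and \<open>b\<close> share, the two crossings of the bigon are linked with each
    other exactly when the strands are parallel.\<close>
  have cha: "chords w a = (if s then {b} else {}) \<union> C"
    using d bigon_word_distinct(9)[OF pw[unfolded w]]
    by (auto simp: chords_def arcs C_def)
  have chb: "chords w b = (if s then {mate a} else {}) \<union> C"
    using d bigon_word_distinct(9)[OF pw[unfolded w]]
    by (auto simp: chords_def arcs C_def)
  have BB: "BB k m w a = BB k m w b" for k m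
  proof -
    let ?t = "\<lambda>p q. wt q * hit m (NN k wt (dbl w p q))"
    have "sum (?t a) C = sum (?t b) C"
      using un C(1) by (intro sum.cong refl) (simp add: cha chb subset_iff)
    moreover have "b \<notin> C" "mate a \<notin> C" using C(1) d(7) by blast+
    \<comment> \<open>Both terms smooth the same pair of crossings, and \<open>b\<close> and
      \<open>mate a\<close> have the same weight.\<close>
    moreover have "?t a b = ?t b (mate a)" if s
    proof -
      have "dstate w a b (\<lambda>n. NN n wt (dbl w a b))" "dstate w a b (\<lambda>n. NN n wt (dbl w b (mate a)))"
        using dbl_dstate[OF pw ain(1), of b] dbl_dstate[OF pw ain(2), of "mate a"] cha chb that
        by (simp_all add: dstate_mate dstate_commute[of w b a])
      then have "(\<lambda>n. NN n wt (dbl w a b)) = (\<lambda>n. NN n wt (dbl w b (mate a)))"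
        unfolding dstate_def by (rule state_eqI) blast
      from fun_cong[OF this, of k] show ?thesis using wt by simp
    qed
    ultimately show ?thesis unfolding BB_def cha chb using C(2) by (cases s) simp_all
  qed
  show ?thesis using idx sm BB by (simp add: data_eq_def fun_eq_iff)
qed

end

subsection \<open>Triangles\<close>

lemma tri_word_arcs:
  assumes "paired (tri_word s1 s2 s3 a b c u v x)"
  shows "arc (tri_word s1 s2 s3 a b c u v x) a =
      (if s1 then [mate c] else []) @ u @ (if s2 then [b] else [])"
    "arc (tri_word s1 s2 s3 a b c u v x) (mate a) =
      (if s2 then [] else [b]) @ v @ strand s3 c (mate b) @ x @ (if s1 then [] else [mate c])"
proof -
  let ?w = "tri_word s1 s2 s3 a b c u v x"
  note d = paired_distinct[OF assms]
  have "?w = (if s1 then [] else [mate c]) @ (if s1 then ?w else tl ?w)"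
    "(if s1 then ?w else tl ?w) @ (if s1 then [] else [mate c]) =
      a # ((if s1 then [mate c] else []) @ u @ (if s2 then [b] else [])) @
      mate a # ((if s2 then [] else [b]) @ v @ strand s3 c (mate b) @ x @ (if s1 then [] else [mate c]))"
    by (simp_all add: tri_word_def strand_def)
  from arc_rotationI[OF d this] show "arc ?w a =
      (if s1 then [mate c] else []) @ u @ (if s2 then [b] else [])"
    "arc ?w (mate a) =
      (if s2 then [] else [b]) @ v @ strand s3 c (mate b) @ x @ (if s1 then [] else [mate c])" .
qed

text \<open>Rotating the circle permutes the three strands cyclically, so what is shown for the
  crossing of \<open>a\<close> carries over to those of \<open>b\<close> and
  \<open>c\<close>.\<close>

lemma tri_word_rotated:
  obtains U V where "tri_word s1 s2 s3 a b c u v x = U @ V" "tri_word s2 s3 s1 b c a v x u = V @ U"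
  using that[of "strand s1 a (mate c) @ u" "strand s2 b (mate a) @ v @ strand s3 c (mate b) @ x"]
  by (simp add: tri_word_def)

lemma tri_wts_rotated: "tri_wts s1 s2 s3 a b c \<Longrightarrow> tri_wts s2 s3 s1 b c a"
  unfolding tri_wts_def by (elim conjE) (intro conjI, assumption+)

lemma tri_wts_not: "tri_wts s1 s2 s3 a b c \<Longrightarrow> tri_wts (\<not> s1) (\<not> s2) (\<not> s3) a b c"
proof -
  have "sg (\<not> s) = - sg s" for s by (cases s) simp_all
  then show "tri_wts s1 s2 s3 a b c \<Longrightarrow> tri_wts (\<not> s1) (\<not> s2) (\<not> s3) a b c"
    unfolding tri_wts_def by (simp only: mult_minus_left neg_equal_iff_equal)
qed

lemma tri_word_set:
  "set (tri_word s1 s2 s3 a b c u v x) = {a, b, c, mate a, mate b, mate c} \<union> set (u @ v @ x)"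
  by (auto simp: tri_word_def)

lemma dstate_rotated: "dstate (u @ v) p q N \<longleftrightarrow> dstate (v @ u) p q N"
  unfolding dstate_def by (rule state_rotated)

lemma mate_in_triangle:
  "mate q \<in> {a, b, c, mate a, mate b, mate c} \<longleftrightarrow> q \<in> {a, b, c, mate a, mate b, mate c}"
  by auto

lemma RIII_dbl_any:
  assumes p: "paired (tri_word s1 s2 s3 a b c u v x)"
    and q: "q \<in> {a, b, c, mate a, mate b, mate c}"
    and 1: "dstate (tri_word s1 s2 s3 a b c u v x) p q N"
    and 2: "dstate (tri_word (\<not> s1) (\<not> s2) (\<not> s3) a b c u v x) p q N'"
    and Z: "p \<notin> {a, b, c, mate a, mate b, mate c}"
    and wts: "tri_wts s1 s2 s3 a b c"
  shows "N = N'"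
proof -
  have p2: "paired (tri_word s2 s3 s1 b c a v x u)"
    using p tri_word_rotated[of s1 s2 s3 a b c u v x] paired_rotated by metis
  have p3: "paired (tri_word s3 s1 s2 c a b x u v)"
    using p2 tri_word_rotated[of s2 s3 s1 b c a v x u] paired_rotated by metis
  have w2: "tri_wts s2 s3 s1 b c a" using tri_wts_rotated[OF wts] .
  have w3: "tri_wts s3 s1 s2 c a b" using tri_wts_rotated[OF w2] .
  have r2: "dstate (tri_word s1 s2 s3 a b c u v x) p q N \<longleftrightarrow> dstate (tri_word s2 s3 s1 b c a v x u) p q N"
    for s1 s2 s3 a b c u v x q N
    using tri_word_rotated[of s1 s2 s3 a b c u v x] dstate_rotated by metis
  have r3: "dstate (tri_word s1 s2 s3 a b c u v x) p q N \<longleftrightarrow> dstate (tri_word s3 s1 s2 c a b x u v) p q N"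
    for s1 s2 s3 q N by (rule trans[OF r2 r2])
  have Z2: "p \<notin> {b, c, a, mate b, mate c, mate a}" and Z3: "p \<notin> {c, a, b, mate c, mate a, mate b}"
    using Z by auto
  consider "q = a \<or> q = mate a" | "q = b \<or> q = mate b" | "q = c \<or> q = mate c" using q by blast
  then show ?thesis
  proof cases
    case 1
    have "dstate (tri_word s1 s2 s3 a b c u v x) p a N"
      "dstate (tri_word (\<not> s1) (\<not> s2) (\<not> s3) a b c u v x) p a N'"
      using assms(3,4) 1 by (elim disjE; simp only: dstate_mate)+
    then show ?thesis by (rule RIII_dbl[OF p _ _ Z wts])
  next
    case 2
    have "dstate (tri_word s1 s2 s3 a b c u v x) p b N"
      "dstate (tri_word (\<not> s1) (\<not> s2) (\<not> s3) a b c u v x) p b N'"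
      using assms(3,4) 2 by (elim disjE; simp only: dstate_mate)+
    from this[THEN r2[THEN iffD1]] show ?thesis by (rule RIII_dbl[OF p2 _ _ Z2 w2])
  next
    case 3
    have "dstate (tri_word s1 s2 s3 a b c u v x) p c N"
      "dstate (tri_word (\<not> s1) (\<not> s2) (\<not> s3) a b c u v x) p c N'"
      using assms(3,4) 3 by (elim disjE; simp only: dstate_mate)+
    from this[THEN r3[THEN iffD1]] show ?thesis by (rule RIII_dbl[OF p3 _ _ Z3 w3])
  qed
qed

lemma strand_arc:
  assumes "distinct (xs @ strand s y z @ ys)" "p \<in> set (xs @ strand s y z @ ys)"
    "p \<notin> {y, z, mate y, mate z}"
  shows "set (arc (xs @ strand (\<not> s) y z @ ys) p) = set (arc (xs @ strand s y z @ ys) p)"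
    "y \<in> set (arc (xs @ strand s y z @ ys) p) \<longleftrightarrow> z \<in> set (arc (xs @ strand s y z @ ys) p)"
proof -
  have *: "set (arc (xs @ strand (\<not> s) y z @ ys) p) = set (arc (xs @ strand s y z @ ys) p) \<and>
      (y \<in> set (arc (xs @ strand s y z @ ys) p) \<longleftrightarrow> z \<in> set (arc (xs @ strand s y z @ ys) p))"
  proof (cases s)
    case True
    then have e: "xs @ strand s y z @ ys = xs @ y # z # ys" "xs @ strand (\<not> s) y z @ ys = xs @ z # y # ys"
      by (simp_all add: strand_def)
    show ?thesis unfolding e using arc_adjacent[OF assms[unfolded e]] by blast
  next
    case False
    then have e: "xs @ strand s y z @ ys = xs @ z # y # ys" "xs @ strand (\<not> s) y z @ ys = xs @ y # z # ys"
      by (simp_all add: strand_def)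
    have "p \<notin> {z, y, mate z, mate y}" using assms(3) by blast
    from arc_adjacent[OF assms(1,2)[unfolded e] this] show ?thesis unfolding e by blast
  qed
  then show "set (arc (xs @ strand (\<not> s) y z @ ys) p) = set (arc (xs @ strand s y z @ ys) p)"
    "y \<in> set (arc (xs @ strand s y z @ ys) p) \<longleftrightarrow> z \<in> set (arc (xs @ strand s y z @ ys) p)"
    by blast+
qed

context
  fixes s1 s2 s3 a b c u v x w w'
  assumes fr: "four_regular w" "four_regular w'"
    and w: "w = tri_word s1 s2 s3 a b c u v x"
    and w': "w' = tri_word (\<not> s1) (\<not> s2) (\<not> s3) a b c u v x"
    and wts: "tri_wts s1 s2 s3 a b c"
begin

lemma RIII_paired: "paired w" "paired w'"
  using fr four_regular_paired by blast+

lemmas RIII_distinct = tri_word_distinct[OF RIII_paired(1)[unfolded w]]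

lemma RIII_set: "set w = {a, b, c, mate a, mate b, mate c} \<union> set (u @ v @ x)"
    "set w' = {a, b, c, mate a, mate b, mate c} \<union> set (u @ v @ x)"
  unfolding w w' by (rule tri_word_set)+

lemma RIII_NN: "NN n wt w = NN n wt w'"
proof -
  have "(\<lambda>n. NN n wt w) = (\<lambda>n. NN n wt w')"
    by (rule RIII_state[OF RIII_paired(1)[unfolded w], folded w,
          OF state_plain[OF RIII_paired(1)] state_plain[OF RIII_paired(2), unfolded w'] _ _ _ _ _ wts,
          folded w']) simp_all
  then show ?thesis by (rule fun_cong)
qed

lemma RIII_arc:
  assumes "p \<in> set (u @ v @ x)"
  shows "set (arc w' p) = set (arc w p)"
    "a \<in> set (arc w p) \<longleftrightarrow> mate c \<in> set (arc w p)"
    "b \<in> set (arc w p) \<longleftrightarrow> mate a \<in> set (arc w p)"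
    "c \<in> set (arc w p) \<longleftrightarrow> mate b \<in> set (arc w p)"
proof -
  let ?S = "\<lambda>s1 s2 s3. tri_word s1 s2 s3 a b c u v x"
  have pE: "p \<notin> {a, b, c, mate a, mate b, mate c}" using assms RIII_distinct(19) by blast
  have ok: "distinct (?S t1 t2 t3)" "p \<in> set (?S t1 t2 t3)" for t1 t2 t3
    using paired_distinct[OF RIII_paired(1)] RIII_set(1) assms
    by (auto simp: w tri_word_def strand_def split: if_splits)
  have f1: "?S t1 t2 t3 = [] @ strand t1 a (mate c) @ u @ strand t2 b (mate a) @ v @ strand t3 c (mate b) @ x"
    for t1 t2 t3 by (simp add: tri_word_def)
  have f2: "?S t1 t2 t3 = (strand t1 a (mate c) @ u) @ strand t2 b (mate a) @ v @ strand t3 c (mate b) @ x"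
    for t1 t2 t3 by (simp add: tri_word_def)
  have f3: "?S t1 t2 t3 = (strand t1 a (mate c) @ u @ strand t2 b (mate a) @ v) @ strand t3 c (mate b) @ x"
    for t1 t2 t3 by (simp add: tri_word_def)
  have n: "p \<notin> {a, mate c, mate a, mate (mate c)}" "p \<notin> {b, mate a, mate b, mate (mate a)}"
    "p \<notin> {c, mate b, mate c, mate (mate b)}" using pE by auto
  have g: "set (arc (?S (\<not> t1) t2 t3) p) = set (arc (?S t1 t2 t3) p)"
    "set (arc (?S t1 (\<not> t2) t3) p) = set (arc (?S t1 t2 t3) p)"
    "set (arc (?S t1 t2 (\<not> t3)) p) = set (arc (?S t1 t2 t3) p)" for t1 t2 t3
    using strand_arc(1)[OF ok[of t1 t2 t3, unfolded f1] n(1)] strand_arc(1)[OF ok[of t1 t2 t3, unfolded f2] n(2)]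
      strand_arc(1)[OF ok[of t1 t2 t3, unfolded f3] n(3)]
    by (simp_all only: f1[symmetric] f2[symmetric] f3[symmetric])
  show "set (arc w' p) = set (arc w p)" by (simp only: w w' g)
  show "a \<in> set (arc w p) \<longleftrightarrow> mate c \<in> set (arc w p)"
    "b \<in> set (arc w p) \<longleftrightarrow> mate a \<in> set (arc w p)"
    "c \<in> set (arc w p) \<longleftrightarrow> mate b \<in> set (arc w p)"
    using strand_arc(2)[OF ok[of s1 s2 s3, unfolded f1] n(1)] strand_arc(2)[OF ok[of s1 s2 s3, unfolded f2] n(2)]
      strand_arc(2)[OF ok[of s1 s2 s3, unfolded f3] n(3)]
    by (simp_all only: f1[symmetric] f2[symmetric] f3[symmetric] w)
qed

lemma RIII_data_outside:
  assumes p: "p \<in> set (u @ v @ x)"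
  shows "data_eq w p w' p"
proof -
  let ?E = "{a, b, c, mate a, mate b, mate c}"
  note pw = RIII_paired
  have mp: "mate p \<in> set (u @ v @ x)" using RIII_distinct(21)[OF p] .
  have pin: "p \<in> set w" "p \<in> set w'" using p RIII_set by blast+
  have pE: "p \<notin> ?E" "mate p \<notin> ?E"
    using RIII_distinct(19) p mp by blast+
  note arc = RIII_arc[OF p] and arcm = RIII_arc[OF mp]
  have disj: "set (arc w p) \<inter> set (arc w (mate p)) = {}"
    using paired_split_facts(2)[OF pw(1) pin(1)] by simp
  have idx: "idx w p = idx w' p"
    using idx_set[OF pw(1) pin(1)] idx_set[OF pw(2) pin(2)] arc(1) by simp
  define \<chi> where "\<chi> = (\<lambda>r. if r \<in> set (arc w (mate p)) then - 1 else 1 :: int)"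
  have 1: "state w \<chi> {p, mate p} (against_glue p) (\<lambda>n. NN n wt (sm w p))"
    by (rule state_sm[OF fr(1) pin(1)]) (use disj in \<open>auto simp: \<chi>_def\<close>)
  have 2: "state w' \<chi> {p, mate p} (against_glue p) (\<lambda>n. NN n wt (sm w' p))"
    by (rule state_sm[OF fr(2) pin(2)]) (use arc(1) arcm(1) disj in \<open>auto simp: \<chi>_def\<close>)
  have Z: "{p, mate p} \<inter> ?E = {}" using pE by blast
  have sm: "(\<lambda>n. NN n wt (sm w p)) = (\<lambda>n. NN n wt (sm w' p))"
    by (rule RIII_state[OF pw(1)[unfolded w], folded w w', OF 1 2 Z _ _ _ _ wts])
       (use arcm in \<open>simp_all add: \<chi>_def\<close>)
  have ch: "chords w' p = chords w p" by (simp only: chords_def arc(1) arcm(1))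
  have dbl: "NN n wt (dbl w p q) = NN n wt (dbl w' p q)" if q: "q \<in> chords w p" for q n
  proof -
    have q': "q \<in> chords w' p" using q ch by simp
    have "(\<lambda>n. NN n wt (dbl w p q)) = (\<lambda>n. NN n wt (dbl w' p q))"
    proof (cases "q \<in> ?E")
      case True
      show ?thesis
        by (rule RIII_dbl_any[OF pw(1)[unfolded w] True, folded w w',
              OF dbl_dstate[OF pw(1) pin(1) q] dbl_dstate[OF pw(2) pin(2) q'] pE(1) wts])
    next
      case False
      then have "{p, mate p, q, mate q} \<inter> ?E = {}" using pE mate_in_triangle[of q] by blast
      then show ?thesis
        by (rule RIII_state[OF pw(1)[unfolded w], folded w w',
              OF state_dbl[OF pw(1) pin(1) q] state_dbl[OF pw(2) pin(2) q'] _ _ _ _ _ wts]) simp_all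
    qed
    then show ?thesis by (rule fun_cong)
  qed
  have "BB k m w p = BB k m w' p" for k m
    unfolding BB_def ch by (intro sum.cong refl) (simp add: dbl)
  then show ?thesis using idx sm by (simp add: data_eq_def fun_eq_iff)
qed

text \<open>At a crossing of the triangle the set of chords itself changes: \<open>mate c\<close> is
  a chord of \<open>a\<close> iff \<open>s1\<close>, and \<open>b\<close> is one iff
  \<open>s2\<close>, while the move negates both flags. The curves of these special chords are
  compared by \<open>RIII_two_same\<close> and \<open>RIII_two_opposite\<close>.\<close>

lemma RIII_data_first: "data_eq w a w' a"
proof -
  let ?E = "{a, b, c, mate a, mate b, mate c}"
  note pw = RIII_paired and d = RIII_distinct
  note arcs = tri_word_arcs[OF pw(1)[unfolded w], folded w]
    tri_word_arcs[OF pw(2)[unfolded w'], folded w']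
  have ain: "a \<in> set w" "a \<in> set w'" using RIII_set by blast+
  have sw: "sg s1 * wt c = sg s2 * wt b" using wts unfolding tri_wts_def by blast
  have idx: "idx w a = idx w' a"
    using sw by (cases s1; cases s2; simp add: idx_def arcs)
  define \<chi> where "\<chi> = (\<lambda>r. if r \<in> set (arc w (mate a)) then - 1 else 1 :: int)"
  define \<chi>' where "\<chi>' = (\<lambda>r. if r \<in> set (arc w' (mate a)) then - 1 else 1 :: int)"
  have 1: "state w \<chi> {a, mate a} (against_glue a) (\<lambda>n. NN n wt (sm w a))"
    by (rule state_sm[OF fr(1) ain(1)]) (use paired_split_facts(2)[OF pw(1) ain(1)] in \<open>auto simp: \<chi>_def\<close>)
  have 2: "state w' \<chi>' {a, mate a} (against_glue a) (\<lambda>n. NN n wt (sm w' a))"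
    by (rule state_sm[OF fr(2) ain(2)]) (use paired_split_facts(2)[OF pw(2) ain(2)] in \<open>auto simp: \<chi>'_def\<close>)
  have o: "b \<notin> set (u @ v @ x)" "mate c \<notin> set (u @ v @ x)" using d(19) by blast+
  have 3: "\<chi> (mate c) = sg s1" "\<chi> b = sg s2" "\<chi> c = -1" "\<chi> (mate b) = -1"
      "\<chi>' (mate c) = - sg s1" "\<chi>' b = - sg s2" "\<chi>' c = -1" "\<chi>' (mate b) = -1"
    using d(1-18) o by (cases s1; cases s2; simp add: \<chi>_def \<chi>'_def arcs)+
  have 4: "\<chi> r = \<chi>' r" if "r \<in> set (u @ v @ x)" for r
    using that o by (auto simp: \<chi>_def \<chi>'_def arcs)
  have sm: "(\<lambda>n. NN n wt (sm w a)) = (\<lambda>n. NN n wt (sm w' a))"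
    by (rule RIII_sm[OF pw(1)[unfolded w], folded w w', OF 1 2 3 4 wts])
  define C where "C = {q \<in> set u. mate q \<in> set (v @ x)}"
  have C: "C \<subseteq> set (u @ v @ x)" "finite C" by (auto simp: C_def)
  have uv: "set u \<inter> set (v @ x) = {}" using d(20) by auto
  have mo: "mate q \<noteq> b \<and> mate q \<noteq> c \<and> mate q \<noteq> mate b \<and> mate q \<noteq> mate c"
    if "q \<in> set u" for q
  proof -
    have "mate q \<in> set (u @ v @ x)" using d(21)[of q] that by simp
    then show ?thesis using d(19) by blast
  qed
  have cu: "c \<notin> set u" "mate b \<notin> set u" using d(19) by auto
  have ch: "chords w a = (if s1 then {mate c} else {}) \<union> (if s2 then {b} else {}) \<union> C"
  proof (rule set_eqI)
    fix q
    show "q \<in> chords w a \<longleftrightarrow> q \<in> (if s1 then {mate c} else {}) \<union> (if s2 then {b} else {}) \<union> C"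
      using mo[of q] d(1-18) by (cases s1; cases s2) (auto simp: chords_def arcs C_def)
  qed
  have ch': "chords w' a = (if s1 then {} else {mate c}) \<union> (if s2 then {} else {b}) \<union> C"
  proof (rule set_eqI)
    fix q
    show "q \<in> chords w' a \<longleftrightarrow> q \<in> (if s1 then {} else {mate c}) \<union> (if s2 then {} else {b}) \<union> C"
      using mo[of q] d(1-18) by (cases s1; cases s2) (auto simp: chords_def arcs C_def)
  qed
  have un: "NN n wt (dbl w a q) = NN n wt (dbl w' a q)" if q: "q \<in> C" for q n
  proof -
    have q1: "q \<in> chords w a" "q \<in> chords w' a" using q ch ch' by blast+
    have 1: "dstate w q a (\<lambda>n. NN n wt (dbl w a q))" "dstate w' q a (\<lambda>n. NN n wt (dbl w' a q))"
      using dbl_dstate[OF pw(1) ain(1) q1(1)] dbl_dstate[OF pw(2) ain(2) q1(2)]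
      by (simp_all only: dstate_commute)
    have "q \<notin> ?E" using q C(1) d(19) by blast
    then have "(\<lambda>n. NN n wt (dbl w a q)) = (\<lambda>n. NN n wt (dbl w' a q))"
      by (rule RIII_dbl[OF pw(1)[unfolded w], folded w w', OF 1 _ wts])
    then show ?thesis by (rule fun_cong)
  qed
  have dc: "dstate w a c (\<lambda>n. NN n wt (dbl w a (mate c)))" if s1
    using dbl_dstate[OF pw(1) ain(1), of "mate c"] that by (simp add: ch dstate_mate)
  have db: "dstate w a b (\<lambda>n. NN n wt (dbl w a b))" if s2
    using dbl_dstate[OF pw(1) ain(1), of b] that by (simp add: ch)
  have dc': "dstate w' a c (\<lambda>n. NN n wt (dbl w' a (mate c)))" if "\<not> s1"
    using dbl_dstate[OF pw(2) ain(2), of "mate c"] that by (simp add: ch' dstate_mate)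
  have db': "dstate w' a b (\<lambda>n. NN n wt (dbl w' a b))" if "\<not> s2"
    using dbl_dstate[OF pw(2) ain(2), of b] that by (simp add: ch')
  have BB: "BB k m w a = BB k m w' a" for k m
  proof -
    let ?t = "\<lambda>w q. wt q * hit m (NN k wt (dbl w a q))"
    have "sum (?t w) C = sum (?t w') C"
      using un by (intro sum.cong refl) simp
    moreover have "b \<notin> C" "mate c \<notin> C" using C(1) o by blast+
    \<comment> \<open>For equal flags both special chords are on one side of the move and cancel
      there. For different flags each side has one of them, and these two terms agree.\<close>
    moreover have "(if s1 then ?t w (mate c) else 0) + (if s2 then ?t w b else 0)
        = (if s1 then 0 else ?t w' (mate c)) + (if s2 then 0 else ?t w' b)"
    proof (cases s1; cases s2)
      assume s: s1 s2
      have "NN k wt (dbl w a (mate c)) = NN k wt (dbl w a b)"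
        by (rule fun_cong[OF RIII_two_same[OF pw(1)[unfolded w], folded w, OF dc[OF s(1)] db[OF s(2)] s wts]])
      then show ?thesis using s sw by simp
    next
      assume s: s1 "\<not> s2"
      have "NN k wt (dbl w a (mate c)) = NN k wt (dbl w' a b)"
        by (rule fun_cong[OF RIII_two_opposite[OF pw(1)[unfolded w], folded w w', OF dc[OF s(1)] db'[OF s(2)] s wts]])
      then show ?thesis using s sw by simp
    next
      assume s: "\<not> s1" s2
      have ns: "\<not> s1" "\<not> \<not> s2" using s by simp_all
      have ww: "w = tri_word (\<not> \<not> s1) (\<not> \<not> s2) (\<not> \<not> s3) a b c u v x" using w by simp
      have "NN k wt (dbl w' a (mate c)) = NN k wt (dbl w a b)"
        by (rule fun_cong[OF RIII_two_opposite[OF pw(2)[unfolded w'], folded w' ww,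
              OF dc'[OF s(1)] db[OF s(2)] ns tri_wts_not[OF wts]]])
      then show ?thesis using s sw by simp
    next
      assume s: "\<not> s1" "\<not> s2"
      have "NN k wt (dbl w' a (mate c)) = NN k wt (dbl w' a b)"
        by (rule fun_cong[OF RIII_two_same[OF pw(2)[unfolded w'], folded w',
              OF dc'[OF s(1)] db'[OF s(2)] s tri_wts_not[OF wts]]])
      then show ?thesis using s sw by simp
    qed
    ultimately show ?thesis
      unfolding BB_def ch ch' using C(2) d(1-18) by (cases s1; cases s2; simp)
  qed
  show ?thesis using idx sm BB by (simp add: data_eq_def fun_eq_iff)
qed

end

lemma RIII_data:
  assumes fr: "four_regular w" "four_regular w'"
    and w: "w = tri_word s1 s2 s3 a b c u v x"
    and w': "w' = tri_word (\<not> s1) (\<not> s2) (\<not> s3) a b c u v x"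
    and wts: "tri_wts s1 s2 s3 a b c" and p: "p \<in> set w"
  shows "data_eq w p w' p"
proof -
  have first: "data_eq w a w' a"
    if fr: "four_regular w" "four_regular w'"
      and w: "w = tri_word s1 s2 s3 a b c u v x"
      and w': "w' = tri_word (\<not> s1) (\<not> s2) (\<not> s3) a b c u v x"
      and wts: "tri_wts s1 s2 s3 a b c" for w w' s1 s2 s3 a b c u v x
    by (rule RIII_data_first[OF that])
  have rot: "four_regular (tri_word s2 s3 s1 b c a v x u) \<and>
      (\<forall>q\<in>set w. data_eq w q (tri_word s2 s3 s1 b c a v x u) q)"
    if "four_regular w" "w = tri_word s1 s2 s3 a b c u v x" for w s1 s2 s3 a b c u v x
  proof -
    note h = that
    obtain U V where UV: "w = U @ V" "tri_word s2 s3 s1 b c a v x u = V @ U"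
      using tri_word_rotated[of s1 s2 s3 a b c u v x] h(2) by metis
    have fr: "four_regular (U @ V)" using h(1) UV(1) by simp
    have "data_eq (U @ V) q (V @ U) q" if "q \<in> set (U @ V)" for q
      using data_eq_sym[OF data_eq_rotated[OF four_regular_paired[OF fr] that]] .
    then show ?thesis unfolding UV using four_regular_rotated[OF fr] by blast
  qed
  let ?w2 = "tri_word s2 s3 s1 b c a v x u" and ?w3 = "tri_word s3 s1 s2 c a b x u v"
  let ?w2' = "tri_word (\<not> s2) (\<not> s3) (\<not> s1) b c a v x u"
  let ?w3' = "tri_word (\<not> s3) (\<not> s1) (\<not> s2) c a b x u v"
  note r2 = rot[OF fr(1) w] and r2' = rot[OF fr(2) w']
  note r3 = rot[OF r2[THEN conjunct1] refl] and r3' = rot[OF r2'[THEN conjunct1] refl]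
  note w2 = tri_wts_rotated[OF wts]
  note w3 = tri_wts_rotated[OF w2]
  have sets: "set w' = set w" "set ?w2 = set w" "set ?w2' = set w"
    unfolding w w' tri_word_set by auto
  have mem: "a \<in> set w" "b \<in> set w" "c \<in> set w" unfolding w tri_word_set by auto
  note d2 = r2[THEN conjunct2, rule_format] and d3 = r3[THEN conjunct2, rule_format, unfolded sets]
    and d2' = r2'[THEN conjunct2, rule_format, unfolded sets]
    and d3' = r3'[THEN conjunct2, rule_format, unfolded sets]
  have A: "data_eq w a w' a" by (rule first[OF fr w w' wts])
  have "data_eq ?w2 b ?w2' b"
    by (rule first[OF r2[THEN conjunct1] r2'[THEN conjunct1] refl refl w2])
  with d2[OF mem(2)] have "data_eq w b ?w2' b" by (rule data_eq_trans)
  then have B: "data_eq w b w' b" using data_eq_sym[OF d2'[OF mem(2)]] by (rule data_eq_trans)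
  have "data_eq ?w3 c ?w3' c"
    by (rule first[OF r3[THEN conjunct1] r3'[THEN conjunct1] refl refl w3])
  with data_eq_trans[OF d2[OF mem(3)] d3[OF mem(3)]] have "data_eq w c ?w3' c" by (rule data_eq_trans)
  then have C: "data_eq w c w' c"
    using data_eq_sym[OF data_eq_trans[OF d2'[OF mem(3)] d3'[OF mem(3)]]] by (rule data_eq_trans)
  have m: "data_eq w (mate q) w' (mate q)" if "data_eq w q w' q" "q \<in> set w" for q
    using data_eq_mate[OF fr _ _ that(1)] that(2) sets(1) by simp
  have "p \<in> set (u @ v @ x) \<or> p \<in> {a, b, c} \<or> p \<in> {mate a, mate b, mate c}"
    using p unfolding w tri_word_set by blast
  then show ?thesis
  proof (elim disjE)
    assume "p \<in> set (u @ v @ x)"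
    then show ?thesis by (rule RIII_data_outside[OF fr w w' wts])
  qed (use A B C m[OF A mem(1)] m[OF B mem(2)] m[OF C mem(3)] in auto)
qed

section \<open>The data in terms of the definitions\<close>

text \<open>The appended \<open>[p]\<close> covers the circle with a single passage, which is its
  own successor.\<close>

lemma nxt_split:
  assumes "distinct (u @ p # v)"
  shows "nxt (u @ p # v) p = hd (v @ u @ [p])"
proof -
  let ?w = "u @ p # v"
  have "map_of (zip ?w (rotate1 ?w)) (?w ! length u) = Some (rotate1 ?w ! length u)"
    by (rule map_of_zip_nth) (use assms in simp_all)
  moreover have "rotate1 ?w ! length u = ?w ! (Suc (length u) mod length ?w)"
    by (rule nth_rotate1) simp
  moreover have "?w ! (Suc (length u) mod length ?w) = hd (v @ u @ [p])"
  proof (cases v)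
    case Nil
    then show ?thesis by (cases u) (simp_all add: nth_append)
  next
    case (Cons y ys)
    then show ?thesis by (simp add: nth_append)
  qed
  ultimately show ?thesis by (simp add: nxt_def)
qed

lemma closed_chain_nxt:
  assumes "distinct w" "closed_chain f g w" "p \<in> set w"
  shows "f (nxt w p) = g p"
proof -
  obtain u v where w: "w = u @ p # v" using assms(3) by (meson split_list)
  have "closed_chain f g ((p # v) @ u)"
    using assms(2) closed_chain_rotated[of f g u "p # v"] by (simp add: w)
  then have "chain f g (g p) (v @ u) (f p)" by (auto simp: closed_chain_def)
  then have "f (hd (v @ u @ [p])) = g p" by (cases v; cases u) auto
  then show ?thesis using nxt_split assms(1) by (simp add: w)
qed

text \<open>Passes from one label per edge to the two labels of a potential: the label leaving
  \<open>p\<close> is the one arriving at its successor.\<close>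

lemma closed_chain_nxt_self:
  assumes "distinct w"
  shows "closed_chain f (\<lambda>p. f (nxt w p)) w"
proof (cases w)
  case Nil
  then show ?thesis by (simp add: closed_chain_def)
next
  case (Cons x xs)
  have "chain f (\<lambda>p. f (nxt w p)) (f (hd (v @ [x]))) v (f x)" if "w = u @ v" for u v
    using that
  proof (induction v arbitrary: u)
    case (Cons p v)
    have "nxt w p = hd (v @ u @ [p])" using nxt_split[of u p v] assms Cons.prems by simp
    also have "\<dots> = hd (v @ [x])"
      using Cons.prems \<open>w = x # xs\<close> by (cases v; cases u) auto
    finally have "nxt w p = hd (v @ [x])" .
    then show ?case using Cons.IH[of "u @ [p]"] Cons.prems by simp
  qed simp
  from this[of "[]" w] show ?thesis using Cons by (auto simp: closed_chain_def)
qed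

lemma labelling_iff:
  assumes "distinct w"
  shows "labelling w lab \<longleftrightarrow> (\<forall>p\<in>set w. lab (nxt w p) = lab p - wt p)"
  unfolding labelling_def by (intro ball_cong refl) (auto simp: wt_def)

lemma labelling_exists:
  assumes "paired w"
  obtains lab where "labelling w lab"
proof -
  obtain f g where "closed_chain f g w" "\<And>p. g p = f p - wt p"
    using closed_chain_exists[of w wt] assms by auto
  then have "labelling w f"
    unfolding labelling_iff[OF paired_distinct[OF assms]]
    using closed_chain_nxt[OF paired_distinct[OF assms], of f g] by simp
  then show ?thesis using that by blast
qed

section \<open>Signs, indices and smoothings in terms of over passages\<close>

definition overs :: "circ \<Rightarrow> passage set" where
  "overs w = {p \<in> set w. level p = Over}"

lemma finite_overs [simp]: "finite (overs w)"
  by (simp add: overs_def)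

lemma passage_on_eq:
  assumes "four_regular w" "p \<in> set w" "level p \<noteq> Virt"
  shows "passage_on w (vert p) (level p) = p"
  unfolding passage_on_def
proof (rule the_equality)
  fix q assume q: "q \<in> set w \<and> vert q = vert p \<and> level q = level p"
  then have "q = p \<or> q = mate p" using four_regular_vert[OF assms(1,2)] by blast
  moreover have "level (mate p) \<noteq> level p" using assms(3) by (cases "level p") auto
  ultimately show "q = p" using q by auto
qed (use assms in auto)

lemma passage_from_eq:
  assumes "four_regular w" "p \<in> set w"
  shows "passage_from w (vert p) (side p) = p"
  unfolding passage_from_def
proof (rule the_equality)
  fix q assume q: "q \<in> set w \<and> vert q = vert p \<and> side q = side p"
  then have "q = p \<or> q = mate p" using four_regular_vert[OF assms] by blast
  then show "q = p" using q by auto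
qed (use assms in auto)

lemma inj_on_vert_overs:
  assumes "four_regular w" "A \<subseteq> set w" "\<And>p. p \<in> A \<Longrightarrow> mate p \<notin> A"
  shows "inj_on vert A"
proof (rule inj_onI)
  fix p q assume "p \<in> A" "q \<in> A" "vert p = vert q"
  then show "p = q"
    using four_regular_vert[OF assms(1), of q p] assms(2,3) by auto
qed

lemma crossings_overs:
  assumes "four_regular w"
  shows "crossings w = vert ` overs w" "inj_on vert (overs w)"
proof -
  have "vert p \<in> vert ` overs w" if "p \<in> set w" "level p \<noteq> Virt" for p
  proof (cases "level p")
    case Over
    then show ?thesis using that by (auto simp: overs_def)
  next
    case Under
    then have "mate p \<in> overs w"
      using that paired_mate_iff[OF four_regular_paired[OF assms]] by (simp add: overs_def)
    then show ?thesis by (metis image_eqI mate_simps(1))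
  qed (use that in simp)
  then show "crossings w = vert ` overs w" by (auto simp: crossings_def overs_def)
  show "inj_on vert (overs w)"
    by (rule inj_on_vert_overs[OF assms]) (auto simp: overs_def)
qed

lemma crossing_sgn_over:
  assumes "four_regular w" "p \<in> overs w"
  shows "crossing_sgn w (vert p) = wt p"
  using passage_on_eq[OF assms(1), of p] assms(2) by (simp add: crossing_sgn_def overs_def wt_def)

text \<open>All labellings give the same value, and one exists, so the description in
  \<open>Ind\<close> denotes. The sign of the crossing and the \<open>- 1\<close> turn the label
  difference into the arc sum of the over passage for either side of \<open>p\<close>.\<close>

lemma Ind_over:
  assumes "four_regular w" "p \<in> overs w"
  shows "Ind w (vert p) = idx w p"
proof -
  have pw: "paired w" and d: "distinct w" using four_regular_paired[OF assms(1)] paired_distinct by blast+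
  have p: "p \<in> set w" "level p = Over" using assms(2) by (auto simp: overs_def)
  have m: "mate p \<in> set w" using p(1) paired_mate_iff[OF pw] by simp
  have *: "crossing_sgn w (vert p) * (lab (passage_from w (vert p) Lft) - lab (passage_from w (vert p) Rgt) - 1)
      = idx w p" if lab: "labelling w lab" for lab
  proof -
    let ?g = "\<lambda>p. lab (nxt w p)"
    have g: "\<And>q. q \<in> set w \<Longrightarrow> ?g q = lab q - wt q" using lab labelling_iff[OF d] by blast
    have i: "idx w q = lab q - wt q - lab (mate q)" if "q \<in> set w" for q
      using closed_chain_arc[of w lab ?g wt q] pw closed_chain_nxt_self[OF d, of lab] g that
      by (simp add: idx_def)
    show ?thesis
    proof (cases "side p")
      case Lft
      then show ?thesis
        using i[OF p(1)] passage_from_eq[OF assms(1) p(1)] passage_from_eq[OF assms(1) m]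
          crossing_sgn_over[OF assms] p(2) by (simp add: wt_def)
    next
      case Rgt
      then show ?thesis
        using i[OF p(1)] passage_from_eq[OF assms(1) p(1)] passage_from_eq[OF assms(1) m]
          crossing_sgn_over[OF assms] p(2) by (simp add: wt_def)
    qed
  qed
  obtain lab where "labelling w lab" using labelling_exists[OF pw] .
  then show ?thesis unfolding Ind_def using * by (intro the_equality) auto
qed

lemma sum_crossings:
  assumes "four_regular w"
  shows "(\<Sum>c\<in>crossings w. h c) = (\<Sum>p\<in>overs w. h (vert p))"
  using crossings_overs[OF assms] by (simp add: sum.reindex)

lemma nabla_J_over:
  assumes "four_regular w"
  shows "nabla_J n w = (\<Sum>p\<in>overs w. wt p * delta n (idx w p))"
proof -
  have fin: "finite (crossings w)" using crossings_overs(1)[OF assms] by simp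
  have "J n w = (\<Sum>p\<in>overs w. wt p * of_bool (idx w p = n))" for n
  proof -
    have "J n w = (\<Sum>c\<in>crossings w. if Ind w c = n then crossing_sgn w c else 0)"
      unfolding J_def using fin by (intro sum.inter_filter) simp
    then show ?thesis
      unfolding sum_crossings[OF assms]
      by (simp only:) (intro sum.cong refl, simp add: Ind_over[OF assms] crossing_sgn_over[OF assms])
  qed
  then show ?thesis by (simp add: nabla_J_def delta_def sum_subtractf algebra_simps)
qed

text \<open>The under passages repeat the contribution of the over passages, and virtual ones weigh
  nothing.\<close>

lemma nabla_J_NN:
  assumes "four_regular w"
  shows "2 * nabla_J n w = NN n wt w"
proof -
  have pw: "paired w" using four_regular_paired assms .
  let ?t = "\<lambda>p. wt p * delta n (idx w p)"
  have "set w = overs w \<union> mate ` overs w \<union> {p \<in> set w. level p = Virt}"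
  proof (rule set_eqI)
    fix p
    have "p \<in> mate ` overs w \<longleftrightarrow> mate p \<in> overs w" by (metis image_iff mate_simps(4))
    then show "p \<in> set w \<longleftrightarrow> p \<in> overs w \<union> mate ` overs w \<union> {p \<in> set w. level p = Virt}"
      using paired_mate_iff[OF pw, of p] by (cases "level p") (auto simp: overs_def)
  qed
  then have "NN n wt w = sum ?t (overs w \<union> mate ` overs w \<union> {p \<in> set w. level p = Virt})"
    by (simp add: NN_def idx_def)
  also have "\<dots> = sum ?t (overs w \<union> mate ` overs w) + sum ?t {p \<in> set w. level p = Virt}"
    by (rule sum.union_disjoint) (auto simp: overs_def)
  also have "sum ?t {p \<in> set w. level p = Virt} = 0" by (simp add: wt_def)
  also have "sum ?t (overs w \<union> mate ` overs w) = sum ?t (overs w) + sum ?t (mate ` overs w)"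
    by (rule sum.union_disjoint) (auto simp: overs_def)
  also have "sum ?t (mate ` overs w) = sum ?t (overs w)"
    by (subst sum.reindex) (auto simp: inj_on_def idx_mate[OF pw] overs_def)
  finally show ?thesis by (simp add: nabla_J_over[OF assms])
qed

text \<open>For a classical \<open>p\<close>, the passage of its crossing at which the arc kept by
  the convention starts.\<close>

definition kept :: "convention \<Rightarrow> passage \<Rightarrow> passage" where
  "kept \<kappa> p = (if kept_level \<kappa> = level p then p else mate p)"

lemma kept_cases: "kept \<kappa> p = p \<or> kept \<kappa> p = mate p"
  by (simp add: kept_def)

lemma passage_on_kept:
  assumes "four_regular w" "p \<in> set w" "level p \<noteq> Virt"
  shows "passage_on w (vert p) (kept_level \<kappa>) = kept \<kappa> p"
proof -
  have m: "mate p \<in> set w" using assms four_regular_paired paired_mate_iff by blast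
  have "level (kept \<kappa> p) = kept_level \<kappa>"
    using assms(3) by (cases \<kappa>; cases "level p") (simp_all add: kept_def)
  moreover have "vert (kept \<kappa> p) = vert p" "kept \<kappa> p \<in> set w" "level (kept \<kappa> p) \<noteq> Virt"
    using assms m by (simp_all add: kept_def)
  ultimately show ?thesis using passage_on_eq[OF assms(1), of "kept \<kappa> p"] by simp
qed

lemma kept_in:
  assumes "four_regular w" "p \<in> overs w"
  shows "p \<in> set w" "level p \<noteq> Virt" "kept \<kappa> p \<in> set w"
  using assms kept_cases[of \<kappa> p] paired_mate_iff[OF four_regular_paired[OF assms(1)], of p]
  by (auto simp: overs_def)

lemma smooth1_sm:
  assumes "four_regular w" "p \<in> overs w"
  shows "smooth1 \<kappa> w (vert p) = sm w (kept \<kappa> p)"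
  using passage_on_kept[OF assms(1)] kept_in[OF assms] by (simp add: smooth1_def sm_def Let_def)

lemma four_regular_map_reorient:
  assumes "four_regular w" "paired L" "set L \<subseteq> set w"
  shows "four_regular (map (reorient R) L)"
  unfolding four_regular_iff
proof (intro conjI ballI impI)
  show "paired (map (reorient R) L)" by (rule paired_map_reorient[OF assms])
  fix p' q' assume "p' \<in> set (map (reorient R) L)" "q' \<in> set (map (reorient R) L)" "vert q' = vert p'"
  then obtain p q where "p' = reorient R p" "q' = reorient R q" "p \<in> set L" "q \<in> set L" "vert q = vert p"
    unfolding set_map by (elim imageE) (metis reorient_simps(1))
  then have "p' = reorient R p" "q' = reorient R q" "p \<in> set w" "q \<in> set w" "vert q = vert p"
    using assms(3) by blast+
  then show "q' = p' \<or> q' = mate p'"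
    using four_regular_vert[OF assms(1)] mate_reorient by metis
qed

lemma four_regular_subset:
  assumes "four_regular w" "paired L" "set L \<subseteq> set w"
  shows "four_regular L"
  using assms unfolding four_regular_iff by (meson subsetD)

lemma four_regular_sm:
  assumes "four_regular w" "p \<in> set w"
  shows "four_regular (sm w p)"
  unfolding sm_def reverse_join_def
  using paired_sm_word[OF four_regular_paired[OF assms(1)] assms(2)]
  by (intro four_regular_map_reorient[OF assms(1)]) auto

lemma nabla_J_smooth1:
  assumes "four_regular w" "p \<in> overs w"
  shows "2 * nabla_J n (smooth1 \<kappa> w (vert p)) = NN n wt (sm w (kept \<kappa> p))"
  using nabla_J_NN[OF four_regular_sm] kept_in[OF assms] assms smooth1_sm[OF assms] by simp

text \<open>
  Smoothing \<open>c\<close> and then a crossing \<open>e\<close> of the two components joins the four arcs between \<open>c\<close> and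
  \<open>e\<close> without any relative reversal.
\<close>

lemma smooth3_smooth2:
  assumes fr: "four_regular w" and p: "p \<in> set w" and q: "q \<in> chords w p" and r: "r = q \<or> r = mate q"
    and E: "E = (map (reorient (set (arc w (mate p)))) (arc w p),
      map (reorient (set (arc w (mate p)))) (rev (arc w (mate p))))"
    and l: "level r = kept_level \<kappa>"
  shows "smooth3 \<kappa> E (vert q) = dbl w p q \<or> smooth3 \<kappa> E (vert q) = rev (dbl w p q)"
proof -
  define X where "X = arc w p"
  define Y where "Y = arc w (mate p)"
  let ?\<rho> = "reorient (set Y)"
  have pw: "paired w" using four_regular_paired fr .
  have E: "E = (map ?\<rho> X, map ?\<rho> (rev Y))" using E by (simp add: X_def Y_def)
  have qX: "q \<in> set X" and qY: "mate q \<in> set Y" using q by (auto simp: chords_def X_def Y_def)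
  have d: "distinct X" "distinct Y" "set X \<inter> set Y = {}"
    using paired_split_facts(2)[OF pw p] by (auto simp: X_def Y_def)
  have sub: "set X \<subseteq> set w" "set Y \<subseteq> set w"
    using paired_split_facts(1)[OF pw p] by (auto simp: X_def Y_def)
  have inj: "inj_on ?\<rho> (set w)" by (rule reorient_inj_on[OF fr])
  have L: "paired (X @ rev Y)" "set (X @ rev Y) = set w - {p, mate p}"
    using paired_sm_word[OF pw p] by (simp_all add: X_def Y_def)
  have frE: "four_regular (fst E @ snd E)"
    unfolding E fst_conv snd_conv map_append[symmetric]
    by (rule four_regular_map_reorient[OF fr L(1)]) (use L(2) in blast)
  have rin: "r \<in> set X \<union> set Y" using r qX qY by auto
  have "passage_on (fst E @ snd E) (vert (?\<rho> r)) (level (?\<rho> r)) = ?\<rho> r"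
    by (rule passage_on_eq[OF frE]) (use rin l in \<open>cases \<kappa>; auto simp: E\<close>)+
  then have on: "passage_on (fst E @ snd E) (vert q) (kept_level \<kappa>) = ?\<rho> r" using r l by auto
  have mem: "?\<rho> t \<in> ?\<rho> ` A \<longleftrightarrow> t \<in> A" if "t \<in> set w" "A \<subseteq> set w" for t A
    using inj_on_image_mem_iff[OF inj that] .
  have aX: "after (map ?\<rho> X) (?\<rho> q) = map ?\<rho> (after X q)"
    by (rule after_map[OF d(1) qX inj_on_subset[OF inj sub(1)]])
  have aY: "after (map ?\<rho> (rev Y)) (?\<rho> (mate q)) = map ?\<rho> (rev (after Y (mate q)))"
    using after_map[of "rev Y" "mate q" ?\<rho>] d(2) qY inj_on_subset[OF inj sub(2)]
    by (simp add: after_rev)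
  have sX: "set (after X q) = set X - {q}" and sY: "set (after Y (mate q)) = set Y - {mate q}"
    using set_after d qX qY by auto
  \<comment> \<open>Away from the crossing of \<open>q\<close>, reversing either component flips
    exactly the crossings between the two. The second reorientation thus restores the original
    sides.\<close>
  have undo: "reorient (?\<rho> ` B) (?\<rho> t) = t"
    if t: "t \<in> set (after X q @ after Y (mate q))" and B: "B = set X - {q} \<or> B = set Y - {mate q}" for t B
  proof -
    have tw: "t \<in> set w" "mate t \<in> set w" using t sX sY sub paired_mate_iff[OF pw] by auto
    have tm: "t \<in> set X \<union> set Y" "mate t \<in> set X \<union> set Y" "t \<noteq> q" "t \<noteq> mate q"
      using t sX sY d paired_mate_iff[OF L(1), of t] qX qY by auto
    have BX: "B \<subseteq> set w" using B sub by auto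
    have 1: "?\<rho> t \<in> ?\<rho> ` B \<longleftrightarrow> t \<in> B" "mate (?\<rho> t) \<in> ?\<rho> ` B \<longleftrightarrow> mate t \<in> B"
      unfolding mate_reorient by (rule mem[OF tw(1) BX], rule mem[OF tw(2) BX])
    have "(t \<in> B) \<noteq> (mate t \<in> B) \<longleftrightarrow> (t \<in> set Y) \<noteq> (mate t \<in> set Y)"
    proof -
      have "mate t \<noteq> q" "mate t \<noteq> mate q" using tm(3,4) by auto
      then show ?thesis using B tm d(3) by auto
    qed
    then show ?thesis
      unfolding reorient_def[of "?\<rho> ` B"] 1 unfolding reorient_def[of "set Y"]
      by (cases t) (simp split: if_splits)
  qed
  have undo_map: "map (reorient (?\<rho> ` B)) (map ?\<rho> L) = L"
    if "set L \<subseteq> set (after X q @ after Y (mate q))" "B = set X - {q} \<or> B = set Y - {mate q}" for L B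
    unfolding map_map by (rule map_idI) (use that undo in auto)
  have dbl: "dbl w p q = after X q @ after Y (mate q)" by (simp add: dbl_def X_def Y_def)
  show ?thesis
  \<comment> \<open>If the first component is kept, the second one has been reversed twice.
    Otherwise each has been reversed once, which is the whole curve run backwards.\<close>
  proof (cases "r = q")
    case True
    have "?\<rho> r \<in> set (fst E)" using True qX by (simp add: E)
    then have "smooth3 \<kappa> E (vert q) = reverse_join (after (fst E) (?\<rho> q)) (after (snd E) (?\<rho> (mate q)))"
      using True on by (simp add: smooth3_def mate_reorient)
    also have "\<dots> = map (reorient (?\<rho> ` (set Y - {mate q}))) (map ?\<rho> (after X q @ after Y (mate q)))"
      unfolding E fst_conv snd_conv aX aY reverse_join_def by (simp add: sY rev_map)
    also have "\<dots> = dbl w p q" unfolding dbl by (rule undo_map) auto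
    finally show ?thesis by simp
  next
    case False
    then have r: "r = mate q" using r by simp
    have "?\<rho> r \<notin> set (fst E)"
      using mem[of r "set X"] r qY d(3) sub by (auto simp: E)
    then have "smooth3 \<kappa> E (vert q) = reverse_join (after (snd E) (?\<rho> (mate q))) (after (fst E) (?\<rho> q))"
      using r on by (simp add: smooth3_def mate_reorient)
    also have "\<dots> = map (reorient (?\<rho> ` (set X - {q}))) (map ?\<rho> (rev (after X q @ after Y (mate q))))"
      unfolding E fst_conv snd_conv aX aY reverse_join_def by (simp add: sX rev_map)
    also have "\<dots> = rev (dbl w p q)" unfolding dbl by (rule undo_map) auto
    finally show ?thesis by simp
  qed
qed

section \<open>The flat span as a weighted count of chords\<close>

lemma four_regular_dbl:
  assumes "four_regular w" "p \<in> set w" "q \<in> chords w p"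
  shows "four_regular (dbl w p q)"
proof -
  note d = paired_dbl[OF four_regular_paired[OF assms(1)] assms(2,3)]
  show ?thesis by (rule four_regular_subset[OF assms(1) d(1)]) (unfold d(2), blast)
qed

lemma four_regular_rev: "four_regular w \<Longrightarrow> four_regular (rev w)"
  unfolding four_regular_iff paired_def by (simp only: set_rev distinct_rev simp_thms) blast

text \<open>The mixed crossings are the chords of the kept passage. Their signs are flipped by the
  reversal of one component, whence the minus sign; the opposite signs of the over and under sums
  turn crossing signs into weights of passages on the first component. The convention of
  \<open>smooth3\<close> affects only the sign of \<nabla>J_k, which the sum over \<open>m\<close>
  and \<open>- m\<close> ignores.\<close>

lemma fspan_BB:
  assumes fr: "four_regular w" and o: "c \<in> overs w"
  shows "fspan \<kappa>\<^sub>3 k m (smooth2 \<kappa>\<^sub>2 w (vert c)) = - BB k m w (kept \<kappa>\<^sub>2 c)"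
proof -
  define p where "p = kept \<kappa>\<^sub>2 c"
  have p: "p \<in> set w" using kept_in[OF fr o] by (simp add: p_def)
  have pw: "paired w" using four_regular_paired fr .
  define X where "X = arc w p"
  define Y where "Y = arc w (mate p)"
  define E where "E = (map (reorient (set Y)) X, map (reorient (set Y)) (rev Y))"
  let ?\<rho> = "reorient (set Y)"
  have E2: "smooth2 \<kappa>\<^sub>2 w (vert c) = E"
    using passage_on_kept[OF fr, of c] kept_in[OF fr o]
    by (simp add: smooth2_def Let_def E_def X_def Y_def p_def)
  have sub: "set X \<subseteq> set w" "set Y \<subseteq> set w"
    using paired_split_facts(1)[OF pw p] by (auto simp: X_def Y_def)
  have disj: "set X \<inter> set Y = {}"
    using paired_split_facts(2)[OF pw p] by (auto simp: X_def Y_def)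
  have inj: "inj_on ?\<rho> (set w)" by (rule reorient_inj_on[OF fr])
  have L: "paired (X @ rev Y)" "set (X @ rev Y) = set w - {p, mate p}"
    using paired_sm_word[OF pw p] by (simp_all add: X_def Y_def)
  have frE: "four_regular (fst E @ snd E)"
    unfolding E_def fst_conv snd_conv map_append[symmetric]
    by (rule four_regular_map_reorient[OF fr L(1)]) (use L(2) in blast)
  have mY: "mate (?\<rho> q) \<in> ?\<rho> ` set Y \<longleftrightarrow> mate q \<in> set Y" if "q \<in> set w" for q
    unfolding mate_reorient using inj_on_image_mem_iff[OF inj _ sub(2), of "mate q"]
      paired_mate_iff[OF pw] that by simp
  have mixed: "{p' \<in> set (fst E). level p' = l \<and> mate p' \<in> set (snd E)}
      = ?\<rho> ` {q \<in> chords w p. level q = l}" for l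
  proof -
    have "{p' \<in> set (fst E). level p' = l \<and> mate p' \<in> set (snd E)}
        = {p' \<in> ?\<rho> ` set X. level p' = l \<and> mate p' \<in> ?\<rho> ` set Y}" by (simp add: E_def)
    also have "\<dots> = ?\<rho> ` {q \<in> set X. level (?\<rho> q) = l \<and> mate (?\<rho> q) \<in> ?\<rho> ` set Y}" by blast
    also have "{q \<in> set X. level (?\<rho> q) = l \<and> mate (?\<rho> q) \<in> ?\<rho> ` set Y}
        = {q \<in> chords w p. level q = l}"
    proof (rule set_eqI)
      fix q show "q \<in> {q \<in> set X. level (?\<rho> q) = l \<and> mate (?\<rho> q) \<in> ?\<rho> ` set Y}
          \<longleftrightarrow> q \<in> {q \<in> chords w p. level q = l}"
        unfolding chords_def X_def[symmetric] Y_def[symmetric] using mY[of q] sub(1) by auto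
    qed
    finally show ?thesis .
  qed
  have fo: "first_over E = vert ` {q \<in> chords w p. level q = Over}"
    and fu: "first_under E = vert ` {q \<in> chords w p. level q = Under}"
    unfolding first_over_def first_under_def mixed image_image by simp_all
  have chw: "chords w p \<subseteq> set w" using sub(1) by (auto simp: chords_def X_def)
  have chm: "mate q \<notin> chords w p" if "q \<in> chords w p" for q
    using that disj by (auto simp: chords_def X_def Y_def)
  have injv: "inj_on vert (chords w p)" by (rule inj_on_vert_overs[OF fr chw chm])
  have fin: "finite (chords w p)" by (simp add: chords_def)
  have sgn: "crossing_sgn (fst E @ snd E) (vert q) = (if level q = Over then - wt q else wt q)"
    if q: "q \<in> chords w p" and v: "level q \<noteq> Virt" for q
  proof -
    define r where "r = (if level q = Over then q else mate q)"
    have qXY: "q \<in> set X" "mate q \<in> set Y" using q by (auto simp: chords_def X_def Y_def)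
    then have "q \<notin> set Y" "mate (mate q) \<notin> set Y" using disj by auto
    then have wr: "wt (?\<rho> r) = - wt r" using qXY by (simp add: wt_reorient r_def)
    have "level r = Over" using v by (cases "level q") (simp_all add: r_def)
    moreover have "r \<in> set X \<union> set Y" using qXY by (auto simp: r_def)
    ultimately have "?\<rho> r \<in> overs (fst E @ snd E)" by (auto simp: overs_def E_def)
    from crossing_sgn_over[OF frE this] wr show ?thesis by (auto simp: r_def)
  qed
  have nab: "2 * nabla_J k (smooth3 \<kappa>\<^sub>3 E (vert q)) = NN k wt (dbl w p q)
      \<or> 2 * nabla_J k (smooth3 \<kappa>\<^sub>3 E (vert q)) = - NN k wt (dbl w p q)"
    if q: "q \<in> chords w p" and v: "level q \<noteq> Virt" for q
  proof -
    define r where "r = (if level q = kept_level \<kappa>\<^sub>3 then q else mate q)"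
    have "level r = kept_level \<kappa>\<^sub>3" using v by (cases "level q"; cases \<kappa>\<^sub>3) (simp_all add: r_def)
    moreover have "r = q \<or> r = mate q" by (simp add: r_def)
    ultimately have "smooth3 \<kappa>\<^sub>3 E (vert q) = dbl w p q \<or> smooth3 \<kappa>\<^sub>3 E (vert q) = rev (dbl w p q)"
      using smooth3_smooth2[OF fr p q, of r E \<kappa>\<^sub>3] by (simp add: E_def X_def Y_def)
    moreover have "four_regular (dbl w p q)" by (rule four_regular_dbl[OF fr p q])
    ultimately show ?thesis
      using nabla_J_NN[of "dbl w p q" k] nabla_J_NN[of "rev (dbl w p q)" k] four_regular_rev
        NN_rev[OF paired_dbl(1)[OF pw p q], of wt k] by auto
  qed
  let ?n = "\<lambda>q. nabla_J k (smooth3 \<kappa>\<^sub>3 E (vert q))"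
  have part: "(\<Sum>e\<in>vert ` {q \<in> chords w p. level q = l} \<inter> mixed_with \<kappa>\<^sub>3 k m E. crossing_sgn (fst E @ snd E) e)
      = (\<Sum>q\<in>{q \<in> chords w p. level q = l}. (if l = Over then - wt q else wt q) * of_bool (?n q = m))"
    if l: "l = Over \<or> l = Under" for l m
  proof -
    let ?C = "{q \<in> chords w p. level q = l}"
    have "vert ` ?C \<inter> mixed_with \<kappa>\<^sub>3 k m E = vert ` {q \<in> ?C. ?n q = m}"
      unfolding mixed_with_def fo fu using l by auto
    moreover have "inj_on vert {q \<in> ?C. ?n q = m}" by (rule inj_on_subset[OF injv]) auto
    ultimately have "(\<Sum>e\<in>vert ` ?C \<inter> mixed_with \<kappa>\<^sub>3 k m E. crossing_sgn (fst E @ snd E) e)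
        = (\<Sum>q\<in>{q \<in> ?C. ?n q = m}. crossing_sgn (fst E @ snd E) (vert q))"
      by (simp add: sum.reindex)
    also have "\<dots> = (\<Sum>q\<in>?C. if ?n q = m then crossing_sgn (fst E @ snd E) (vert q) else 0)"
      using fin by (intro sum.inter_filter) simp
    also have "\<dots> = (\<Sum>q\<in>?C. (if l = Over then - wt q else wt q) * of_bool (?n q = m))"
      by (intro sum.cong refl) (use sgn l in auto)
    finally show ?thesis .
  qed
  have span: "link_span \<kappa>\<^sub>3 k m E = - (\<Sum>q\<in>chords w p. wt q * of_bool (?n q = m))" for m
  proof -
    let ?h = "\<lambda>q. wt q * of_bool (?n q = m)"
    let ?C = "\<lambda>l. {q \<in> chords w p. level q = l}"
    have U: "chords w p = (?C Over \<union> ?C Under) \<union> ?C Virt"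
    proof (rule set_eqI)
      fix q show "q \<in> chords w p \<longleftrightarrow> q \<in> (?C Over \<union> ?C Under) \<union> ?C Virt" by (cases "level q") auto
    qed
    have "sum ?h (chords w p) = sum ?h ((?C Over \<union> ?C Under) \<union> ?C Virt)"
      by (rule arg_cong[OF U])
    also have "\<dots> = sum ?h (?C Over \<union> ?C Under) + sum ?h (?C Virt)"
      by (rule sum.union_disjoint) (use fin in auto)
    also have "sum ?h {q \<in> chords w p. level q = Virt} = 0" by (simp add: wt_def)
    also have "sum ?h ({q \<in> chords w p. level q = Over} \<union> {q \<in> chords w p. level q = Under})
        = sum ?h {q \<in> chords w p. level q = Over} + sum ?h {q \<in> chords w p. level q = Under}"
      by (rule sum.union_disjoint) (use fin in auto)
    finally show ?thesis
      unfolding link_span_def fo fu by (simp only: part simp_thms level.distinct if_True if_False)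
        (simp add: sum_negf)
  qed
  have "fspan \<kappa>\<^sub>3 k m E = - (\<Sum>q\<in>chords w p. wt q * (of_bool (?n q = m) + of_bool (?n q = - m)))"
    unfolding fspan_def span by (simp add: sum.distrib distrib_left)
  also have "(\<Sum>q\<in>chords w p. wt q * (of_bool (?n q = m) + of_bool (?n q = - m))) = BB k m w p"
    unfolding BB_def
  proof (intro sum.cong refl)
    fix q assume q: "q \<in> chords w p"
    show "wt q * (of_bool (?n q = m) + of_bool (?n q = - m)) = wt q * hit m (NN k wt (dbl w p q))"
    proof (cases "level q = Virt")
      case False
      have "hit m (NN k wt (dbl w p q)) = hit m (2 * ?n q)" using nab[OF q False] hit_minus by auto
      then show ?thesis by (auto simp: hit_def)
    qed (simp add: wt_def)
  qed
  finally show ?thesis by (simp add: E2 p_def)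
qed

section \<open>Bigons and triangles among the faces\<close>

lemma nxt_prv:
  assumes "distinct w" "p \<in> set w"
  shows "prv w (nxt w p) = p" "nxt w (prv w p) = p" "nxt w p \<in> set w" "prv w p \<in> set w"
proof -
  have n: "nxt w (w ! i) = rotate1 w ! i" "prv w (rotate1 w ! i) = w ! i" if "i < length w" for i
    using map_of_zip_nth[of w "rotate1 w" i] map_of_zip_nth[of "rotate1 w" w i] that assms(1)
    by (simp_all add: nxt_def prv_def)
  obtain i where i: "i < length w" "p = w ! i" using assms(2) by (metis in_set_conv_nth)
  then show "prv w (nxt w p) = p" using n by simp
  show "nxt w p \<in> set w" using n(1) i by (metis length_rotate1 nth_mem set_rotate1)
  obtain j where j: "j < length w" "p = rotate1 w ! j"
    using assms(2) by (metis in_set_conv_nth length_rotate1 set_rotate1)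
  then show "nxt w (prv w p) = p" "prv w p \<in> set w" using n by simp_all
qed

lemma nxt_consecutive:
  assumes "distinct (u @ [x, y] @ v)"
  shows "nxt (u @ [x, y] @ v) x = y" "prv (u @ [x, y] @ v) y = x"
proof -
  show n: "nxt (u @ [x, y] @ v) x = y" using nxt_split[of u x "y # v"] assms by simp
  show "prv (u @ [x, y] @ v) y = x" using nxt_prv(1)[OF assms, of x] n by simp
qed

lemma face_next_inj:
  assumes "paired w"
  shows "inj_on (face_next w) (set w \<times> UNIV)"
proof (rule inj_onI)
  fix d e assume d: "d \<in> set w \<times> UNIV" and e: "e \<in> set w \<times> UNIV" and eq: "face_next w d = face_next w e"
  obtain p s q t where de: "d = (p, s)" "e = (q, t)" by (cases d; cases e) auto
  have pq: "mate p \<in> set w" "mate q \<in> set w" using d e de paired_mate_iff[OF assms] by auto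
  note np = nxt_prv[OF paired_distinct[OF assms]]
  have "snd (face_next w d) = ((side p = Lft) = s)" "snd (face_next w e) = ((side q = Lft) = t)"
    by (simp_all add: de face_next_def)
  then have dir: "((side p = Lft) = s) = ((side q = Lft) = t)" using eq by simp
  have "p = q"
  proof (cases "(side p = Lft) = s")
    case True
    then have "fst (face_next w d) = nxt w (mate p)" "fst (face_next w e) = nxt w (mate q)"
      using dir by (simp_all add: de face_next_def)
    then have "prv w (nxt w (mate p)) = prv w (nxt w (mate q))" using eq by simp
    then show ?thesis unfolding np(1)[OF pq(1)] np(1)[OF pq(2)] by simp
  next
    case False
    then have "fst (face_next w d) = prv w (mate p)" "fst (face_next w e) = prv w (mate q)"
      using dir by (simp_all add: de face_next_def)
    then have "nxt w (prv w (mate p)) = nxt w (prv w (mate q))" using eq by simp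
    then show ?thesis unfolding np(2)[OF pq(1)] np(2)[OF pq(2)] by simp
  qed
  then show "d = e" using dir by (auto simp: de)
qed

lemma orbit_invariant:
  assumes "A \<subseteq> orbit f x" "f ` A \<subseteq> A" "f ` (orbit f x - A) \<subseteq> orbit f x - A"
  shows "A = {} \<or> A = orbit f x"
proof (cases "f x \<in> A")
  case True
  have "y \<in> A" if "y \<in> orbit f x" for y
    using that by induction (use True assms(2) in auto)
  then show ?thesis using assms(1) by auto
next
  case False
  have "y \<in> orbit f x - A" if "y \<in> orbit f x" for y
    using that by induction (use False assms(3) in \<open>auto intro: orbit.intros\<close>)
  then show ?thesis using assms(1) by auto
qed

text \<open>By injectivity nothing else is mapped to a fixed point, which would therefore be cut off
  from the rest of the orbit.\<close>

lemma orbit_no_fixpoint: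
  assumes "S = orbit f x" "inj_on f S" "y \<in> S" "z \<in> S" "z \<noteq> y"
  shows "f y \<noteq> y"
proof
  assume fy: "f y = y"
  have "f ` (S - {y}) \<subseteq> S - {y}"
  proof
    fix v assume "v \<in> f ` (S - {y})"
    then obtain t where t: "t \<in> S" "t \<noteq> y" "v = f t" by auto
    then have "v \<in> S" using assms(1) by (auto intro: orbit.intros)
    moreover have "v \<noteq> y" using t fy assms(2,3) by (metis inj_onD)
    ultimately show "v \<in> S - {y}" by simp
  qed
  then have "{y} = {} \<or> {y} = S"
    using orbit_invariant[of "{y}" f x] fy assms(1,3) by simp
  then show False using assms(4,5) by auto
qed

lemma orbit_pair:
  assumes "{d, e} = orbit f x" "inj_on f {d, e}" "d \<noteq> e"
  shows "f d = e" "f e = d"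
proof -
  have "d \<in> orbit f x" "e \<in> orbit f x" unfolding assms(1)[symmetric] by simp_all
  then have "f d \<in> {d, e}" "f e \<in> {d, e}" unfolding assms(1) by (blast intro: orbit.step)+
  moreover have "f d \<noteq> d" "f e \<noteq> e"
    using orbit_no_fixpoint[OF assms(1,2), of d e] orbit_no_fixpoint[OF assms(1,2), of e d] assms(3) by simp_all
  ultimately show "f d = e" "f e = d" by blast+
qed

text \<open>An injective map without fixed points on three points is one of the two 3-cycles; they
  are the two orders in which the named strands can follow each other around the face.\<close>

lemma orbit_triple:
  assumes "{d, e, g} = orbit f x" "inj_on f {d, e, g}" "d \<noteq> e" "d \<noteq> g" "e \<noteq> g"
  shows "f d = e \<and> f e = g \<and> f g = d \<or> f d = g \<and> f g = e \<and> f e = d"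
proof -
  have "d \<in> orbit f x" "e \<in> orbit f x" "g \<in> orbit f x" unfolding assms(1)[symmetric] by simp_all
  then have m: "f d \<in> {d, e, g}" "f e \<in> {d, e, g}" "f g \<in> {d, e, g}"
    unfolding assms(1) by (blast intro: orbit.step)+
  have "f d \<noteq> d" "f e \<noteq> e" "f g \<noteq> g"
    using orbit_no_fixpoint[OF assms(1,2), of d e] orbit_no_fixpoint[OF assms(1,2), of e d]
      orbit_no_fixpoint[OF assms(1,2), of g d] assms(3-5) by simp_all
  moreover have "f d \<noteq> f e" "f d \<noteq> f g" "f e \<noteq> f g"
    using inj_onD[OF assms(2), of d e] inj_onD[OF assms(2), of d g] inj_onD[OF assms(2), of e g] assms(3-5)
    by blast+
  moreover have "f d = d \<or> f d = e \<or> f d = g" "f e = d \<or> f e = e \<or> f e = g" "f g = d \<or> f g = e \<or> f g = g"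
    using m by blast+
  ultimately show ?thesis by metis
qed

text \<open>
  A side of a face runs along the edge between two consecutive passages \<open>x\<close>, \<open>y\<close>, forwards or
  backwards.
\<close>

definition dart_of :: "bool \<Rightarrow> passage \<Rightarrow> passage \<Rightarrow> dart" where
  "dart_of s x y = (if s then (y, True) else (x, False))"

definition start_of :: "bool \<Rightarrow> passage \<Rightarrow> passage \<Rightarrow> passage" where
  "start_of s x y = (if s then x else y)"

definition end_of :: "bool \<Rightarrow> passage \<Rightarrow> passage \<Rightarrow> passage" where
  "end_of s x y = (if s then y else x)"

lemma edge_darts_dart_of: "d \<in> edge_darts x y \<Longrightarrow> \<exists>s. d = dart_of s x y"
  unfolding edge_darts_def dart_of_def by (metis empty_iff insert_iff)

definition consecutive :: "circ \<Rightarrow> passage \<Rightarrow> passage \<Rightarrow> bool" where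
  "consecutive w x y \<longleftrightarrow> x \<in> set w \<and> y \<in> set w \<and> nxt w x = y \<and> prv w y = x"

lemma consecutiveI: "distinct w \<Longrightarrow> w = u @ [x, y] @ v \<Longrightarrow> consecutive w x y"
  using nxt_consecutive[of u x y v] by (simp add: consecutive_def)

text \<open>A left turn passes to the other strand of the vertex. The direction relative to the
  circle is kept at a left passage and reversed at a right one.\<close>

lemma face_corner:
  assumes "paired w" "consecutive w x y" "consecutive w x' y'"
    and "face_next w (dart_of s x y) = dart_of s' x' y'"
  shows "mate (end_of s x y) = start_of s' x' y'"
    "s' \<longleftrightarrow> ((side (end_of s x y) = Lft) = s)"
proof -
  let ?p = "end_of s x y"
  have dart: "dart_of s x y = (?p, s)" by (simp add: dart_of_def end_of_def)
  have m: "mate ?p \<in> set w"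
    using assms(2) paired_mate_iff[OF assms(1)] by (simp add: consecutive_def end_of_def)
  note np = nxt_prv[OF paired_distinct[OF assms(1)] m]
  have f: "face_next w (dart_of s x y) =
      (if (side ?p = Lft) = s then (nxt w (mate ?p), True) else (prv w (mate ?p), False))"
    unfolding dart by (simp add: face_next_def)
  show s': "s' \<longleftrightarrow> ((side ?p = Lft) = s)"
    using assms(4) unfolding f by (auto simp: dart_of_def split: if_splits)
  show "mate ?p = start_of s' x' y'"
  proof (cases s')
    case True
    then have "nxt w (mate ?p) = y'" using assms(4) s' unfolding f by (simp add: dart_of_def)
    then show ?thesis using np(1) assms(3) True by (simp add: consecutive_def start_of_def)
  next
    case False
    then have "prv w (mate ?p) = x'" using assms(4) s' unfolding f by (simp add: dart_of_def)
    then show ?thesis using np(2) assms(3) False by (simp add: consecutive_def start_of_def)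
  qed
qed

lemma dart_of_mem: "consecutive w x y \<Longrightarrow> dart_of s x y \<in> set w \<times> UNIV"
  by (simp add: consecutive_def dart_of_def)

lemma dart_of_neq: "{x, y} \<inter> {x', y'} = {} \<Longrightarrow> dart_of s x y \<noteq> dart_of s' x' y'"
  by (auto simp: dart_of_def)

lemma strand_start_end:
  "[x, y] = strand (\<not> s) (end_of s x y) (start_of s x y)"
  "[x, y] = strand s (start_of s x y) (end_of s x y)"
  by (cases s; simp add: strand_def end_of_def start_of_def)+

text \<open>Going once round the face, the direction is reversed an even number of times, so both
  edges end at passages of the same side. One of these is the mate of the other passage on the first
  strand, which gives the opposite sides.\<close>

lemma bigon_normal:
  assumes "paired w" "consecutive w a1 a2" "consecutive w b1 b2" "{a1, a2} \<inter> {b1, b2} = {}"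
    and "bigon w (a1, a2) (b1, b2)"
  shows "\<exists>s. [b1, b2] = strand s (mate a1) (mate a2)" "side a2 \<noteq> side a1"
proof -
  have "\<exists>d\<in>edge_darts a1 a2. \<exists>e\<in>edge_darts b1 b2. {d, e} \<in> faces w"
    using assms(5) by (simp only: bigon_def prod.case)
  then obtain d e x where de: "d \<in> edge_darts a1 a2" "e \<in> edge_darts b1 b2" "{d, e} = orbit (face_next w) x"
    unfolding faces_def by blast
  obtain s t where st: "d = dart_of s a1 a2" "e = dart_of t b1 b2"
    using edge_darts_dart_of[OF de(1)] edge_darts_dart_of[OF de(2)] by blast
  have ne: "d \<noteq> e" unfolding st by (rule dart_of_neq[OF assms(4)])
  have "{d, e} \<subseteq> set w \<times> UNIV"
    unfolding st by (simp only: insert_subset dart_of_mem[OF assms(2)] dart_of_mem[OF assms(3)]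
        empty_subsetI simp_thms)
  then have inj: "inj_on (face_next w) {d, e}" by (rule inj_on_subset[OF face_next_inj[OF assms(1)]])
  note o = orbit_pair[OF de(3) inj ne, unfolded st]
  note c1 = face_corner[OF assms(1,2,3) o(1)] and c2 = face_corner[OF assms(1,3,2) o(2)]
  have st': "start_of t b1 b2 = mate (end_of s a1 a2)" using c1(1) by (rule sym)
  have en: "end_of t b1 b2 = mate (start_of s a1 a2)"
    by (simp only: c2(1)[symmetric] mate_simps(4))
  have "[b1, b2] = strand t (mate (end_of s a1 a2)) (mate (start_of s a1 a2))"
    using strand_start_end(2)[of b1 b2 t] unfolding st' en .
  also have "\<dots> = strand (s \<noteq> t) (mate a1) (mate a2)"
    by (cases s; cases t) (simp_all add: start_of_def end_of_def strand_def)
  finally have "[b1, b2] = strand (s \<noteq> t) (mate a1) (mate a2)" .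
  then show "\<exists>s. [b1, b2] = strand s (mate a1) (mate a2)" by blast
  have opp: "side (end_of t b1 b2) = opp_side (side (start_of s a1 a2))"
    unfolding en by simp
  have "side (end_of s a1 a2) \<noteq> side (start_of s a1 a2)"
  proof
    assume "side (end_of s a1 a2) = side (start_of s a1 a2)"
    moreover have "opp_side x = Lft \<longleftrightarrow> x \<noteq> Lft" for x by (cases x) simp_all
    ultimately show False using c1(2) c2(2) opp by metis
  qed
  then show "side a2 \<noteq> side a1" by (cases s) (auto simp: start_of_def end_of_def)
qed

definition sd :: "passage \<Rightarrow> int" where
  "sd p = (if side p = Lft then 1 else -1)"

lemma sd_mate: "sd (mate p) = - sd p"
  by (cases "side p") (simp_all add: sd_def)

text \<open>By \<open>face_corner\<close>, \<open>sd\<close> at the end of a side of the face is the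
  product of the direction signs of this side and the next. Multiplying by one of the directions
  leaves the other, which yields the three relations.\<close>

lemma triangle_normal:
  assumes "paired w" "consecutive w a1 a2" "consecutive w b1 b2" "consecutive w c1 c2"
    and dis: "{a1, a2} \<inter> {b1, b2} = {}" "{a1, a2} \<inter> {c1, c2} = {}" "{b1, b2} \<inter> {c1, c2} = {}"
    and "triangle w (a1, a2) (b1, b2) (c1, c2)"
  obtains s1 s2 s3 a b c where "[a1, a2] = strand s1 a (mate c)" "[b1, b2] = strand s2 b (mate a)"
    "[c1, c2] = strand s3 c (mate b)"
    "sg s1 * sd c = sg s2 * sd b" "sg s2 * sd a = sg s3 * sd c" "sg s3 * sd b = sg s1 * sd a"
proof -
  have "\<exists>d\<in>edge_darts a1 a2. \<exists>e\<in>edge_darts b1 b2. \<exists>g\<in>edge_darts c1 c2. {d, e, g} \<in> faces w"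
    using assms(8) by (simp only: triangle_def prod.case)
  then obtain d e g x where de: "d \<in> edge_darts a1 a2" "e \<in> edge_darts b1 b2" "g \<in> edge_darts c1 c2"
    "{d, e, g} = orbit (face_next w) x"
    unfolding faces_def by blast
  obtain s t r where st: "d = dart_of s a1 a2" "e = dart_of t b1 b2" "g = dart_of r c1 c2"
    using edge_darts_dart_of[OF de(1)] edge_darts_dart_of[OF de(2)] edge_darts_dart_of[OF de(3)] by blast
  have ne: "d \<noteq> e" "d \<noteq> g" "e \<noteq> g" unfolding st by (rule dart_of_neq, rule dis)+
  have "{d, e, g} \<subseteq> set w \<times> UNIV"
    unfolding st by (simp only: insert_subset dart_of_mem[OF assms(2)] dart_of_mem[OF assms(3)]
        dart_of_mem[OF assms(4)] empty_subsetI simp_thms)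
  then have inj: "inj_on (face_next w) {d, e, g}" by (rule inj_on_subset[OF face_next_inj[OF assms(1)]])
  have sd: "sd p = sg s * sg s'" if "s' \<longleftrightarrow> ((side p = Lft) = s)" for p s s'
    using that by (cases "side p"; cases s) (simp_all add: sd_def)
  have sg2: "sg s * (sg s * y) = y" "sg s * (y * sg s) = y" for s y by (cases s; simp)+
  from orbit_triple[OF de(4) inj ne]
  consider "face_next w d = e" "face_next w e = g" "face_next w g = d"
    | "face_next w d = g" "face_next w g = e" "face_next w e = d" by blast
  then show ?thesis
  proof cases
    case 1
    note c1 = face_corner[OF assms(1,2,3) 1(1)[unfolded st]]
      and c2 = face_corner[OF assms(1,3,4) 1(2)[unfolded st]]
      and c3 = face_corner[OF assms(1,4,2) 1(3)[unfolded st]]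
    have sg_not: "sg (\<not> s) = - sg s" for s by (cases s) simp_all
    \<comment> \<open>In this order each side ends at its crossing with the following strand, so end
      passages are chosen and the flags are negated. In the other order start passages take their
      place and the flags are the directions themselves.\<close>
    show ?thesis
      by (rule that[of "\<not> s" "end_of s a1 a2" "end_of r c1 c2" "\<not> t" "end_of t b1 b2" "\<not> r"])
        (simp_all only: c1(1) c2(1) c3(1) strand_start_end(1)[symmetric] sg_not
          sd[OF c1(2)] sd[OF c2(2)] sd[OF c3(2)] sg2 mult_minus_left)
  next
    case 2
    note c1 = face_corner[OF assms(1,2,4) 2(1)[unfolded st]]
      and c2 = face_corner[OF assms(1,4,3) 2(2)[unfolded st]]
      and c3 = face_corner[OF assms(1,3,2) 2(3)[unfolded st]]
    have m: "mate (start_of s a1 a2) = end_of t b1 b2" "mate (start_of t b1 b2) = end_of r c1 c2"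
      "mate (start_of r c1 c2) = end_of s a1 a2"
      by (simp_all only: c1(1)[symmetric] c2(1)[symmetric] c3(1)[symmetric] mate_simps(4))
    have s: "sd (start_of s a1 a2) = - (sg t * sg s)" "sd (start_of t b1 b2) = - (sg r * sg t)"
      "sd (start_of r c1 c2) = - (sg s * sg r)"
      using sd[OF c1(2)] sd[OF c2(2)] sd[OF c3(2)] sd_mate[of "start_of s a1 a2"]
        sd_mate[of "start_of t b1 b2"] sd_mate[of "start_of r c1 c2"] unfolding m by simp_all
    show ?thesis
      by (rule that[of s "start_of s a1 a2" "start_of r c1 c2" t "start_of t b1 b2" r])
        (simp_all only: m strand_start_end(2)[symmetric] s sg2 mult_minus_right)
  qed
qed

section \<open>Invariance\<close>

text \<open>The share of one crossing: \<open>s\<close> is its sign, \<open>i\<close> its index,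
  \<open>N\<close> and \<open>a\<close> are the values of \<nabla>J_n on the diagram and on the
  type-1 smoothing, and \<open>b\<close> is the flat span.\<close>

definition contr :: "int \<Rightarrow> int \<Rightarrow> int \<Rightarrow> int \<Rightarrow> int \<Rightarrow> (int \<times> int \<times> int) \<Rightarrow>\<^sub>0 int" where
  "contr N s i a b = Poly_Mapping.single (i, a, b) s
     - (if a \<in> {N, - N} \<and> b = 0 then Poly_Mapping.single (0, a, b) s else Poly_Mapping.single (0, N, b) s)"

lemma contr_minus: "contr N (- s) i a b = - contr N s i a b"
  by (simp add: contr_def single_uminus)

text \<open>The divisions by 2 are exact on four-regular words, by
  \<open>nabla_J_NN\<close>.\<close>

definition term_of ::
  "convention \<Rightarrow> convention \<Rightarrow> int \<Rightarrow> int \<Rightarrow> int \<Rightarrow> circ \<Rightarrow> passage \<Rightarrow> (int \<times> int \<times> int) \<Rightarrow>\<^sub>0 int" where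
  "term_of \<kappa>\<^sub>1 \<kappa>\<^sub>2 n k m w p = contr (NN n wt w div 2) (wt p) (idx w p)
     (NN n wt (sm w (kept \<kappa>\<^sub>1 p)) div 2) (- BB k m w (kept \<kappa>\<^sub>2 p))"

text \<open>The polynomial of the theorem, as a sum over the over passages.\<close>

definition FT ::
  "convention \<Rightarrow> convention \<Rightarrow> int \<Rightarrow> int \<Rightarrow> int \<Rightarrow> circ \<Rightarrow> (int \<times> int \<times> int) \<Rightarrow>\<^sub>0 int" where
  "FT \<kappa>\<^sub>1 \<kappa>\<^sub>2 n k m w = (\<Sum>p\<in>overs w. term_of \<kappa>\<^sub>1 \<kappa>\<^sub>2 n k m w p)"

lemma sum_filter_split:
  fixes A :: "'a \<Rightarrow> 'b::ab_group_add"
  assumes "finite C"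
  shows "sum A C - sum B {c \<in> C. P c} - sum D (C - {c \<in> C. P c})
    = (\<Sum>c\<in>C. A c - (if P c then B c else D c))"
proof -
  have "C - {c \<in> C. P c} = {c \<in> C. \<not> P c}" by auto
  moreover have "(\<Sum>c\<in>C. if P c then B c else D c) = sum B {c \<in> C. P c} + sum D {c \<in> C. \<not> P c}"
    using assms by (simp add: sum.If_cases Int_def)
  ultimately show ?thesis by (simp add: sum_subtractf)
qed

lemma F_tilde_FT:
  assumes "four_regular D"
  shows "F_tilde \<kappa>\<^sub>1 \<kappa>\<^sub>2 \<kappa>\<^sub>3 n k m D = FT \<kappa>\<^sub>1 \<kappa>\<^sub>2 n k m D"
proof -
  let ?a = "\<lambda>c. nabla_J n (smooth1 \<kappa>\<^sub>1 D c)" and ?b = "\<lambda>c. fspan \<kappa>\<^sub>3 k m (smooth2 \<kappa>\<^sub>2 D c)"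
  have fin: "finite (crossings D)" using crossings_overs(1)[OF assms] by simp
  have "F_tilde \<kappa>\<^sub>1 \<kappa>\<^sub>2 \<kappa>\<^sub>3 n k m D
      = (\<Sum>c\<in>crossings D. contr (nabla_J n D) (crossing_sgn D c) (Ind D c) (?a c) (?b c))"
    unfolding F_tilde_def T_tilde_def sum_filter_split[OF fin] contr_def by (rule refl)
  also have "\<dots> = FT \<kappa>\<^sub>1 \<kappa>\<^sub>2 n k m D"
    unfolding sum_crossings[OF assms] FT_def term_of_def
  proof (intro sum.cong refl)
    fix p assume p: "p \<in> overs D"
    have "nabla_J n D = NN n wt D div 2" using nabla_J_NN[OF assms, of n] by simp
    moreover have "?a (vert p) = NN n wt (sm D (kept \<kappa>\<^sub>1 p)) div 2"
      using nabla_J_smooth1[OF assms p, of n \<kappa>\<^sub>1] by simp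
    ultimately show "contr (nabla_J n D) (crossing_sgn D (vert p)) (Ind D (vert p)) (?a (vert p)) (?b (vert p))
        = contr (NN n wt D div 2) (wt p) (idx D p) (NN n wt (sm D (kept \<kappa>\<^sub>1 p)) div 2) (- BB k m D (kept \<kappa>\<^sub>2 p))"
      by (simp only: crossing_sgn_over[OF assms p] Ind_over[OF assms p] fspan_BB[OF assms p])
  qed
  finally show ?thesis .
qed

lemma term_of_transfer:
  assumes "\<And>n. NN n wt w' = NN n wt w" "wt p' = wt p"
    "\<And>\<kappa>. data_eq w' (kept \<kappa> p') w (kept \<kappa> p)" "data_eq w' p' w p"
  shows "term_of \<kappa>\<^sub>1 \<kappa>\<^sub>2 n k m w' p' = term_of \<kappa>\<^sub>1 \<kappa>\<^sub>2 n k m w p"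
  using assms(1,2,4) assms(3)[of \<kappa>\<^sub>1] assms(3)[of \<kappa>\<^sub>2] by (simp add: term_of_def data_eq_def)

lemma FT_transfer:
  assumes "\<And>n. NN n wt w' = NN n wt w" "set w' = h ` set w" "inj_on h (set w)"
    and h: "\<And>p. p \<in> set w \<Longrightarrow> level (h p) = level p \<and> wt (h p) = wt p \<and> mate (h p) = h (mate p)"
    and "paired w" and data: "\<And>p. p \<in> set w \<Longrightarrow> level p \<noteq> Virt \<Longrightarrow> data_eq w' (h p) w p"
  shows "FT \<kappa>\<^sub>1 \<kappa>\<^sub>2 n k m w' = FT \<kappa>\<^sub>1 \<kappa>\<^sub>2 n k m w"
proof -
  have o: "overs w' = h ` overs w" using assms(2) h by (auto simp: overs_def)
  have "inj_on h (overs w)" by (rule inj_on_subset[OF assms(3)]) (auto simp: overs_def)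
  then have "FT \<kappa>\<^sub>1 \<kappa>\<^sub>2 n k m w' = (\<Sum>p\<in>overs w. term_of \<kappa>\<^sub>1 \<kappa>\<^sub>2 n k m w' (h p))"
    unfolding FT_def o by (simp add: sum.reindex)
  also have "\<dots> = FT \<kappa>\<^sub>1 \<kappa>\<^sub>2 n k m w"
    unfolding FT_def
  proof (intro sum.cong refl term_of_transfer)
    fix p \<kappa> assume "p \<in> overs w"
    then have p: "p \<in> set w" "level p \<noteq> Virt" "mate p \<in> set w" "level (mate p) \<noteq> Virt"
      using paired_mate_iff[OF assms(5)] by (auto simp: overs_def)
    show "wt (h p) = wt p" using h[OF p(1)] by blast
    show "data_eq w' (h p) w p" by (rule data[OF p(1,2)])
    have "kept \<kappa> (h p) = h (kept \<kappa> p)" using h[OF p(1)] by (simp add: kept_def)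
    then show "data_eq w' (kept \<kappa> (h p)) w (kept \<kappa> p)"
      using kept_cases[of \<kappa> p] data[OF p(1,2)] data[OF p(3,4)] by auto
  qed (rule assms(1))
  finally show ?thesis .
qed

subsection \<open>Virtual crossings\<close>

text \<open>Virtual passages weigh nothing in arc sums and in sums over passages, so all data of
  classical passages can be read off from the word without them. This disposes of every move with
  virtual crossings at once.\<close>

definition core :: "circ \<Rightarrow> circ" where
  "core w = filter (\<lambda>p. level p \<noteq> Virt) w"

lemma core_append [simp]: "core (u @ v) = core u @ core v"
  by (simp add: core_def)

lemma set_core: "set (core w) = {p \<in> set w. level p \<noteq> Virt}"
  by (auto simp: core_def)

lemma sum_list_core: "sum_list (map wt (core xs)) = sum_list (map wt xs)"
  unfolding core_def by (rule sum_list_map_filter) (simp add: wt_def)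

lemma arc_core:
  "paired w \<Longrightarrow> p \<in> set w \<Longrightarrow> level p \<noteq> Virt \<Longrightarrow> arc (core w) p = core (arc w p)"
  unfolding core_def by (rule arc_filter) (auto simp: paired_def)

lemma four_regular_core: "four_regular w \<Longrightarrow> four_regular (core w)"
  unfolding core_def by (rule four_regular_filter) auto

lemma NN_core:
  assumes "paired w"
  shows "NN n wt (core w) = NN n wt w"
proof -
  have "NN n wt (core w) = (\<Sum>p\<in>set (core w). wt p * delta n (sum_list (map wt (arc w p))))"
    unfolding NN_def
    by (intro sum.cong refl) (simp add: set_core arc_core[OF assms] sum_list_core)
  also have "\<dots> = NN n wt w"
    unfolding NN_def by (rule sum.mono_neutral_left) (auto simp: set_core wt_def)
  finally show ?thesis .
qed

lemma core_map: "(\<And>p. level (h p) = level p) \<Longrightarrow> core (map h xs) = map h (core xs)"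
  by (simp add: core_def filter_map comp_def)

lemma core_rev: "core (rev xs) = rev (core xs)"
  by (simp add: core_def rev_filter)

lemma sm_core:
  assumes "paired w" "p \<in> set w" "level p \<noteq> Virt"
  shows "sm (core w) p = core (sm w p)"
proof -
  let ?X = "arc w p" and ?Y = "arc w (mate p)"
  have m: "mate p \<in> set w" "level (mate p) \<noteq> Virt" using assms paired_mate_iff by auto
  have "core (sm w p) = map (reorient (set ?Y)) (core ?X @ rev (core ?Y))"
    by (simp add: sm_def reverse_join_def core_map core_rev)
  also have "\<dots> = map (reorient (set (core ?Y))) (core ?X @ rev (core ?Y))"
    by (intro map_cong refl) (auto simp: reorient_def set_core)
  finally show ?thesis
    by (simp add: sm_def reverse_join_def arc_core[OF assms] arc_core[OF assms(1) m])
qed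

lemma chords_core:
  assumes "paired w" "p \<in> set w" "level p \<noteq> Virt"
  shows "chords (core w) p = {q \<in> chords w p. level q \<noteq> Virt}"
proof -
  have m: "mate p \<in> set w" "level (mate p) \<noteq> Virt" using assms paired_mate_iff by auto
  show ?thesis
    by (auto simp: chords_def arc_core[OF assms] arc_core[OF assms(1) m] set_core)
qed

lemma dbl_core:
  assumes "paired w" "p \<in> set w" "level p \<noteq> Virt" "q \<in> chords w p" "level q \<noteq> Virt"
  shows "dbl (core w) p q = core (dbl w p q)"
proof -
  have m: "mate p \<in> set w" "level (mate p) \<noteq> Virt" using assms paired_mate_iff by auto
  have d: "distinct (arc w p)" "distinct (arc w (mate p))"
    using paired_split_facts(2)[OF assms(1,2)] by auto
  have q: "q \<in> set (arc w p)" "mate q \<in> set (arc w (mate p))" using assms(4) by (auto simp: chords_def)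
  show ?thesis
    unfolding dbl_def arc_core[OF assms(1-3)] arc_core[OF assms(1) m] core_append
    using after_filter[OF d(1) q(1), of "\<lambda>p. level p \<noteq> Virt"]
      after_filter[OF d(2) q(2), of "\<lambda>p. level p \<noteq> Virt"] assms(5)
    by (simp add: core_def)
qed

lemma data_eq_core:
  assumes "four_regular w" "p \<in> set w" "level p \<noteq> Virt"
  shows "data_eq (core w) p w p"
proof -
  have pw: "paired w" using four_regular_paired assms(1) .
  have "BB k m (core w) p = BB k m w p" for k m
  proof -
    have "BB k m (core w) p = (\<Sum>q\<in>{q \<in> chords w p. level q \<noteq> Virt}. wt q * hit m (NN k wt (dbl w p q)))"
      unfolding BB_def chords_core[OF pw assms(2,3)]
      using dbl_core[OF pw assms(2,3)] NN_core[OF paired_dbl(1)[OF pw assms(2)]]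
      by (intro sum.cong refl) simp
    also have "\<dots> = BB k m w p"
      unfolding BB_def by (rule sum.mono_neutral_left) (auto simp: chords_def wt_def)
    finally show ?thesis .
  qed
  moreover have "paired (sm w p)" using four_regular_sm[OF assms(1,2)] four_regular_paired by blast
  ultimately show ?thesis
    by (simp add: data_eq_def idx_def arc_core[OF pw assms(2,3)] sum_list_core
        sm_core[OF pw assms(2,3)] NN_core)
qed

lemma FT_core:
  assumes "four_regular w"
  shows "FT \<kappa>\<^sub>1 \<kappa>\<^sub>2 n k m (core w) = FT \<kappa>\<^sub>1 \<kappa>\<^sub>2 n k m w"
proof -
  have pw: "paired w" using four_regular_paired assms .
  have o: "overs (core w) = overs w" by (auto simp: overs_def set_core)
  have "term_of \<kappa>\<^sub>1 \<kappa>\<^sub>2 n k m (core w) p = term_of \<kappa>\<^sub>1 \<kappa>\<^sub>2 n k m w p" if "p \<in> overs w" for p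
  proof (rule term_of_transfer)
    have p: "p \<in> set w" "level p \<noteq> Virt" "mate p \<in> set w" "level (mate p) \<noteq> Virt"
      using that paired_mate_iff[OF pw] by (auto simp: overs_def)
    show "data_eq (core w) p w p" by (rule data_eq_core[OF assms p(1,2)])
    show "data_eq (core w) (kept \<kappa> p) w (kept \<kappa> p)" for \<kappa>
      using data_eq_core[OF assms p(1,2)] data_eq_core[OF assms p(3,4)] kept_cases[of \<kappa> p] by auto
  qed (simp_all add: NN_core[OF pw])
  then show ?thesis unfolding FT_def o by (rule sum.cong[OF refl])
qed

subsection \<open>Renaming and rotation\<close>

lemma rename_simps [simp]:
  "vert (rename f p) = f (vert p)" "side (rename f p) = side p" "level (rename f p) = level p"
  "wt (rename f p) = wt p" "mate (rename f p) = rename f (mate p)"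
  by (simp_all add: rename_def wt_def mate_def)

text \<open>Stated for all passages over the vertices of \<open>w\<close> instead of
  \<open>set w\<close>, since smoothings contain reoriented passages that need not occur in
  \<open>w\<close>.\<close>

lemma rename_inj_on:
  assumes "inj_on f (vertices w)"
  shows "inj_on (rename f) {p. vert p \<in> vertices w}"
proof (rule inj_onI)
  fix p q assume pq: "p \<in> {p. vert p \<in> vertices w}" "q \<in> {p. vert p \<in> vertices w}" "rename f p = rename f q"
  then have "vert p = vert q"
    using inj_onD[OF assms, of "vert p" "vert q"] rename_simps(1) by (metis mem_Collect_eq)
  moreover have "side p = side q" "level p = level q" using pq(3) rename_simps(2,3) by metis+
  ultimately show "p = q" by (simp add: passage.expand)
qed

lemma NN_rename:
  assumes "paired w" "inj_on (rename f) (set w)"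
  shows "NN n wt (map (rename f) w) = NN n wt w"
proof -
  have "wt \<circ> rename f = wt" by auto
  then show ?thesis using NN_map[OF assms, of n wt] by simp
qed

lemma data_eq_rename:
  assumes fr: "four_regular w" and f: "inj_on f (vertices w)" and p: "p \<in> set w"
  shows "data_eq (map (rename f) w) (rename f p) w p"
proof -
  let ?r = "rename f" and ?X = "arc w p" and ?Y = "arc w (mate p)" and ?V = "{p. vert p \<in> vertices w}"
  have pw: "paired w" using four_regular_paired fr .
  have m: "mate p \<in> set w" using p paired_mate_iff[OF pw] by simp
  have wV: "set w \<subseteq> ?V" by (auto simp: vertices_def)
  note injV = rename_inj_on[OF f]
  have inj: "inj_on ?r (set w)" by (rule inj_on_subset[OF injV wV])
  have a: "arc (map ?r w) (?r p) = map ?r ?X" "arc (map ?r w) (mate (?r p)) = map ?r ?Y"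
    using arc_map[OF pw p inj] arc_map[OF pw m inj] by simp_all
  have sub: "set ?X \<subseteq> set w" "set ?Y \<subseteq> set w" using paired_split_facts(1)[OF pw p] by auto
  have d: "distinct ?X" "distinct ?Y" using paired_split_facts(2)[OF pw p] by auto
  have mem: "?r q \<in> ?r ` A \<longleftrightarrow> q \<in> A" if "q \<in> set w" "A \<subseteq> set w" for q A
    using inj_on_image_mem_iff[OF inj that] .
  have idx: "idx (map ?r w) (?r p) = idx w p" by (simp add: idx_def a comp_def)
  have "sm (map ?r w) (?r p) = map ?r (sm w p)"
  proof -
    have "reorient (?r ` set ?Y) (?r q) = ?r (reorient (set ?Y) q)" if "q \<in> set w" for q
    proof -
      have "?r q \<in> ?r ` set ?Y \<longleftrightarrow> q \<in> set ?Y" by (rule mem[OF that sub(2)])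
      moreover have "mate (?r q) \<in> ?r ` set ?Y \<longleftrightarrow> mate q \<in> set ?Y"
        using mem[of "mate q" "set ?Y"] that paired_mate_iff[OF pw] sub(2) by simp
      ultimately show ?thesis by (simp add: reorient_def rename_def)
    qed
    then show ?thesis
      unfolding sm_def reverse_join_def a using sub by (auto simp: rev_map)
  qed
  moreover have "paired (sm w p)" using four_regular_sm[OF fr p] four_regular_paired by blast
  moreover have "inj_on ?r (set (sm w p))"
    by (rule inj_on_subset[OF injV]) (use sub wV in \<open>auto simp: sm_def reverse_join_def\<close>)
  ultimately have sm: "NN n wt (sm (map ?r w) (?r p)) = NN n wt (sm w p)" for n
    by (simp add: NN_rename)
  have ch: "chords (map ?r w) (?r p) = ?r ` chords w p"
  proof -
    have "chords (map ?r w) (?r p) = ?r ` {q \<in> set ?X. ?r (mate q) \<in> ?r ` set ?Y}"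
      using a unfolding chords_def by auto
    also have "{q \<in> set ?X. ?r (mate q) \<in> ?r ` set ?Y} = chords w p"
      unfolding chords_def
    proof (rule Collect_cong, rule conj_cong[OF refl])
      fix q assume "q \<in> set ?X"
      then have "mate q \<in> set w" using sub paired_mate_iff[OF pw] by auto
      then show "?r (mate q) \<in> ?r ` set ?Y \<longleftrightarrow> mate q \<in> set ?Y" by (rule mem[OF _ sub(2)])
    qed
    finally show ?thesis .
  qed
  have chw: "chords w p \<subseteq> set w" using sub by (auto simp: chords_def)
  have dbl: "NN k wt (dbl (map ?r w) (?r p) (?r q)) = NN k wt (dbl w p q)" if q: "q \<in> chords w p" for k q
  proof -
    have "q \<in> set ?X" "mate q \<in> set ?Y" using q by (auto simp: chords_def)
    then have "dbl (map ?r w) (?r p) (?r q) = map ?r (dbl w p q)"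
      unfolding dbl_def a using after_map[OF d(1) _ inj_on_subset[OF inj sub(1)], of q]
        after_map[OF d(2) _ inj_on_subset[OF inj sub(2)], of "mate q"] by simp
    moreover have "inj_on ?r (set (dbl w p q))"
      by (rule inj_on_subset[OF inj]) (unfold paired_dbl(2)[OF pw p q], blast)
    ultimately show ?thesis using NN_rename[OF paired_dbl(1)[OF pw p q]] by simp
  qed
  have "BB k m (map ?r w) (?r p) = BB k m w p" for k m
    unfolding BB_def ch using inj_on_subset[OF inj chw] dbl by (simp add: sum.reindex)
  then show ?thesis using idx sm by (simp add: data_eq_def)
qed

lemma FT_rename:
  assumes "four_regular w" "inj_on f (vertices w)"
  shows "FT \<kappa>\<^sub>1 \<kappa>\<^sub>2 n k m (map (rename f) w) = FT \<kappa>\<^sub>1 \<kappa>\<^sub>2 n k m w"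
proof (rule FT_transfer)
  have pw: "paired w" using four_regular_paired assms(1) .
  show "paired w" by (rule pw)
  show inj: "inj_on (rename f) (set w)"
    by (rule inj_on_subset[OF rename_inj_on[OF assms(2)]]) (auto simp: vertices_def)
  show "NN n wt (map (rename f) w) = NN n wt w" for n by (rule NN_rename[OF pw inj])
qed (use data_eq_rename[OF assms] in simp_all)

lemma FT_same:
  assumes "\<And>n. NN n wt w' = NN n wt w" "set w' = set w" "paired w" "\<And>p. p \<in> set w \<Longrightarrow> data_eq w' p w p"
  shows "FT \<kappa>\<^sub>1 \<kappa>\<^sub>2 n k m w' = FT \<kappa>\<^sub>1 \<kappa>\<^sub>2 n k m w"
  by (rule FT_transfer[where h = id]) (use assms in simp_all)

lemma FT_rotated:
  assumes "paired (u @ v)"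
  shows "FT \<kappa>\<^sub>1 \<kappa>\<^sub>2 n k m (v @ u) = FT \<kappa>\<^sub>1 \<kappa>\<^sub>2 n k m (u @ v)"
  using assms data_eq_rotated[OF assms] paired_distinct[OF assms]
  by (intro FT_same NN_rotated) auto

subsection \<open>Reidemeister moves\<close>

text \<open>This is what the set \<open>T\<close> is made for: a kink has index and flat span zero,
  its smoothing is the rest of the knot up to reversal, and its term is subtracted again.\<close>

lemma contr_kink: "a = N \<or> a = - N \<Longrightarrow> contr N s 0 a 0 = 0"
  by (auto simp: contr_def)

lemma FT_RI:
  assumes fr: "four_regular (u @ [z, mate z])" and z: "level z \<noteq> Virt"
  shows "FT \<kappa>\<^sub>1 \<kappa>\<^sub>2 n k m (u @ [z, mate z]) = FT \<kappa>\<^sub>1 \<kappa>\<^sub>2 n k m u"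
proof -
  let ?w = "u @ [z, mate z]"
  let ?t = "term_of \<kappa>\<^sub>1 \<kappa>\<^sub>2 n k m"
  have fru: "four_regular u" by (rule RI_four_regular[OF fr])
  have pw: "paired ?w" and pu: "paired u" using four_regular_paired fr fru by blast+
  note N = RI_NN[OF fr fru]
  have ev: "NN n wt u = 2 * nabla_J n u" using nabla_J_NN[OF fru] by simp
  have kink: "idx ?w q = 0 \<and> BB k m ?w q = 0 \<and> (NN n wt (sm ?w q) = NN n wt u \<or> NN n wt (sm ?w q) = - NN n wt u)"
    if "q \<in> {z, mate z}" for q
    using that RI_kink(1)[OF fr] RI_kink(2)[OF fr, of k m] RI_kink(3)[OF fr, of n] idx_mate[OF pw, of z] BB_mate[OF pw, of z k m]
      sm_mate[OF fr, of z n] by auto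
  have zero: "?t ?w q = 0" if q: "q \<in> {z, mate z}" for q
  proof -
    have kq: "kept \<kappa> q \<in> {z, mate z}" for \<kappa> using q kept_cases[of \<kappa> q] by auto
    show ?thesis unfolding term_of_def N
      using kink[OF q] kink[OF kq[of \<kappa>\<^sub>1]] kink[OF kq[of \<kappa>\<^sub>2]] ev by (auto intro!: contr_kink)
  qed
  have same: "?t ?w q = ?t u q" if q: "q \<in> overs u" for q
  proof (rule term_of_transfer)
    have qu: "q \<in> set u" "mate q \<in> set u"
      using q paired_mate_iff[OF pu] by (auto simp: overs_def)
    show "data_eq ?w q u q" by (rule RI_data[OF fr qu(1)])
    show "data_eq ?w (kept \<kappa> q) u (kept \<kappa> q)" for \<kappa>
      using kept_cases[of \<kappa> q] RI_data[OF fr qu(1)] RI_data[OF fr qu(2)] by auto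
  qed (simp_all add: N)
  have ov: "overs ?w = overs u \<union> (overs ?w \<inter> {z, mate z})" by (auto simp: overs_def)
  have "overs u \<inter> (overs ?w \<inter> {z, mate z}) = {}"
    using paired_distinct[OF pw] by (auto simp: overs_def)
  then have "FT \<kappa>\<^sub>1 \<kappa>\<^sub>2 n k m ?w = sum (?t ?w) (overs u) + sum (?t ?w) (overs ?w \<inter> {z, mate z})"
    unfolding FT_def by (subst ov) (rule sum.union_disjoint, simp_all)
  also have "sum (?t ?w) (overs ?w \<inter> {z, mate z}) = 0" by (rule sum.neutral) (use zero in blast)
  also have "sum (?t ?w) (overs u) = FT \<kappa>\<^sub>1 \<kappa>\<^sub>2 n k m u"
    unfolding FT_def by (rule sum.cong[OF refl same])
  finally show ?thesis by simp
qed

lemma FT_RII: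
  assumes fr: "four_regular w" and w: "w = bigon_word s a b u v" and wt: "wt b = - wt a"
    and l: "level a \<noteq> Virt" "level b = level a"
  shows "FT \<kappa>\<^sub>1 \<kappa>\<^sub>2 n k m w = FT \<kappa>\<^sub>1 \<kappa>\<^sub>2 n k m (u @ v)"
proof -
  let ?t = "term_of \<kappa>\<^sub>1 \<kappa>\<^sub>2 n k m"
  let ?E = "{a, b, mate a, mate b}"
  note d = RII_distinct[OF fr w wt]
  have pw: "paired w" using four_regular_paired fr .
  have fru: "four_regular (u @ v)" by (rule RII_four_regular[OF fr w wt])
  have pu: "paired (u @ v)" using four_regular_paired fru .
  note N = RII_NN[OF fr w wt]
  have same: "?t w q = ?t (u @ v) q" if q: "q \<in> overs (u @ v)" for q
  proof (rule term_of_transfer)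
    have qu: "q \<in> set (u @ v)" "mate q \<in> set (u @ v)"
      using q paired_mate_iff[OF pu] by (auto simp: overs_def)
    show "data_eq w q (u @ v) q" by (rule RII_data[OF fr w wt qu(1)])
    show "data_eq w (kept \<kappa> q) (u @ v) (kept \<kappa> q)" for \<kappa>
      using kept_cases[of \<kappa> q] RII_data[OF fr w wt qu(1)] RII_data[OF fr w wt qu(2)] by auto
  qed (simp_all add: N)
  have mem: "a \<in> set w" "b \<in> set w" using d(10) by auto
  have ab: "data_eq w a w b" by (rule RII_bigon[OF fr w wt])
  have abm: "data_eq w (mate a) w (mate b)" by (rule data_eq_mate[OF fr fr mem ab])
  have cancel: "?t w p + ?t w q = 0"
    if "p = a \<and> q = b \<or> p = mate a \<and> q = mate b" for p q
  proof -
    have e: "data_eq w p w q" "data_eq w (mate p) w (mate q)" using that ab abm by auto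
    \<comment> \<open>Equal levels ensure that every convention keeps corresponding passages at the
      two crossings.\<close>
    have lv: "level p = level q" "wt p = - wt q" using that l wt by auto
    then have "data_eq w (kept \<kappa> p) w (kept \<kappa> q)" for \<kappa> using e by (simp add: kept_def)
    then have "?t w p = contr (NN n wt w div 2) (- wt q) (idx w q)
        (NN n wt (sm w (kept \<kappa>\<^sub>1 q)) div 2) (- BB k m w (kept \<kappa>\<^sub>2 q))"
      unfolding term_of_def using e(1) lv(2) by (simp add: data_eq_def)
    then show ?thesis unfolding contr_minus by (simp add: term_of_def)
  qed
  have ovE: "overs w \<inter> ?E = (if level a = Over then {a, b} else {mate a, mate b})"
    using mem l paired_mate_iff[OF pw] by (cases "level a") (auto simp: overs_def)
  have zero: "sum (?t w) (overs w \<inter> ?E) = 0"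
    unfolding ovE using cancel[of a b] cancel[of "mate a" "mate b"] d(1) by simp
  have ov: "overs w = overs (u @ v) \<union> (overs w \<inter> ?E)" using d(10) by (auto simp: overs_def)
  have "overs (u @ v) \<inter> (overs w \<inter> ?E) = {}" using d(7) by (auto simp: overs_def)
  then have "FT \<kappa>\<^sub>1 \<kappa>\<^sub>2 n k m w = sum (?t w) (overs (u @ v)) + sum (?t w) (overs w \<inter> ?E)"
    unfolding FT_def by (subst ov) (rule sum.union_disjoint, simp_all)
  also have "sum (?t w) (overs (u @ v)) = FT \<kappa>\<^sub>1 \<kappa>\<^sub>2 n k m (u @ v)"
    unfolding FT_def by (rule sum.cong[OF refl same])
  finally show ?thesis unfolding zero by simp
qed

lemma FT_RIII:
  assumes fr: "four_regular w" "four_regular w'"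
    and w: "w = tri_word s1 s2 s3 a b c u v x"
    and w': "w' = tri_word (\<not> s1) (\<not> s2) (\<not> s3) a b c u v x"
    and wts: "tri_wts s1 s2 s3 a b c"
  shows "FT \<kappa>\<^sub>1 \<kappa>\<^sub>2 n k m w' = FT \<kappa>\<^sub>1 \<kappa>\<^sub>2 n k m w"
proof (rule FT_same)
  show "NN n wt w' = NN n wt w" for n using RIII_NN[OF fr w w' wts] by simp
  show "set w' = set w" unfolding w w' tri_word_set ..
  show "paired w" using four_regular_paired fr(1) .
  show "data_eq w' p w p" if "p \<in> set w" for p
    by (rule data_eq_sym[OF RIII_data[OF fr w w' wts that]])
qed

lemma virtual_strand: "level p = Virt \<or> level q = Virt \<Longrightarrow> core [p, q] = core [q, p]"
  by (auto simp: core_def)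

lemma strand_swap: "[p, q] = strand s y z \<Longrightarrow> [q, p] = strand (\<not> s) y z"
  by (cases s) (simp_all add: strand_def)

lemma strand_nonvirtual:
  "[p, q] = strand s y (mate z) \<Longrightarrow>
    level p \<noteq> Virt \<and> level q \<noteq> Virt \<longleftrightarrow> level y \<noteq> Virt \<and> level z \<noteq> Virt"
  by (cases s) (auto simp: strand_def)

lemma strand_virtual:
  "[p, q] = strand s y (mate z) \<Longrightarrow> level p = Virt \<and> level q = Virt \<longleftrightarrow> level y = Virt \<and> level z = Virt"
  by (cases s) (auto simp: strand_def)

lemma wt_sd: "level p \<noteq> Virt \<Longrightarrow> wt p = sd p"
  by (simp add: wt_def sd_def)

lemma triangle_word_normal:
  assumes pw: "paired w" and w: "w = u @ [a1, a2] @ v @ [b1, b2] @ x @ [c1, c2]"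
    and t: "triangle w (a1, a2) (b1, b2) (c1, c2)"
  obtains s1 s2 s3 a b c where "[a1, a2] = strand s1 a (mate c)" "[b1, b2] = strand s2 b (mate a)"
    "[c1, c2] = strand s3 c (mate b)"
    "sg s1 * sd c = sg s2 * sd b" "sg s2 * sd a = sg s3 * sd c" "sg s3 * sd b = sg s1 * sd a"
proof -
  have d: "distinct w" using paired_distinct[OF pw] .
  have c1: "consecutive w a1 a2" by (rule consecutiveI[OF d w])
  have c2: "consecutive w b1 b2"
    by (rule consecutiveI[OF d, of "u @ [a1, a2] @ v" _ _ "x @ [c1, c2]"]) (simp add: w)
  have c3: "consecutive w c1 c2"
    by (rule consecutiveI[OF d, of "u @ [a1, a2] @ v @ [b1, b2] @ x" _ _ "[]"]) (simp add: w)
  have dis: "{a1, a2} \<inter> {b1, b2} = {}" "{a1, a2} \<inter> {c1, c2} = {}" "{b1, b2} \<inter> {c1, c2} = {}"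
    using d unfolding w by auto
  show ?thesis by (rule triangle_normal[OF pw c1 c2 c3 dis t]) (rule that)
qed

lemma strand_levels:
  "[p, q] = strand s y z \<Longrightarrow> {level p, level q} = {level y, level z}"
  by (cases s) (auto simp: strand_def)

text \<open>A strand over both others and one under both others leave room for classical crossings
  only, so \<open>FT_RIII\<close> applies. A strand with two virtual crossings leaves at most one
  classical passage on every strand, and the exchange is invisible in \<open>core\<close>.\<close>

lemma FT_triangle:
  assumes fr: "four_regular w" "four_regular w'"
    and w: "w = u @ [a1, a2] @ v @ [b1, b2] @ x @ [c1, c2]"
    and w': "w' = u @ [a2, a1] @ v @ [b2, b1] @ x @ [c2, c1]"
    and t: "triangle w (a1, a2) (b1, b2) (c1, c2)"
    and l: "{(Over, Over), (Under, Under)} \<subseteq> {(level a1, level a2), (level b1, level b2), (level c1, level c2)}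
      \<or> (Virt, Virt) \<in> {(level a1, level a2), (level b1, level b2), (level c1, level c2)}"
  shows "FT \<kappa>\<^sub>1 \<kappa>\<^sub>2 n k m w' = FT \<kappa>\<^sub>1 \<kappa>\<^sub>2 n k m w"
proof -
  obtain s1 s2 s3 a b c where s: "[a1, a2] = strand s1 a (mate c)" "[b1, b2] = strand s2 b (mate a)"
    "[c1, c2] = strand s3 c (mate b)"
    and sd: "sg s1 * sd c = sg s2 * sd b" "sg s2 * sd a = sg s3 * sd c" "sg s3 * sd b = sg s1 * sd a"
    using triangle_word_normal[OF four_regular_paired[OF fr(1)] w t] .
  let ?na = "level a \<noteq> Virt" and ?nb = "level b \<noteq> Virt" and ?nc = "level c \<noteq> Virt"
  note nv = strand_nonvirtual[OF s(1)] strand_nonvirtual[OF s(2)] strand_nonvirtual[OF s(3)]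
  note av = strand_virtual[OF s(1)] strand_virtual[OF s(2)] strand_virtual[OF s(3)]
  from l show ?thesis
  proof
    assume "{(Over, Over), (Under, Under)} \<subseteq> {(level a1, level a2), (level b1, level b2), (level c1, level c2)}"
    then have "(level a1 = Over \<and> level a2 = Over \<or> level b1 = Over \<and> level b2 = Over
          \<or> level c1 = Over \<and> level c2 = Over)
        \<and> (level a1 = Under \<and> level a2 = Under \<or> level b1 = Under \<and> level b2 = Under
          \<or> level c1 = Under \<and> level c2 = Under)"
      by (simp add: eq_commute)
    then have "?na \<and> ?nb \<and> ?nc" using nv by (elim conjE disjE) simp_all
    then have wts: "tri_wts s1 s2 s3 a b c" using sd by (simp add: tri_wts_def wt_sd)
    let ?t = "tri_word s1 s2 s3 a b c v x u" and ?t' = "tri_word (\<not> s1) (\<not> s2) (\<not> s3) a b c v x u"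
    let ?r = "[a1, a2] @ v @ [b1, b2] @ x @ [c1, c2]" and ?r' = "[a2, a1] @ v @ [b2, b1] @ x @ [c2, c1]"
    have t: "?t = ?r @ u" "?t' = ?r' @ u"
      unfolding tri_word_def s strand_swap[OF s(1)] strand_swap[OF s(2)] strand_swap[OF s(3)] by simp_all
    have f: "four_regular ?t" "four_regular ?t'"
      unfolding t using fr four_regular_rotated[of u ?r] four_regular_rotated[of u ?r'] w w' by simp_all
    have "FT \<kappa>\<^sub>1 \<kappa>\<^sub>2 n k m ?t' = FT \<kappa>\<^sub>1 \<kappa>\<^sub>2 n k m ?t" by (rule FT_RIII[OF f refl refl wts])
    moreover have "FT \<kappa>\<^sub>1 \<kappa>\<^sub>2 n k m ?t = FT \<kappa>\<^sub>1 \<kappa>\<^sub>2 n k m w" "FT \<kappa>\<^sub>1 \<kappa>\<^sub>2 n k m ?t' = FT \<kappa>\<^sub>1 \<kappa>\<^sub>2 n k m w'"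
      unfolding t w w'
      using FT_rotated[OF four_regular_paired[OF fr(1)[unfolded w]]] FT_rotated[OF four_regular_paired[OF fr(2)[unfolded w']]]
      by blast+
    ultimately show ?thesis by simp
  next
    assume "(Virt, Virt) \<in> {(level a1, level a2), (level b1, level b2), (level c1, level c2)}"
    then have "level a1 = Virt \<and> level a2 = Virt \<or> level b1 = Virt \<and> level b2 = Virt
        \<or> level c1 = Virt \<and> level c2 = Virt" by (simp add: eq_commute)
    then have v: "level a1 = Virt \<or> level a2 = Virt" "level b1 = Virt \<or> level b2 = Virt"
      "level c1 = Virt \<or> level c2 = Virt" using av nv by blast+
    note e = virtual_strand[OF v(1)] virtual_strand[OF v(2)] virtual_strand[OF v(3)]
    have "core w' = core w" unfolding w w' core_append e ..
    then show ?thesis using FT_core[OF fr(1)] FT_core[OF fr(2)] by metis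
  qed
qed

lemma bigon_word_normal:
  assumes pw: "paired w" and w: "w = u @ [a1, a2] @ v @ [b1, b2]" and b: "bigon w (a1, a2) (b1, b2)"
  shows "\<exists>s. [b1, b2] = strand s (mate a1) (mate a2)" "side a2 \<noteq> side a1"
proof -
  have d: "distinct w" using paired_distinct[OF pw] .
  have c1: "consecutive w a1 a2" by (rule consecutiveI[OF d w])
  have c2: "consecutive w b1 b2"
    by (rule consecutiveI[OF d, of "u @ [a1, a2] @ v" _ _ "[]"]) (simp add: w)
  have dis: "{a1, a2} \<inter> {b1, b2} = {}" using d unfolding w by auto
  show "\<exists>s. [b1, b2] = strand s (mate a1) (mate a2)" "side a2 \<noteq> side a1"
    by (rule bigon_normal[OF pw c1 c2 dis b])+
qed

lemma FT_move:
  assumes "move w w'" "four_regular w" "four_regular w'"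
  shows "FT \<kappa>\<^sub>1 \<kappa>\<^sub>2 n k m w' = FT \<kappa>\<^sub>1 \<kappa>\<^sub>2 n k m w"
  using assms
proof cases
  case (Rotate j)
  let ?i = "j mod length w"
  have "paired (take ?i w @ drop ?i w)" using four_regular_paired[OF assms(2)] by simp
  from FT_rotated[OF this] show ?thesis using Rotate by (simp add: rotate_drop_take)
next
  case (Rename f)
  then show ?thesis using FT_rename[OF assms(2)] by simp
next
  case (RI p)
  then show ?thesis using FT_RI assms(3) by simp
next
  case (VRI p)
  then have "core w' = core w" by (simp add: core_def)
  then show ?thesis using FT_core[OF assms(2)] FT_core[OF assms(3)] by metis
next
  case (RII u a1 a2 v b1 b2)
  have pw: "paired w'" using four_regular_paired assms(3) .
  obtain s where s: "[b1, b2] = strand s (mate a1) (mate a2)" and sd: "side a2 \<noteq> side a1"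
    using bigon_word_normal[OF pw RII(2,3)] by blast
  have wt: "wt a2 = - wt a1" using sd RII(4,5) by (cases "side a1"; cases "side a2") (simp_all add: wt_def)
  let ?b = "bigon_word s a1 a2 v u"
  have b: "?b = ([a1, a2] @ v @ [b1, b2]) @ u" by (simp add: bigon_word_def s)
  have w': "w' = u @ ([a1, a2] @ v @ [b1, b2])" using RII(2) by simp
  have fb: "four_regular ?b" unfolding b using four_regular_rotated assms(3) unfolding w' by blast
  have "FT \<kappa>\<^sub>1 \<kappa>\<^sub>2 n k m ?b = FT \<kappa>\<^sub>1 \<kappa>\<^sub>2 n k m (v @ u)"
    by (rule FT_RII[OF fb refl wt RII(4,5)])
  moreover have "FT \<kappa>\<^sub>1 \<kappa>\<^sub>2 n k m ?b = FT \<kappa>\<^sub>1 \<kappa>\<^sub>2 n k m w'"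
    unfolding b w' by (rule FT_rotated[OF pw[unfolded w']])
  moreover have "FT \<kappa>\<^sub>1 \<kappa>\<^sub>2 n k m (v @ u) = FT \<kappa>\<^sub>1 \<kappa>\<^sub>2 n k m w"
    unfolding RII(1) by (rule FT_rotated[OF four_regular_paired[OF assms(2)[unfolded RII(1)]]])
  ultimately show ?thesis by simp
next
  case (VRII u a1 a2 v b1 b2)
  have pw: "paired w'" using four_regular_paired assms(3) .
  obtain s where s: "[b1, b2] = strand s (mate a1) (mate a2)"
    using bigon_word_normal[OF pw VRII(2,3)] by blast
  have "level b1 = Virt" "level b2 = Virt"
    using strand_levels[OF s] VRII(4,5) by auto
  then have "core w' = core w" using VRII by (simp add: core_def)
  then show ?thesis using FT_core[OF assms(2)] FT_core[OF assms(3)] by metis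
next
  case (RIII u a1 a2 v b1 b2 x c1 c2)
  show ?thesis by (rule FT_triangle[OF assms(2,3) RIII(2,1,3)]) (use RIII(4) in blast)
next
  case (VRIII u a1 a2 v b1 b2 x c1 c2)
  have "level a1 = Virt" "level a2 = Virt" using VRIII(4) by auto
  then show ?thesis by (intro FT_triangle[OF assms(2,3) VRIII(2,1,3)]) simp
next
  case (SV u a1 a2 v b1 b2 x c1 c2)
  show ?thesis by (rule FT_triangle[OF assms(2,3) SV(2,1,3)]) (use SV(4) in blast)
qed

lemma knot_diagram_four_regular: "knot_diagram w \<Longrightarrow> four_regular w"
  by (simp add: knot_diagram_def)

lemma FT_equivalent:
  assumes "equivalent w w'"
  shows "FT \<kappa>\<^sub>1 \<kappa>\<^sub>2 n k m w' = FT \<kappa>\<^sub>1 \<kappa>\<^sub>2 n k m w"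
  using assms unfolding equivalent_def
proof (induction rule: equivclp_induct)
  case (step y z)
  then have "FT \<kappa>\<^sub>1 \<kappa>\<^sub>2 n k m z = FT \<kappa>\<^sub>1 \<kappa>\<^sub>2 n k m y"
    using FT_move[of y z] FT_move[of z y] knot_diagram_four_regular by metis
  then show ?case using step.IH by simp
qed simp

lemma virtual_knotE:
  assumes "K \<in> virtual_knots"
  obtains w where "knot_diagram w" "w \<in> K"
    "\<And>D. D \<in> K \<longleftrightarrow> knot_diagram D \<and> equivalent w D"
proof -
  obtain w where w: "knot_diagram w"
    "K = {(w, w'). knot_diagram w \<and> knot_diagram w' \<and> equivalent w w'} `` {w}"
    using assms unfolding virtual_knots_def by (auto elim: quotientE)
  then have "D \<in> K \<longleftrightarrow> knot_diagram D \<and> equivalent w D" for D by auto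
  then show ?thesis using that w(1) by (simp add: equivalent_def)
qed

lemma F_tilde_invariant:
  assumes "K \<in> virtual_knots" "D \<in> K" "D' \<in> K"
  shows "F_tilde \<kappa>\<^sub>1 \<kappa>\<^sub>2 \<kappa>\<^sub>3 n k m D = F_tilde \<kappa>\<^sub>1 \<kappa>\<^sub>2 \<kappa>\<^sub>3 n k m D'"
proof -
  obtain w where w: "\<And>D. D \<in> K \<longleftrightarrow> knot_diagram D \<and> equivalent w D"
    using virtual_knotE[OF assms(1)] by metis
  then show ?thesis
    using F_tilde_FT[OF knot_diagram_four_regular] FT_equivalent assms(2,3) by metis
qed

section \<open>Comparison with the \<open>F\<close>-polynomials\<close>

lemma abs_sum_list_wt: "\<bar>sum_list (map wt xs)\<bar> \<le> int (length xs)"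
proof (induction xs)
  case (Cons p xs)
  have "\<bar>wt p\<bar> \<le> 1" by (simp add: wt_def)
  then show ?case using Cons by simp
qed simp

text \<open>No arc is long enough for its weights to add up to \<open>k\<close> or
  \<open>- k\<close>.\<close>

lemma NN_large:
  assumes "paired w" "int (length w) < k"
  shows "NN k wt w = 0"
  unfolding NN_def
proof (rule sum.neutral, rule ballI)
  fix p assume p: "p \<in> set w"
  have "length (arc w p) = card (set (arc w p))"
    using paired_split_facts(2)[OF assms(1) p] by (simp add: distinct_card)
  also have "\<dots> \<le> length w"
    using paired_split_facts(1)[OF assms(1) p] by (intro order_trans[OF card_mono card_length]) auto
  finally have "\<bar>sum_list (map wt (arc w p))\<bar> < k"
    using abs_sum_list_wt[of "arc w p"] assms(2) by simp
  then show "wt p * delta k (sum_list (map wt (arc w p))) = 0" by (auto simp: delta_def)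
qed

text \<open>\<nabla>J_k vanishes on all doubly smoothed curves and thus never equals \<plusminus>1.
  For \<open>m = 0\<close> every chord would count instead.\<close>

lemma fspan_large:
  assumes fr: "four_regular D" and k: "int (length D) < k" and c: "c \<in> crossings D"
  shows "fspan \<kappa>\<^sub>3 k 1 (smooth2 \<kappa>\<^sub>2 D c) = 0"
proof -
  have pw: "paired D" using four_regular_paired fr .
  obtain p where p: "p \<in> overs D" "c = vert p" using c crossings_overs(1)[OF fr] by auto
  have pin: "kept \<kappa>\<^sub>2 p \<in> set D" using kept_in(3)[OF fr p(1)] .
  have "NN k wt (dbl D (kept \<kappa>\<^sub>2 p) q) = 0" if q: "q \<in> chords D (kept \<kappa>\<^sub>2 p)" for q
  proof (rule NN_large)
    note d = paired_dbl[OF pw pin q]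
    show "paired (dbl D (kept \<kappa>\<^sub>2 p) q)" by (rule d(1))
    have "length (dbl D (kept \<kappa>\<^sub>2 p) q) = card (set (dbl D (kept \<kappa>\<^sub>2 p) q))"
      using paired_distinct[OF d(1)] by (simp add: distinct_card)
    also have "\<dots> \<le> length D"
      unfolding d(2) by (intro order_trans[OF card_mono card_length]) auto
    finally show "int (length (dbl D (kept \<kappa>\<^sub>2 p) q)) < k" using k by simp
  qed
  then have "BB k 1 D (kept \<kappa>\<^sub>2 p) = 0" unfolding BB_def by (simp add: hit_def)
  then show ?thesis using fspan_BB[OF fr p(1)] p(2) by simp
qed

lemma F_tilde_F_poly:
  assumes fr: "four_regular D" and 0: "\<And>c. c \<in> crossings D \<Longrightarrow> fspan \<kappa>\<^sub>3 k m (smooth2 \<kappa>\<^sub>2 D c) = 0"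
  shows "Poly_Mapping.lookup (F_tilde \<kappa>\<^sub>1 \<kappa>\<^sub>2 \<kappa>\<^sub>3 n k m D) (x, y, 0) = Poly_Mapping.lookup (F_poly \<kappa>\<^sub>1 n D) (x, y)"
proof -
  have fin: "finite (crossings D)" using crossings_overs(1)[OF fr] by simp
  show ?thesis
    unfolding F_tilde_def T_tilde_def F_poly_def T_set_def sum_filter_split[OF fin]
      Poly_Mapping.lookup_sum
    by (intro sum.cong refl) (simp add: 0 lookup_minus lookup_single when_def)
qed

lemma F_tilde_stronger:
  assumes K: "K \<in> virtual_knots" "K' \<in> virtual_knots" and d: "distinguishes (F_poly \<kappa>\<^sub>1 n) K K'"
  shows "\<exists>k m. k \<noteq> 0 \<and> distinguishes (F_tilde \<kappa>\<^sub>1 \<kappa>\<^sub>2 \<kappa>\<^sub>3 n k m) K K'"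
proof -
  obtain D where D: "knot_diagram D" "D \<in> K" using virtual_knotE[OF K(1)] by metis
  obtain D' where D': "knot_diagram D'" "D' \<in> K'" using virtual_knotE[OF K(2)] by metis
  \<comment> \<open>Exceeds both lengths, so that one \<open>k\<close> annihilates the flat spans of
    both diagrams.\<close>
  define k where "k = int (length D) + int (length D') + 1"
  have fr: "four_regular D" "four_regular D'" using D(1) D'(1) knot_diagram_four_regular by blast+
  have l: "Poly_Mapping.lookup (F_tilde \<kappa>\<^sub>1 \<kappa>\<^sub>2 \<kappa>\<^sub>3 n k 1 D) (x, y, 0) = Poly_Mapping.lookup (F_poly \<kappa>\<^sub>1 n D) (x, y)"
    "Poly_Mapping.lookup (F_tilde \<kappa>\<^sub>1 \<kappa>\<^sub>2 \<kappa>\<^sub>3 n k 1 D') (x, y, 0) = Poly_Mapping.lookup (F_poly \<kappa>\<^sub>1 n D') (x, y)" for x y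
  proof -
    have k: "int (length D) < k" "int (length D') < k" by (simp_all add: k_def)
    show "Poly_Mapping.lookup (F_tilde \<kappa>\<^sub>1 \<kappa>\<^sub>2 \<kappa>\<^sub>3 n k 1 D) (x, y, 0) = Poly_Mapping.lookup (F_poly \<kappa>\<^sub>1 n D) (x, y)"
      by (rule F_tilde_F_poly[OF fr(1) fspan_large[OF fr(1) k(1)]])
    show "Poly_Mapping.lookup (F_tilde \<kappa>\<^sub>1 \<kappa>\<^sub>2 \<kappa>\<^sub>3 n k 1 D') (x, y, 0) = Poly_Mapping.lookup (F_poly \<kappa>\<^sub>1 n D') (x, y)"
      by (rule F_tilde_F_poly[OF fr(2) fspan_large[OF fr(2) k(2)]])
  qed
  have "F_tilde \<kappa>\<^sub>1 \<kappa>\<^sub>2 \<kappa>\<^sub>3 n k 1 D \<noteq> F_tilde \<kappa>\<^sub>1 \<kappa>\<^sub>2 \<kappa>\<^sub>3 n k 1 D'"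
  proof
    assume e: "F_tilde \<kappa>\<^sub>1 \<kappa>\<^sub>2 \<kappa>\<^sub>3 n k 1 D = F_tilde \<kappa>\<^sub>1 \<kappa>\<^sub>2 \<kappa>\<^sub>3 n k 1 D'"
    have "F_poly \<kappa>\<^sub>1 n D = F_poly \<kappa>\<^sub>1 n D'"
    proof (rule poly_mapping_eqI)
      fix z show "Poly_Mapping.lookup (F_poly \<kappa>\<^sub>1 n D) z = Poly_Mapping.lookup (F_poly \<kappa>\<^sub>1 n D') z"
        using l[of "fst z" "snd z"] e by simp
    qed
    then show False using d D(2) D'(2) by (auto simp: distinguishes_def)
  qed
  \<comment> \<open>Invariance extends the inequality from the two chosen diagrams to all diagrams
    of the knots.\<close>
  then have "distinguishes (F_tilde \<kappa>\<^sub>1 \<kappa>\<^sub>2 \<kappa>\<^sub>3 n k 1) K K'"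
    using F_tilde_invariant[OF K(1) D(2)] F_tilde_invariant[OF K(2) D'(2)]
    unfolding distinguishes_def by metis
  moreover have "k \<noteq> 0" by (simp add: k_def)
  ultimately show ?thesis by blast
qed

section \<open>A knot that the \<open>F\<close>-polynomials do not detect\<close>

lemma orbit_cycle:
  assumes "map f xs = rotate1 xs" "y \<in> set xs"
  shows "orbit f y = set xs"
proof -
  obtain i where i: "i < length xs" "y = xs ! i" using assms(2) by (metis in_set_conv_nth)
  have step: "f (xs ! j) = xs ! (Suc j mod length xs)" if "j < length xs" for j
    using that arg_cong[OF assms(1), of "\<lambda>l. l ! j"] by (simp add: nth_rotate1)
  have pow: "(f ^^ n) y = xs ! ((i + n) mod length xs)" for n
  proof (induction n)
    case (Suc n)
    have "(i + n) mod length xs < length xs" using i(1) by (intro mod_less_divisor) auto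
    then show ?case using Suc step by (simp add: mod_Suc_eq)
  qed (use i in simp)
  show ?thesis
  proof
    show "orbit f y \<subseteq> set xs"
    proof
      fix z assume "z \<in> orbit f y"
      then obtain n where "z = (f ^^ n) y" by (auto simp: orbit_altdef)
      moreover have "(i + n) mod length xs < length xs" using i(1) by (intro mod_less_divisor) auto
      ultimately show "z \<in> set xs" using pow by (metis nth_mem)
    qed
    show "set xs \<subseteq> orbit f y"
    proof
      fix z assume "z \<in> set xs"
      then obtain j where j: "j < length xs" "z = xs ! j" by (metis in_set_conv_nth)
      let ?n = "j + length xs - i"
      have "0 < ?n" using i j by simp
      have "(i + ?n) mod length xs = j" using i j by simp
      then have "(f ^^ ?n) y = z" using pow[of ?n] j by simp
      then show "z \<in> orbit f y" unfolding orbit_altdef using \<open>0 < ?n\<close> by blast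
    qed
  qed
qed

text \<open>A partition of the darts into cycles of \<open>face_next\<close> serves as a certificate
  that can be checked by evaluation.\<close>

lemma card_faces:
  assumes "\<And>xs. xs \<in> set F \<Longrightarrow> map (face_next w) xs = rotate1 xs" "[] \<notin> set F"
    and "distinct (concat F)" "set (concat F) = set w \<times> UNIV"
  shows "card (faces w) = length F"
proof -
  have "faces w = set ` set F"
  proof
    show "faces w \<subseteq> set ` set F"
    proof
      fix S assume "S \<in> faces w"
      then obtain d where d: "S = orbit (face_next w) d" "d \<in> set (concat F)"
        unfolding faces_def assms(4) by auto
      then obtain xs where "xs \<in> set F" "d \<in> set xs" by auto
      then show "S \<in> set ` set F" using orbit_cycle[OF assms(1)] d(1) by blast
    qed
    show "set ` set F \<subseteq> faces w"
    proof
      fix S assume "S \<in> set ` set F"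
      then obtain xs where xs: "xs \<in> set F" "S = set xs" by auto
      then have "xs \<noteq> []" using assms(2) by auto
      then have d: "hd xs \<in> set xs" by simp
      then have "hd xs \<in> set w \<times> UNIV" unfolding assms(4)[symmetric] using xs(1) by auto
      then show "S \<in> faces w"
        unfolding faces_def using orbit_cycle[OF assms(1)[OF xs(1)] d] xs(2) by auto
    qed
  qed
  moreover have "inj_on set (set F)"
  proof (rule inj_onI)
    fix xs ys assume *: "xs \<in> set F" "ys \<in> set F" "set xs = set ys"
    show "xs = ys"
    proof (rule ccontr)
      assume "xs \<noteq> ys"
      then have "set xs \<inter> set ys = {}" using assms(3) *(1,2) unfolding distinct_concat_iff by blast
      moreover have "xs \<noteq> []" using *(1) assms(2) by auto
      ultimately show False using *(3) by auto
    qed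
  qed
  moreover have "distinct F"
    using assms(2,3) by (simp add: distinct_concat_iff removeAll_id)
  ultimately show ?thesis by (simp add: card_image distinct_card)
qed

section \<open>Evaluation of the example\<close>

lemma four_regular_check:
  "four_regular w \<longleftrightarrow> distinct w \<and>
     list_all (\<lambda>p. mate p \<in> set w \<and> list_all (\<lambda>q. vert q = vert p \<longrightarrow> q = p \<or> q = mate p) w) w"
  by (auto simp: four_regular_iff paired_def list_all_iff)

definition profile :: "circ \<Rightarrow> (int \<times> int) list" where
  "profile w = map (\<lambda>p. (wt p, idx w p)) w"

text \<open>Separates the word from \<open>n\<close>: a profile is computed by evaluation, and the
  remaining sum can be simplified for symbolic \<open>n\<close>.\<close>

lemma NN_profile:
  assumes "distinct w"
  shows "NN n wt w = sum_list (map (\<lambda>(s, i). s * delta n i) (profile w))"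
  using assms by (simp add: NN_def profile_def idx_def sum_list_distinct_conv_sum_set comp_def)

lemma delta_neg_numeral:
  "delta n (- 1) = - delta n 1" "delta n (- numeral k) = - delta n (numeral k)"
  by (rule delta_minus)+

text \<open>Vertices 0 to 4 are classical; 5, 6 and 7 are virtual and realise the cyclic word
  \<open>example_core\<close> in the sphere.\<close>

definition example :: circ where
  "example = [Pass 5 Rgt Virt, Pass 0 Rgt Over, Pass 6 Lft Virt, Pass 1 Rgt Over, Pass 2 Lft Under,
     Pass 6 Rgt Virt, Pass 0 Lft Under, Pass 7 Rgt Virt, Pass 3 Lft Over, Pass 5 Lft Virt,
     Pass 4 Rgt Under, Pass 3 Rgt Under, Pass 1 Lft Under, Pass 2 Rgt Over, Pass 7 Lft Virt,
     Pass 4 Lft Over]"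

text \<open>Ten boundaries for eight vertices, as Euler's formula demands.\<close>

definition example_faces :: "dart list list" where
  "example_faces =
    [[(Pass 5 Rgt Virt, True), (Pass 3 Lft Over, False), (Pass 4 Rgt Under, False)],
     [(Pass 5 Rgt Virt, False), (Pass 4 Rgt Under, True), (Pass 7 Lft Virt, False), (Pass 0 Lft Under, False)],
     [(Pass 0 Rgt Over, True), (Pass 6 Rgt Virt, False), (Pass 1 Rgt Over, True), (Pass 3 Rgt Under, False),
      (Pass 5 Lft Virt, True)],
     [(Pass 0 Rgt Over, False), (Pass 7 Rgt Virt, True), (Pass 2 Rgt Over, False), (Pass 6 Rgt Virt, True)],
     [(Pass 6 Lft Virt, True), (Pass 0 Lft Under, True)],
     [(Pass 6 Lft Virt, False), (Pass 2 Lft Under, False), (Pass 1 Lft Under, False)],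
     [(Pass 1 Rgt Over, False), (Pass 2 Rgt Over, True)],
     [(Pass 2 Lft Under, True), (Pass 7 Lft Virt, True), (Pass 3 Lft Over, True), (Pass 1 Lft Under, True)],
     [(Pass 7 Rgt Virt, False), (Pass 4 Lft Over, True), (Pass 3 Rgt Under, True)],
     [(Pass 5 Lft Virt, False), (Pass 4 Lft Over, False)]]"

lemma example_knot_diagram: "knot_diagram example"
proof -
  have "four_regular example" unfolding four_regular_check by code_simp
  moreover have "card (faces example) = length example_faces"
  proof (rule card_faces)
    have "list_all (\<lambda>xs. map (face_next example) xs = rotate1 xs) example_faces" by code_simp
    then show "xs \<in> set example_faces \<Longrightarrow> map (face_next example) xs = rotate1 xs" for xs
      by (auto simp: list_all_iff)
    show "[] \<notin> set example_faces" by (simp add: example_faces_def)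
    show "distinct (concat example_faces)" by code_simp
    have "set (concat example_faces) = set (List.product example [True, False])" by code_simp
    then show "set (concat example_faces) = set example \<times> UNIV" by (auto simp: UNIV_bool)
  qed
  moreover have "card (vertices example) = 8"
    by code_simp
  ultimately show ?thesis by (simp add: knot_diagram_def planar_def example_faces_def)
qed

definition example_core :: circ where
  "example_core = [Pass 0 Rgt Over, Pass 1 Rgt Over, Pass 2 Lft Under, Pass 0 Lft Under, Pass 3 Lft Over,
     Pass 4 Rgt Under, Pass 3 Rgt Under, Pass 1 Lft Under, Pass 2 Rgt Over, Pass 4 Lft Over]"

lemma core_example: "core example = example_core"
  by (simp add: core_def example_def example_core_def)

lemma example_four_regular: "four_regular example_core"
  unfolding core_example[symmetric]
  by (rule four_regular_core[OF knot_diagram_four_regular[OF example_knot_diagram]])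

lemma overs_example:
  "overs example_core = {Pass 0 Rgt Over, Pass 1 Rgt Over, Pass 2 Rgt Over, Pass 3 Lft Over, Pass 4 Lft Over}"
  by (auto simp: overs_def example_core_def)

lemma idx_example:
  "idx example_core (Pass 0 Rgt Over) = 0" "idx example_core (Pass 1 Rgt Over) = 1"
  "idx example_core (Pass 2 Rgt Over) = -1" "idx example_core (Pass 3 Lft Over) = -1"
  "idx example_core (Pass 4 Lft Over) = 1"
  by code_simp+

lemma NN_example: "NN n wt example_core = 0"
proof -
  have p: "profile example_core = [(-1, 0), (-1, 1), (1, 1), (1, 0), (1, -1), (-1, -1), (-1, 1), (1, -1),
      (-1, -1), (1, 1)]" by code_simp
  have "distinct example_core" by code_simp
  then show ?thesis by (simp add: NN_profile p delta_neg_numeral)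
qed

lemma NN_sm_example:
  assumes "p \<in> overs example_core"
  shows "NN n wt (sm example_core p) = 0"
proof -
  have pr: "profile (sm example_core (Pass 0 Rgt Over)) =
      [(1, 1), (-1, 1), (1, -1), (1, -1), (-1, -1), (-1, -1), (-1, 1), (1, 1)]"
    "profile (sm example_core (Pass 1 Rgt Over)) =
      [(-1, 0), (-1, 1), (1, 1), (1, 0), (-1, -1), (1, -1), (-1, 0), (1, 0)]"
    "profile (sm example_core (Pass 2 Rgt Over)) =
      [(-1, 0), (1, 1), (1, 0), (-1, 0), (-1, 1), (1, 0), (1, -1), (-1, -1)]"
    "profile (sm example_core (Pass 3 Lft Over)) =
      [(1, 0), (1, 0), (1, -3), (-1, -3), (-1, 0), (-1, 0), (-1, 3), (1, 3)]"
    "profile (sm example_core (Pass 4 Lft Over)) =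
      [(-1, 0), (1, 0), (-1, 0), (1, 0), (-1, 0), (1, 0), (-1, 0), (1, 0)]"
    by code_simp+
  have "p \<in> set example_core" using assms by (simp add: overs_def)
  then have "distinct (sm example_core p)"
    using four_regular_sm[OF example_four_regular] four_regular_paired paired_distinct by blast
  then have "NN n wt (sm example_core p)
      = sum_list (map (\<lambda>(s, i). s * delta n i) (profile (sm example_core p)))"
    by (rule NN_profile)
  also have "\<dots> = 0" using assms unfolding overs_example by (auto simp: pr delta_neg_numeral simp del: One_nat_def)
  finally show ?thesis .
qed

lemma BB_list:
  assumes "paired w" "p \<in> set w"
  shows "BB k m w p = sum_list (map (\<lambda>q. if mate q \<in> set (arc w (mate p))
      then wt q * hit m (sum_list (map (\<lambda>(s, i). s * delta k i) (profile (dbl w p q)))) else 0) (arc w p))"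
proof -
  have "distinct (arc w p)" using paired_split_facts(2)[OF assms] by simp
  then have "sum_list (map (\<lambda>q. if mate q \<in> set (arc w (mate p))
        then wt q * hit m (sum_list (map (\<lambda>(s, i). s * delta k i) (profile (dbl w p q)))) else 0) (arc w p))
      = (\<Sum>q\<in>set (arc w p). if mate q \<in> set (arc w (mate p))
        then wt q * hit m (sum_list (map (\<lambda>(s, i). s * delta k i) (profile (dbl w p q)))) else 0)"
    by (rule sum_list_distinct_conv_sum_set)
  also have "\<dots> = (\<Sum>q\<in>chords w p. wt q * hit m (sum_list (map (\<lambda>(s, i). s * delta k i) (profile (dbl w p q)))))"
    unfolding chords_def by (rule sum.inter_filter[symmetric]) simp
  also have "\<dots> = BB k m w p"
    unfolding BB_def
    using NN_profile[OF paired_distinct[OF paired_dbl(1)[OF assms]]] by (intro sum.cong) simp_all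
  finally show ?thesis by simp
qed

text \<open>Crossings 1 and 4 have the same index and opposite signs, and so do 2 and 3. The flat
  span separates the partners: it is nonzero at 1 and 2 and zero at 3 and 4.\<close>

lemma BB_example:
  "BB 2 1 example_core (Pass 0 Rgt Over) = 0" "BB 2 1 example_core (Pass 1 Rgt Over) = -1"
  "BB 2 1 example_core (Pass 2 Rgt Over) = 1" "BB 2 1 example_core (Pass 3 Lft Over) = 0"
  "BB 2 1 example_core (Pass 4 Lft Over) = 0"
proof -
  note l = BB_list[OF four_regular_paired[OF example_four_regular]]
  show "BB 2 1 example_core (Pass 0 Rgt Over) = 0"
    by (subst l, code_simp, code_simp)
  show "BB 2 1 example_core (Pass 1 Rgt Over) = -1"
    by (subst l, code_simp, code_simp)
  show "BB 2 1 example_core (Pass 2 Rgt Over) = 1"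
    by (subst l, code_simp, code_simp)
  show "BB 2 1 example_core (Pass 3 Lft Over) = 0"
    by (subst l, code_simp, code_simp)
  show "BB 2 1 example_core (Pass 4 Lft Over) = 0"
    by (subst l, code_simp, code_simp)
qed

lemma overs_core: "overs (core w) = overs w"
  by (auto simp: overs_def set_core)

lemma wt_example:
  "wt (Pass v Lft Over) = 1" "wt (Pass v Rgt Over) = -1"
  by (simp_all add: wt_def)

lemma NN_sm_kept_example:
  assumes "p \<in> overs example_core"
  shows "NN n wt (sm example_core (kept \<kappa> p)) = 0"
  using kept_cases[of \<kappa> p] NN_sm_example[OF assms] sm_mate[OF example_four_regular, of p n] assms
  by (auto simp: overs_def)

lemma BB_kept_example:
  assumes "p \<in> overs example_core"
  shows "BB k m example_core (kept \<kappa> p) = (if \<kappa> = Keep_Over then 1 else -1) * BB k m example_core p"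
  using assms BB_mate[OF four_regular_paired[OF example_four_regular], of p k m]
  by (cases \<kappa>) (auto simp: overs_def kept_def)

lemma F_poly_example: "F_poly \<kappa> n example = 0"
proof -
  note fr = knot_diagram_four_regular[OF example_knot_diagram]
  have ov: "overs example = overs example_core" using overs_core[of example] core_example by simp
  have data: "data_eq example_core p example p" if "p \<in> set example" "level p \<noteq> Virt" for p
    using data_eq_core[OF fr that] core_example by simp
  have fin: "finite (crossings example)" using crossings_overs(1)[OF fr] by simp
  have N: "nabla_J n example = 0"
    using nabla_J_NN[OF fr, of n] NN_core[OF four_regular_paired[OF fr], of n] NN_example core_example by simp
  have A: "nabla_J n (smooth1 \<kappa> example (vert p)) = 0" "Ind example (vert p) = idx example_core p"
    if p: "p \<in> overs example" for p
  proof -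
    have k: "kept \<kappa> p \<in> set example" "level (kept \<kappa> p) \<noteq> Virt"
      using kept_in[OF fr p] by (auto simp: kept_def)
    show "nabla_J n (smooth1 \<kappa> example (vert p)) = 0"
      using nabla_J_smooth1[OF fr p, of n \<kappa>] data[OF k] NN_sm_kept_example[of p n \<kappa>] p ov
      by (simp add: data_eq_def)
    show "Ind example (vert p) = idx example_core p"
      using Ind_over[OF fr p] data[of p] kept_in[OF fr p] by (simp add: data_eq_def)
  qed
  have "F_poly \<kappa> n example = (\<Sum>p\<in>overs example.
      Poly_Mapping.single (idx example_core p, 0) (wt p) - Poly_Mapping.single (0, 0) (wt p))"
    unfolding F_poly_def T_set_def sum_filter_split[OF fin]
    unfolding sum_crossings[OF fr]
    by (intro sum.cong refl) (simp add: A N crossing_sgn_over[OF fr])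
  \<comment> \<open>Crossing 0 has index 0 and cancels itself; the others cancel in the pairs 1, 4
    and 2, 3.\<close>
  also have "\<dots> = 0"
    unfolding ov
    by (rule poly_mapping_eqI, unfold Poly_Mapping.lookup_sum overs_example)
      (simp add: wt_example idx_example lookup_minus lookup_single when_def del: One_nat_def)
  finally show ?thesis .
qed

lemma F_tilde_example: "F_tilde \<kappa>\<^sub>1 \<kappa>\<^sub>2 \<kappa>\<^sub>3 1 2 1 example \<noteq> 0"
proof -
  note fr = knot_diagram_four_regular[OF example_knot_diagram]
  \<comment> \<open>The convention of the type-2 smoothing can only change the sign of the flat
    spans; \<open>?e\<close> is the resulting exponent of \<open>v\<close> at crossing 1.\<close>
  let ?e = "if \<kappa>\<^sub>2 = Keep_Over then 1 else -1 :: int"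
  have F: "F_tilde \<kappa>\<^sub>1 \<kappa>\<^sub>2 \<kappa>\<^sub>3 1 2 1 example = FT \<kappa>\<^sub>1 \<kappa>\<^sub>2 1 2 1 example_core"
    using F_tilde_FT[OF fr, of \<kappa>\<^sub>1 \<kappa>\<^sub>2 \<kappa>\<^sub>3 1 2 1] FT_core[OF fr, of \<kappa>\<^sub>1 \<kappa>\<^sub>2 1 2 1] core_example by simp
  have "FT \<kappa>\<^sub>1 \<kappa>\<^sub>2 1 2 1 example_core = (\<Sum>p\<in>overs example_core.
      contr 0 (wt p) (idx example_core p) 0 (- (?e * BB 2 1 example_core p)))"
    unfolding FT_def term_of_def
    by (intro sum.cong refl) (simp add: NN_example NN_sm_kept_example BB_kept_example)
  \<comment> \<open>The term of crossing 1 survives: its partner, crossing 4, has exponent 0 in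
    \<open>v\<close>, and all subtracted terms have exponent 0 in \<open>t\<close>.\<close>
  also have "Poly_Mapping.lookup \<dots> (1, 0, ?e) = -1"
    unfolding Poly_Mapping.lookup_sum overs_example
    by (simp add: wt_example idx_example BB_example contr_def lookup_add lookup_minus lookup_single when_def
        del: One_nat_def)
  finally have "Poly_Mapping.lookup (F_tilde \<kappa>\<^sub>1 \<kappa>\<^sub>2 \<kappa>\<^sub>3 1 2 1 example) (1, 0, ?e) = -1" unfolding F .
  then show ?thesis by auto
qed

lemma empty_knot_diagram: "knot_diagram []"
  by (simp add: knot_diagram_def four_regular_def planar_def)

lemma virtual_knot_of:
  assumes "knot_diagram w"
  obtains K where "K \<in> virtual_knots" "w \<in> K"
proof -
  let ?r = "{(w, w'). knot_diagram w \<and> knot_diagram w' \<and> equivalent w w'}"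
  have "?r `` {w} \<in> virtual_knots" unfolding virtual_knots_def by (rule quotientI) (simp add: assms)
  moreover have "w \<in> ?r `` {w}" using assms by (simp add: equivalent_def)
  ultimately show ?thesis using that by blast
qed

theorem theorem6:
  fixes \<kappa>\<^sub>1 \<kappa>\<^sub>2 \<kappa>\<^sub>3 :: convention
  shows
    "(\<forall>n k m. n \<noteq> 0 \<and> k \<noteq> 0 \<longrightarrow> knot_invariant (F_tilde \<kappa>\<^sub>1 \<kappa>\<^sub>2 \<kappa>\<^sub>3 n k m))
     \<and> (\<forall>K\<in>virtual_knots. \<forall>K'\<in>virtual_knots.
          (\<exists>n. n \<noteq> 0 \<and> distinguishes (F_poly \<kappa>\<^sub>1 n) K K')
          \<longrightarrow> (\<exists>n k m. n \<noteq> 0 \<and> k \<noteq> 0 \<and> distinguishes (F_tilde \<kappa>\<^sub>1 \<kappa>\<^sub>2 \<kappa>\<^sub>3 n k m) K K'))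
     \<and> (\<exists>K\<in>virtual_knots. \<exists>K'\<in>virtual_knots.
          (\<forall>n. n \<noteq> 0 \<longrightarrow> \<not> distinguishes (F_poly \<kappa>\<^sub>1 n) K K')
          \<and> (\<exists>n k m. n \<noteq> 0 \<and> k \<noteq> 0 \<and> distinguishes (F_tilde \<kappa>\<^sub>1 \<kappa>\<^sub>2 \<kappa>\<^sub>3 n k m) K K'))"
proof (intro conjI)
  show "\<forall>n k m. n \<noteq> 0 \<and> k \<noteq> 0 \<longrightarrow> knot_invariant (F_tilde \<kappa>\<^sub>1 \<kappa>\<^sub>2 \<kappa>\<^sub>3 n k m)"
    unfolding knot_invariant_def using F_tilde_invariant by blast
  show "\<forall>K\<in>virtual_knots. \<forall>K'\<in>virtual_knots.
      (\<exists>n. n \<noteq> 0 \<and> distinguishes (F_poly \<kappa>\<^sub>1 n) K K')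
      \<longrightarrow> (\<exists>n k m. n \<noteq> 0 \<and> k \<noteq> 0 \<and> distinguishes (F_tilde \<kappa>\<^sub>1 \<kappa>\<^sub>2 \<kappa>\<^sub>3 n k m) K K')"
    using F_tilde_stronger by blast
  obtain K where K: "K \<in> virtual_knots" "example \<in> K" using virtual_knot_of[OF example_knot_diagram] .
  obtain K' where K': "K' \<in> virtual_knots" "[] \<in> K'" using virtual_knot_of[OF empty_knot_diagram] .
  have zero: "F_poly \<kappa>\<^sub>1 n [] = 0" "F_tilde \<kappa>\<^sub>1 \<kappa>\<^sub>2 \<kappa>\<^sub>3 n k m [] = 0" for n k m
    by (simp_all add: F_poly_def T_set_def F_tilde_def T_tilde_def crossings_def)
  have "\<not> distinguishes (F_poly \<kappa>\<^sub>1 n) K K'" for n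
    unfolding distinguishes_def using K(2) K'(2) F_poly_example zero(1) by metis
  moreover have "distinguishes (F_tilde \<kappa>\<^sub>1 \<kappa>\<^sub>2 \<kappa>\<^sub>3 1 2 1) K K'"
    unfolding distinguishes_def
    using F_tilde_invariant[OF K(1) _ K(2)] F_tilde_invariant[OF K'(1) _ K'(2)] F_tilde_example zero(2) by metis
  ultimately show "\<exists>K\<in>virtual_knots. \<exists>K'\<in>virtual_knots.
      (\<forall>n. n \<noteq> 0 \<longrightarrow> \<not> distinguishes (F_poly \<kappa>\<^sub>1 n) K K')
      \<and> (\<exists>n k m. n \<noteq> 0 \<and> k \<noteq> 0 \<and> distinguishes (F_tilde \<kappa>\<^sub>1 \<kappa>\<^sub>2 \<kappa>\<^sub>3 n k m) K K')"
    using K(1) K'(1) by (metis one_neq_zero zero_neq_numeral)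
qed

end
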